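(* Fix $\rho\ge1$ and $\mu>0$. For each $d$, let $\boldsymbol\alpha$ be a random variable distributed as $\|x\|_2$ with $x\sim\mathcal N(0,I_d/d)$, and for $m\in\mathbb{R}$ define $$\check{\mathrm{Cross}}_d(\rho;m):=\mathbb{E}\big\|\mathbb{E}[\check u\check u^\top\mid\check M]\big\|_F^2,\qquad \check M=W+\sqrt\rho\,\check u\check u^\top,$$ where $\check u$ has i.i.d. coordinates $\check u_i\sim\mathcal N(m/\sqrt d,1/d)$ and $W$ is an independent GOE matrix as in the context. Then $$\lim_{d\to\infty}\mathbb{E}_{\boldsymbol\alpha}\big[\mathbb{I}(|\boldsymbol\alpha-1|\le d^{-1/4})\,\check{\mathrm{Cross}}_d(\rho;\mu\boldsymbol\alpha)\big]\le\Big(1+\mu^2-\frac1\rho+\frac{|\mu|}{\sqrt\rho}\Big)^2.$$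
   Context: GOE matrix: $d\times d$ symmetric with independent entries $W_{ii}\sim\mathcal N(0,2/d)$ and $W_{ij}\sim\mathcal N(0,1/d)$ for $i<j$. $\|\cdot\|_F$ is the Frobenius norm. *)

theory Defs
  imports "HOL-Probability.Probability"
begin

definition spike_law :: "nat \<Rightarrow> real \<Rightarrow> (nat \<Rightarrow> real) measure" where
  "spike_law d m = PiM {..<d} (\<lambda>i. density lborel (normal_density (m / sqrt (real d)) (sqrt (1 / real d))))"

definition goe_law :: "nat \<Rightarrow> (nat \<times> nat \<Rightarrow> real) measure" where
  "goe_law d = PiM {(i, j). i \<le> j \<and> j < d}
     (\<lambda>(i, j). density lborel (normal_density 0 (if i = j then sqrt (2 / real d) else sqrt (1 / real d))))"

definition goe_matrix :: "(nat \<times> nat \<Rightarrow> real) \<Rightarrow> nat \<Rightarrow> nat \<Rightarrow> real" where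
  "goe_matrix w i j = w (min i j, max i j)"

definition cross_space :: "nat \<Rightarrow> real \<Rightarrow> ((nat \<Rightarrow> real) \<times> (nat \<times> nat \<Rightarrow> real)) measure" where
  "cross_space d m = spike_law d m \<Otimes>\<^sub>M goe_law d"

definition obs :: "nat \<Rightarrow> real \<Rightarrow> (nat \<Rightarrow> real) \<times> (nat \<times> nat \<Rightarrow> real) \<Rightarrow> (nat \<times> nat \<Rightarrow> real)" where
  "obs d \<rho> \<omega> = (\<lambda>(i, j) \<in> {..<d} \<times> {..<d}. goe_matrix (snd \<omega>) i j + sqrt \<rho> * fst \<omega> i * fst \<omega> j)"

definition obs_sigma :: "nat \<Rightarrow> real \<Rightarrow> real \<Rightarrow> ((nat \<Rightarrow> real) \<times> (nat \<times> nat \<Rightarrow> real)) measure" where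
  "obs_sigma d \<rho> m = vimage_algebra (space (cross_space d m)) (obs d \<rho>)
      (PiM ({..<d} \<times> {..<d}) (\<lambda>_. borel))"

definition cross_check :: "nat \<Rightarrow> real \<Rightarrow> real \<Rightarrow> real" where
  "cross_check d \<rho> m =
     (\<integral>\<omega>. (\<Sum>i<d. \<Sum>j<d.
        (real_cond_exp (cross_space d m) (obs_sigma d \<rho> m) (\<lambda>\<omega>'. fst \<omega>' i * fst \<omega>' j) \<omega>)\<^sup>2)
      \<partial>cross_space d m)"

definition iso_gauss :: "nat \<Rightarrow> (nat \<Rightarrow> real) measure" where
  "iso_gauss d = PiM {..<d} (\<lambda>i. density lborel (normal_density 0 (sqrt (1 / real d))))"

definition euclid_norm :: "nat \<Rightarrow> (nat \<Rightarrow> real) \<Rightarrow> real" where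
  "euclid_norm d x = sqrt (\<Sum>i<d. (x i)\<^sup>2)"

definition truncated_cross :: "real \<Rightarrow> real \<Rightarrow> nat \<Rightarrow> real" where
  "truncated_cross \<rho> \<mu> d =
     (\<integral>x. (if \<bar>euclid_norm d x - 1\<bar> \<le> real d powr (-1/4) then 1 else 0)
          * cross_check d \<rho> (\<mu> * euclid_norm d x) \<partial>iso_gauss d)"

end

theory Submission
  imports Defs
begin

text \<open>Write \<open>v\<close>, \<open>C\<close>, \<open>K = C - v v\<^sup>T\<close> for the posterior mean, second moment and covariance of
  the spike, \<open>X = |v|\<^sup>2\<close> and \<open>E |C|\<^sup>2\<close> for the quantity of interest.

  (1) An observation at signal-to-noise ratio \<open>\<rho>\<close> splits into independent ones at \<open>\<rho>'\<close> and
  \<open>\<rho> - \<rho>'\<close>, so \<open>E |C|\<^sup>2\<close> and \<open>E X\<close> increase with \<open>\<rho>\<close>. The increment of \<open>E X\<close> bounds from above the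
  posterior covariance of \<open>u\<close> with \<open>u u\<^sup>T\<close>. As \<open>E X\<close> stays bounded, every interval of ratios
  contains some \<open>\<rho>'\<close> at which this covariance is small, and contracting it with the direction of the
  mean (here \<open>m \<noteq> 0\<close> enters) shows that \<open>E |K|\<^sup>2\<close> is small there.

  (2) Stein's identity for the Gaussian prior under the posterior and integration by parts in the
  noise give, when \<open>K\<close> is negligible, \<open>E \<phi>(X) f(X) \<approx> 0\<close> for
  \<open>f(X) = \<rho> X\<^sup>2 + (1 - \<rho> (1 + m\<^sup>2)) X - m\<^sup>2\<close>. This quadratic has a single positive root \<open>q\<close>, and
  \<open>\<phi>(X) = X - q\<close> forces \<open>X \<rightarrow> q\<close> in mean square, so \<open>E |C|\<^sup>2 \<approx> q\<^sup>2\<close> at \<open>\<rho>'\<close>.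

  (3) Monotonicity in \<open>\<rho>\<close> transfers this from nearby ratios on both sides to \<open>\<rho>\<close>, uniformly for
  \<open>m\<close> near \<open>\<mu>\<close>, and the norm of \<open>N(0, I/d)\<close> concentrates at \<open>1\<close>. The limit is \<open>q\<^sup>2\<close>, and
  \<open>q \<le> 1 + \<mu>\<^sup>2 - 1/\<rho> + \<mu>/\<surd>\<rho>\<close> by subadditivity of the square root.\<close>

section \<open>Stein's identity\<close>

text \<open>The obstacle is that smallness of the posterior covariance is only known on average over
  signal-to-noise ratios. The concentration argument therefore runs at a nearby ratio of unknown
  position, and monotonicity carries the result back from both sides. In place of a derivative in
  the ratio, finite increments are compared: an interval of length \<open>\<epsilon>\<close> is cut
  into \<open>d\<close> steps of length \<open>\<epsilon> / d\<close>. This length is dictated by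
  the fluctuation of the signal in units of the noise (\<open>spread\<close>), which is of order
  \<open>d\<close>: with such steps the drift part of the test statistic stays of the same order as
  its noise part. Some step gains at most order \<open>1 / d\<close>, and this makes
  \<open>third_energy\<close> of order \<open>1 / sqrt d\<close>. A second obstacle is that the mean
  of the spike is itself random in \<open>truncated_cross\<close>. A limit for each fixed mean would
  not be enough, so all errors are explicit rates that depend on the mean only through an interval
  of positive numbers, and measurability in the mean is proved separately.\<close>

lemma integral_derivative_eq_0:
  fixes F F' :: "real \<Rightarrow> real"
  assumes deriv: "\<And>x. (F has_real_derivative F' x) (at x)"
    and cont: "\<And>x. isCont F' x"
    and F: "integrable lborel F" and F': "integrable lborel F'"
  shows "(\<integral>x. F' x \<partial>lborel) = 0"
proof -
  have [measurable]: "F' \<in> borel_measurable borel" using F' by auto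
  \<comment> \<open>Integrating \<open>F' (x + t)\<close> over \<open>t\<close> in the unit interval
    first gives \<open>F (x + 1) - F x\<close>, whose integral vanishes by translation invariance;
    integrating over \<open>x\<close> first gives the integral of \<open>F'\<close>. Fubini thus
    takes the place of limits of \<open>F\<close> at infinity.\<close>
  define f where "f = (\<lambda>t x. indicator {0..1} t * F' (x + t))"
  have shift: "integrable lborel (\<lambda>x. G (x + t))" "(\<integral>x. G (x + t) \<partial>lborel) = (\<integral>x. G x \<partial>lborel)"
    if "integrable lborel G" for G :: "real \<Rightarrow> real" and t :: real
    using lborel_integrable_real_affine[OF that, of 1 t] lborel_integral_real_affine[of 1 G t]
    by (simp_all add: add.commute)
  have int: "integrable (lborel \<Otimes>\<^sub>M lborel) (case_prod f)"
  proof (rule lborel_pair.Fubini_integrable)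
    show "case_prod f \<in> borel_measurable (lborel \<Otimes>\<^sub>M lborel)" unfolding f_def by measurable
    have "(\<lambda>t. \<integral>x. norm (f t x) \<partial>lborel) = (\<lambda>t. indicator {0..1} t * (\<integral>x. \<bar>F' x\<bar> \<partial>lborel))"
      using shift(2)[of "\<lambda>x. \<bar>F' x\<bar>"] F' by (auto simp: f_def abs_mult indicator_def)
    then show "integrable lborel (\<lambda>x. \<integral>y. norm (case (x, y) of (x, xa) \<Rightarrow> f x xa) \<partial>lborel)"
      by simp
    show "AE x in lborel. integrable lborel (\<lambda>y. case (x, y) of (x, xa) \<Rightarrow> f x xa)"
      using shift(1)[OF F'] by (simp add: f_def)
  qed
  have ftc: "(\<integral>t. f t x \<partial>lborel) = F (x + 1) - F x" for x
  proof -
    have "has_bochner_integral lborel (\<lambda>t. F' (x + t) * indicator {0..1} t) (F (x + 1) - F (x + 0))"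
    proof (rule has_bochner_integral_FTC_Icc_real)
      show "((\<lambda>t. F (x + t)) has_real_derivative F' (x + t)) (at t)" for t
        using DERIV_chain2[OF deriv, where g="\<lambda>t. x + t" and x=t and Db=1 and s=UNIV]
        by (simp add: DERIV_add[OF DERIV_const DERIV_ident, of x, simplified])
      show "isCont (\<lambda>t. F' (x + t)) t" for t
        by (rule isCont_o2[OF _ cont]) (auto intro!: continuous_intros)
    qed simp
    then show ?thesis by (simp add: f_def has_bochner_integral_iff mult.commute)
  qed
  have "0 = (\<integral>x. F (x + 1) - F x \<partial>lborel)"
    using shift[OF F, of 1] F by simp
  also have "\<dots> = (\<integral>x. (\<integral>t. f t x \<partial>lborel) \<partial>lborel)" by (simp add: ftc)
  also have "\<dots> = (\<integral>t. (\<integral>x. f t x \<partial>lborel) \<partial>lborel)"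
    by (rule lborel_pair.Fubini_integral[OF int])
  also have "\<dots> = (\<integral>t. indicator {0..1} (t::real) * (\<integral>x. F' x \<partial>lborel) \<partial>lborel)"
    by (simp add: f_def shift(2)[OF F'])
  also have "\<dots> = (\<integral>x. F' x \<partial>lborel)"
  proof -
    have "measure lborel {0..1::real} = 1" using content_real[of 0 1] by simp
    then show ?thesis by simp
  qed
  finally show ?thesis by simp
qed

abbreviation normal_law :: "real \<Rightarrow> real \<Rightarrow> real measure" where
  "normal_law m s \<equiv> density lborel (\<lambda>x. ennreal (normal_density m s x))"

lemma normal_density_deriv:
  assumes "\<sigma> > 0"
  shows "(normal_density m \<sigma> has_real_derivative (- ((x - m) / \<sigma>\<^sup>2) * normal_density m \<sigma> x)) (at x)"
proof -
  have "((\<lambda>x. c * exp (- (x - m)\<^sup>2 / (2 * \<sigma>\<^sup>2))) has_real_derivative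
     (- ((x - m) / \<sigma>\<^sup>2) * (c * exp (- (x - m)\<^sup>2 / (2 * \<sigma>\<^sup>2))))) (at x)" for c
    using assms by (auto intro!: derivative_eq_intros simp: power2_eq_square field_simps)
  then show ?thesis
    unfolding normal_density_def [abs_def] .
qed

text \<open>The derivative of \<open>g\<close> times the density integrates to zero; differentiating
  the density is what produces the factor \<open>x - m\<close>.\<close>

lemma stein_normal:
  fixes g g' :: "real \<Rightarrow> real"
  assumes \<sigma>: "\<sigma> > 0"
    and deriv: "\<And>x. (g has_real_derivative g' x) (at x)"
    and cont: "\<And>x. isCont g' x"
    and g: "integrable (normal_law m \<sigma>) g"
    and xg: "integrable (normal_law m \<sigma>) (\<lambda>x. (x - m) * g x)"
    and g': "integrable (normal_law m \<sigma>) g'"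
  shows "(\<integral>x. (x - m) * g x \<partial>normal_law m \<sigma>) = \<sigma>\<^sup>2 * (\<integral>x. g' x \<partial>normal_law m \<sigma>)"
proof -
  let ?n = "normal_density m \<sigma>"
  define F where "F = (\<lambda>x. ?n x * g x)"
  define F' where "F' = (\<lambda>x. ?n x * g' x - ?n x * ((x - m) * g x) / \<sigma>\<^sup>2)"
  have [measurable]: "g \<in> borel_measurable borel" "g' \<in> borel_measurable borel"
    using g g' by auto
  have i: "integrable lborel (\<lambda>x. ?n x * g x)" "integrable lborel (\<lambda>x. ?n x * g' x)"
      "integrable lborel (\<lambda>x. ?n x * ((x - m) * g x))"
    using g xg g' by (simp_all add: integrable_density)
  have nc: "isCont ?n x" for x
    using normal_density_deriv[OF \<sigma>] by (rule DERIV_isCont)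
  have gc: "isCont g x" for x using deriv by (rule DERIV_isCont)
  have "(\<integral>x. F' x \<partial>lborel) = 0"
  proof (rule integral_derivative_eq_0)
    show "(F has_real_derivative F' x) (at x)" for x
      unfolding F_def F'_def
      by (rule derivative_eq_intros normal_density_deriv[OF \<sigma>] deriv refl)+ (simp add: field_simps)
    show "isCont F' x" for x unfolding F'_def using \<sigma> by (intro continuous_intros nc gc cont) simp
    show "integrable lborel F" "integrable lborel F'" unfolding F_def F'_def using i by auto
  qed
  then have "(\<integral>x. ?n x * g' x \<partial>lborel) = (\<integral>x. ?n x * ((x - m) * g x) \<partial>lborel) / \<sigma>\<^sup>2"
    using i by (simp add: F'_def)
  then show ?thesis using \<sigma> by (simp add: integral_density field_simps)
qed

text \<open>Coordinate \<open>i\<close> is integrated first with the others frozen. Integrability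
  under the product law passes to almost every slice, and \<open>stein_normal\<close> applies
  there.\<close>

lemma stein_PiM:
  fixes g g' :: "('i \<Rightarrow> real) \<Rightarrow> real"
  assumes I: "finite I" "i \<in> I" and \<sigma>: "\<And>j. \<sigma> j > 0"
    and deriv: "\<And>x t. ((\<lambda>t. g (x(i := t))) has_real_derivative g' (x(i := t))) (at t)"
    and cont: "\<And>x t. isCont (\<lambda>t. g' (x(i := t))) t"
    and g: "integrable (PiM I (\<lambda>j. normal_law (m j) (\<sigma> j))) g"
    and xg: "integrable (PiM I (\<lambda>j. normal_law (m j) (\<sigma> j))) (\<lambda>x. (x i - m i) * g x)"
    and g': "integrable (PiM I (\<lambda>j. normal_law (m j) (\<sigma> j))) g'"
  shows "(\<integral>x. (x i - m i) * g x \<partial>PiM I (\<lambda>j. normal_law (m j) (\<sigma> j)))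
       = (\<sigma> i)\<^sup>2 * (\<integral>x. g' x \<partial>PiM I (\<lambda>j. normal_law (m j) (\<sigma> j)))"
proof -
  let ?N = "\<lambda>j. normal_law (m j) (\<sigma> j)"
  define J where "J = I - {i}"
  have J: "finite J" "i \<notin> J" "I = insert i J" using I by (auto simp: J_def)
  interpret product_prob_space ?N UNIV
    by (simp add: product_prob_space_def product_sigma_finite_def prob_space_imp_sigma_finite
        product_prob_space_axioms_def prob_space_normal_density \<sigma>)
  have slice: "AE x in PiM J ?N. integrable (?N i) (\<lambda>t. h (x(i := t)))"
    if h: "integrable (PiM I ?N) h" for h :: "_ \<Rightarrow> real"
  proof -
    have [measurable]: "h \<in> borel_measurable (PiM (insert i J) ?N)" using h J by auto
    have "(\<integral>\<^sup>+ x. (\<integral>\<^sup>+ y. norm (h (x(i := y))) \<partial>?N i) \<partial>PiM J ?N) < \<infinity>"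
      using h J by (simp add: product_nn_integral_insert integrable_iff_bounded)
    then have *: "AE x in PiM J ?N. (\<integral>\<^sup>+ y. norm (h (x(i := y))) \<partial>?N i) \<noteq> \<infinity>"
      by (intro nn_integral_PInf_AE) (auto)
    have **: "\<forall>x\<in>space (PiM J ?N). (\<lambda>t. h (x(i := t))) \<in> borel_measurable (?N i)"
    proof
      fix x assume x: "x \<in> space (PiM J ?N)"
      have "(\<lambda>t. x(i := t)) \<in> measurable (?N i) (PiM (insert i J) ?N)"
        by (rule measurable_fun_upd[where J=J and f="\<lambda>_. x" and h="\<lambda>t. t"]) (use x in simp_all)
      then show "(\<lambda>t. h (x(i := t))) \<in> borel_measurable (?N i)"
        by (rule measurable_compose) measurable
    qed
    show ?thesis
      using *
    proof (rule AE_mp, intro AE_I2 impI)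
      fix x assume x: "x \<in> space (PiM J ?N)" and fin: "(\<integral>\<^sup>+ y. norm (h (x(i := y))) \<partial>?N i) \<noteq> \<infinity>"
      show "integrable (?N i) (\<lambda>t. h (x(i := t)))"
        using bspec[OF ** x] fin unfolding integrable_iff_bounded by (simp only: less_top infinity_ennreal_def simp_thms)
    qed
  qed
  have "(\<integral>x. (x i - m i) * g x \<partial>PiM I ?N)
      = (\<integral>x. (\<integral>y. (y - m i) * g (x(i := y)) \<partial>?N i) \<partial>PiM J ?N)"
    using product_integral_insert[OF J(1,2), of "\<lambda>x. (x i - m i) * g x"] xg J(3) by simp
  also have "\<dots> = (\<integral>x. (\<sigma> i)\<^sup>2 * (\<integral>y. g' (x(i := y)) \<partial>?N i) \<partial>PiM J ?N)"
  proof (rule integral_cong_AE)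
    have [measurable]: "g \<in> borel_measurable (PiM (insert i J) ?N)" "g' \<in> borel_measurable (PiM (insert i J) ?N)"
      using g g' J by auto
    have upd: "(\<lambda>w. (fst w)(i := snd w)) \<in> measurable (PiM J ?N \<Otimes>\<^sub>M ?N i) (PiM (insert i J) ?N)"
      by (rule measurable_fun_upd[where J=J]) auto
    have u1: "(\<lambda>w. g ((fst w)(i := snd w))) \<in> borel_measurable (PiM J ?N \<Otimes>\<^sub>M borel)"
             "(\<lambda>w. g' ((fst w)(i := snd w))) \<in> borel_measurable (PiM J ?N \<Otimes>\<^sub>M borel)"
      using measurable_compose[OF upd, of g borel] measurable_compose[OF upd, of g' borel]
      by (auto cong: measurable_cong_sets)
    show "(\<lambda>x. \<integral>y. (y - m i) * g (x(i := y)) \<partial>?N i) \<in> borel_measurable (PiM J ?N)"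
      by (intro M.borel_measurable_lebesgue_integral) (use u1 in \<open>auto simp: case_prod_beta' cong: measurable_cong_sets\<close>)
    show "(\<lambda>x. (\<sigma> i)\<^sup>2 * (\<integral>y. g' (x(i := y)) \<partial>?N i)) \<in> borel_measurable (PiM J ?N)"
      by (intro borel_measurable_times borel_measurable_const M.borel_measurable_lebesgue_integral)
        (use u1 in \<open>auto simp: case_prod_beta' cong: measurable_cong_sets\<close>)
    show "AE x in PiM J ?N. (\<integral>y. (y - m i) * g (x(i := y)) \<partial>?N i)
        = (\<sigma> i)\<^sup>2 * (\<integral>y. g' (x(i := y)) \<partial>?N i)"
      using slice[OF g] slice[OF xg] slice[OF g']
    proof eventually_elim
      case (elim x)
      show ?case
        by (rule stein_normal[OF \<sigma> deriv cont elim(1) _ elim(3)]) (use elim(2) in simp)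
    qed
  qed
  also have "\<dots> = (\<sigma> i)\<^sup>2 * (\<integral>x. g' x \<partial>PiM I ?N)"
    using product_integral_insert[OF J(1,2), of g'] g' J(3) by simp
  finally show ?thesis .
qed

section \<open>Finite moments of all orders\<close>

text \<open>This class is closed under sums, products and, later, posterior averaging, so
  integrability of the many polynomial error terms follows from their shape alone.\<close>

definition moments :: "'a measure \<Rightarrow> ('a \<Rightarrow> real) \<Rightarrow> bool" where
  "moments M f \<longleftrightarrow> f \<in> borel_measurable M \<and> (\<forall>n. integrable M (\<lambda>x. \<bar>f x\<bar> ^ n))"

lemma moments_measurable: "moments M f \<Longrightarrow> f \<in> borel_measurable M"
  by (simp add: moments_def)

lemma moments_integrable_abs_power: "moments M f \<Longrightarrow> integrable M (\<lambda>x. \<bar>f x\<bar> ^ n)"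
  by (simp add: moments_def)

lemma moments_integrable: "moments M f \<Longrightarrow> integrable M f"
  by (rule integrable_abs_cancel[OF moments_integrable_abs_power[of M f 1, simplified power_one_right]
        moments_measurable])

lemma moments_bound:
  assumes f: "f \<in> borel_measurable M" and g: "\<And>n. integrable M (g n)"
    and le: "\<And>n x. x \<in> space M \<Longrightarrow> \<bar>f x\<bar> ^ n \<le> g n x"
  shows "moments M f"
  unfolding moments_def
proof (intro conjI allI)
  show "integrable M (\<lambda>x. \<bar>f x\<bar> ^ n)" for n
    by (rule Bochner_Integration.integrable_bound[OF g[of n]])
      (use f le in \<open>auto intro!: AE_I2 order_trans[OF _ abs_ge_self] simp: power_abs\<close>)
qed (fact f)

lemma moments_mult:
  assumes f: "moments M f" and g: "moments M g"
  shows "moments M (\<lambda>x. f x * g x)"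
proof (rule moments_bound)
  show "(\<lambda>x. f x * g x) \<in> borel_measurable M"
    by (intro borel_measurable_times moments_measurable f g)
  show "integrable M (\<lambda>x. \<bar>f x\<bar> ^ (2 * n) + \<bar>g x\<bar> ^ (2 * n))" for n
    using f g by (auto intro: moments_integrable_abs_power)
  show "\<bar>f x * g x\<bar> ^ n \<le> \<bar>f x\<bar> ^ (2 * n) + \<bar>g x\<bar> ^ (2 * n)" for n x
  proof -
    have "a * b \<le> a\<^sup>2 + b\<^sup>2" if "a \<ge> 0" "b \<ge> 0" for a b :: real
      using sum_squares_bound[of a b] mult_nonneg_nonneg[OF that] by linarith
    from this[of "\<bar>f x\<bar> ^ n" "\<bar>g x\<bar> ^ n"] show ?thesis
      by (simp add: abs_mult power_mult_distrib power_mult mult.commute[of 2] del: power_abs)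
  qed
qed

lemma moments_add:
  assumes f: "moments M f" and g: "moments M g"
  shows "moments M (\<lambda>x. f x + g x)"
proof (rule moments_bound)
  show "(\<lambda>x. f x + g x) \<in> borel_measurable M"
    by (intro borel_measurable_add moments_measurable f g)
  show "integrable M (\<lambda>x. 2 ^ n * (\<bar>f x\<bar> ^ n + \<bar>g x\<bar> ^ n))" for n
    using f g by (auto intro: moments_integrable_abs_power)
  show "\<bar>f x + g x\<bar> ^ n \<le> 2 ^ n * (\<bar>f x\<bar> ^ n + \<bar>g x\<bar> ^ n)" for n x
  proof -
    have "\<bar>f x + g x\<bar> ^ n \<le> (2 * max \<bar>f x\<bar> \<bar>g x\<bar>) ^ n"
      by (intro power_mono) auto
    also have "\<dots> \<le> 2 ^ n * (\<bar>f x\<bar> ^ n + \<bar>g x\<bar> ^ n)"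
      unfolding power_mult_distrib by (intro mult_left_mono) (auto simp: max_def)
    finally show ?thesis .
  qed
qed

lemma (in finite_measure) moments_const: "moments M (\<lambda>_. c)"
  by (simp add: moments_def)

lemma moments_uminus: "moments M f \<Longrightarrow> moments M (\<lambda>x. - f x)"
  by (simp add: moments_def)

lemma moments_diff: "moments M f \<Longrightarrow> moments M g \<Longrightarrow> moments M (\<lambda>x. f x - g x)"
  using moments_add[of M f "\<lambda>x. - g x"] moments_uminus[of M g] by simp

lemma moments_abs: "moments M f \<Longrightarrow> moments M (\<lambda>x. \<bar>f x\<bar>)"
  by (auto simp: moments_def intro: borel_measurable_abs)

lemma (in finite_measure) moments_power: "moments M f \<Longrightarrow> moments M (\<lambda>x. f x ^ n)"
  by (induction n) (auto intro: moments_mult moments_const)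

lemma (in finite_measure) moments_sum:
  "(\<And>i. i \<in> A \<Longrightarrow> moments M (f i)) \<Longrightarrow> moments M (\<lambda>x. \<Sum>i\<in>A. f i x)"
  by (induction A rule: infinite_finite_induct) (auto intro: moments_add moments_const)

lemma (in finite_measure) moments_divide: "moments M f \<Longrightarrow> moments M (\<lambda>x. f x / c)"
  using moments_mult[of M f "\<lambda>_. inverse c"] moments_const by (simp add: divide_inverse)

lemma (in finite_measure) moments_dominated:
  assumes "f \<in> borel_measurable M" "moments M g" "\<And>x. x \<in> space M \<Longrightarrow> \<bar>f x\<bar> \<le> g x"
  shows "moments M f"
proof (rule moments_bound)
  show "integrable M (\<lambda>x. \<bar>g x\<bar> ^ n)" for n using assms by (rule_tac moments_integrable_abs_power)
  show "\<bar>f x\<bar> ^ n \<le> \<bar>g x\<bar> ^ n" if "x \<in> space M" for n x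
    using assms(3)[OF that] by (intro power_mono) auto
qed fact

lemma moments_distr:
  assumes "T \<in> measurable M N" "f \<in> borel_measurable N"
  shows "moments (distr M N T) f \<longleftrightarrow> moments M (\<lambda>x. f (T x))"
  using assms by (auto simp: moments_def integrable_distr_eq)

lemmas (in finite_measure) moments_intros =
  moments_mult moments_add moments_const moments_uminus moments_diff moments_abs moments_power
  moments_sum moments_divide

lemma (in prob_space) expectation_power_even_le:
  assumes "moments M f"
  shows "expectation f ^ (2 * n) \<le> expectation (\<lambda>x. f x ^ (2 * n))"
  using assms by (intro jensens_inequality[where I=UNIV] convex_power_even)
    (auto intro!: moments_integrable moments_power)

lemma cauchy_schwarz_integral:
  fixes f g :: "'a \<Rightarrow> real"
  assumes "integrable M (\<lambda>x. (f x)\<^sup>2)" "integrable M (\<lambda>x. (g x)\<^sup>2)" "integrable M (\<lambda>x. f x * g x)"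
  shows "(\<integral>x. f x * g x \<partial>M)\<^sup>2 \<le> (\<integral>x. (f x)\<^sup>2 \<partial>M) * (\<integral>x. (g x)\<^sup>2 \<partial>M)"
proof -
  let ?a = "\<integral>x. (f x)\<^sup>2 \<partial>M" and ?b = "\<integral>x. f x * g x \<partial>M" and ?c = "\<integral>x. (g x)\<^sup>2 \<partial>M"
  have q: "0 \<le> s\<^sup>2 * ?a - 2 * s * t * ?b + t\<^sup>2 * ?c" for s t :: real
  proof -
    have "0 \<le> (\<integral>x. (s * f x - t * g x)\<^sup>2 \<partial>M)" by simp
    also have "\<dots> = (\<integral>x. s\<^sup>2 * (f x)\<^sup>2 - 2 * s * t * (f x * g x) + t\<^sup>2 * (g x)\<^sup>2 \<partial>M)"
      by (intro Bochner_Integration.integral_cong) (auto simp: power2_eq_square algebra_simps)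
    also have "\<dots> = s\<^sup>2 * ?a - 2 * s * t * ?b + t\<^sup>2 * ?c"
      using assms by simp
    finally show ?thesis .
  qed
  have a0: "0 \<le> ?a" and c0: "0 \<le> ?c" by auto
  show ?thesis
  proof (cases "?c = 0")
    case True
    have "?b = 0"
    proof (rule ccontr)
      assume b: "?b \<noteq> 0"
      \<comment> \<open>With \<open>?c = 0\<close> the quadratic form is affine in \<open>t\<close>;
        at \<open>s = 1\<close> this \<open>t\<close> gives it the value \<open>-1\<close>.\<close>
      show False using q[of 1 "(?a + 1) / (2 * ?b)"] b True a0 by (simp add: field_simps)
    qed
    then show ?thesis using True by simp
  next
    case False
    then have "?c > 0" using c0 by linarith
    \<comment> \<open>The choice \<open>s = ?c\<close>, \<open>t = ?b\<close> turns the form into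
      \<open>?c\<close> times the discriminant.\<close>
    moreover have "0 \<le> ?c * (?c * ?a - ?b\<^sup>2)"
      using q[of ?c ?b] by (simp add: power2_eq_square algebra_simps)
    ultimately show ?thesis by (simp add: zero_le_mult_iff mult.commute)
  qed
qed

lemma (in finite_measure) moments_cauchy_schwarz:
  assumes "moments M f" "moments M g"
  shows "\<bar>\<integral>x. f x * g x \<partial>M\<bar> \<le> sqrt (\<integral>x. (f x)\<^sup>2 \<partial>M) * sqrt (\<integral>x. (g x)\<^sup>2 \<partial>M)"
proof -
  have "(\<integral>x. f x * g x \<partial>M)\<^sup>2 \<le> (\<integral>x. (f x)\<^sup>2 \<partial>M) * (\<integral>x. (g x)\<^sup>2 \<partial>M)"
    by (rule cauchy_schwarz_integral) (intro moments_integrable moments_mult moments_power assms)+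
  then show ?thesis
    unfolding real_sqrt_mult[symmetric] by (rule real_le_rsqrt[of "\<bar>_\<bar>", simplified])
qed

section \<open>Gaussian channels\<close>

text \<open>One-dimensional Cameron-Martin formula: shifting a centred Gaussian is a change of
  density. The exponential is one factor of the likelihood ratio \<open>lik\<close>.\<close>

lemma nn_integral_normal_shift:
  assumes \<sigma>: "\<sigma> > 0" and [measurable]: "h \<in> borel_measurable borel"
  shows "(\<integral>\<^sup>+x. h (x + a) \<partial>normal_law 0 \<sigma>)
    = (\<integral>\<^sup>+x. h x * ennreal (exp ((x * a - a\<^sup>2 / 2) / \<sigma>\<^sup>2)) \<partial>normal_law 0 \<sigma>)"
proof -
  have dens: "normal_density 0 \<sigma> (x - a) = normal_density 0 \<sigma> x * exp ((x * a - a\<^sup>2 / 2) / \<sigma>\<^sup>2)" for x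
    using \<sigma> by (simp add: normal_density_def power2_eq_square field_simps flip: exp_add)
  have "(\<integral>\<^sup>+x. h (x + a) \<partial>normal_law 0 \<sigma>) = (\<integral>\<^sup>+x. ennreal (normal_density 0 \<sigma> x) * h (x + a) \<partial>lborel)"
    by (simp add: nn_integral_density)
  also have "\<dots> = (\<integral>\<^sup>+x. ennreal (normal_density 0 \<sigma> (x - a)) * h x \<partial>lborel)"
    by (subst nn_integral_real_affine[where c=1 and t="-a"]) auto
  also have "\<dots> = (\<integral>\<^sup>+x. h x * ennreal (exp ((x * a - a\<^sup>2 / 2) / \<sigma>\<^sup>2)) \<partial>normal_law 0 \<sigma>)"
    by (subst nn_integral_density) (auto simp: dens ennreal_mult mult_ac)
  finally show ?thesis .
qed

lemma moments_normal_law: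
  assumes "\<sigma> > 0"
  shows "moments (normal_law m \<sigma>) (\<lambda>x. x)"
proof -
  interpret prob_space "normal_law m \<sigma>" by (rule prob_space_normal_density) fact
  have "moments (normal_law m \<sigma>) (\<lambda>x. x - m)"
    using assms integrable_normal_moment_abs[of \<sigma> m]
    by (auto simp: moments_def integrable_density)
  from moments_add[OF this moments_const[of m]] show ?thesis by simp
qed

lemma has_real_derivative_integral:
  fixes h h' :: "real \<Rightarrow> 'a \<Rightarrow> real"
  assumes deriv: "\<And>s x. x \<in> space M \<Longrightarrow> ((\<lambda>s. h s x) has_real_derivative h' s x) (at s)"
    and int: "\<And>s. integrable M (h s)"
    and meas: "h' t \<in> borel_measurable M"
    and bound: "\<And>s x. x \<in> space M \<Longrightarrow> \<bar>s - t\<bar> \<le> 1 \<Longrightarrow> \<bar>h' s x\<bar> \<le> B x"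
    and B: "integrable M B"
  shows "((\<lambda>s. \<integral>x. h s x \<partial>M) has_real_derivative (\<integral>x. h' t x \<partial>M)) (at t)"
  unfolding has_field_derivative_iff tendsto_at_iff_sequentially comp_def
proof (intro allI impI)
  fix X :: "nat \<Rightarrow> real"
  assume X: "\<forall>i. X i \<in> UNIV - {t}" "X \<longlonglongrightarrow> t"
  \<comment> \<open>Members of the sequence farther than 1 from \<open>t\<close> are replaced by
    \<open>t + 1\<close>, so that the majorant is valid at every index; from some index on nothing
    is changed.\<close>
  define s where "s = (\<lambda>i. if \<bar>X i - t\<bar> \<le> 1 then X i else t + 1)"
  have s: "s i \<noteq> t" "\<bar>s i - t\<bar> \<le> 1" for i using X by (auto simp: s_def)
  have ev: "eventually (\<lambda>i. s i = X i) sequentially"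
    using tendstoD[OF X(2), of 1] by (auto simp: s_def dist_real_def elim: eventually_mono)
  have st: "s \<longlonglongrightarrow> t"
    using X(2) ev by (simp add: tendsto_cong)
  have "(\<lambda>i. \<integral>x. (h (s i) x - h t x) / (s i - t) \<partial>M) \<longlonglongrightarrow> (\<integral>x. h' t x \<partial>M)"
  proof (rule integral_dominated_convergence[where w=B])
    show "h' t \<in> borel_measurable M" "integrable M B" by fact+
    show "(\<lambda>x. (h (s i) x - h t x) / (s i - t)) \<in> borel_measurable M" for i
      using int[of "s i"] int[of t] by auto
    show "AE x in M. (\<lambda>i. (h (s i) x - h t x) / (s i - t)) \<longlonglongrightarrow> h' t x"
    proof (rule AE_I2)
      fix x assume "x \<in> space M"
      from deriv[OF this, of t] show "(\<lambda>i. (h (s i) x - h t x) / (s i - t)) \<longlonglongrightarrow> h' t x"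
        unfolding has_field_derivative_iff tendsto_at_iff_sequentially comp_def using s st by auto
    qed
    show "AE x in M. norm ((h (s i) x - h t x) / (s i - t)) \<le> B x" for i
    proof (rule AE_I2)
      fix x assume x: "x \<in> space M"
      have "norm (h (s i) x - h t x) \<le> B x * norm (s i - t)"
      proof (rule field_differentiable_bound[where S="{t - 1..t + 1}" and f'="\<lambda>s. h' s x"])
        show "((\<lambda>s. h s x) has_field_derivative h' z x) (at z within {t - 1..t + 1})" for z
          using deriv[OF x] by (rule has_field_derivative_at_within)
        show "norm (h' z x) \<le> B x" if "z \<in> {t - 1..t + 1}" for z
          using bound[OF x, of z] that by (auto simp: abs_le_iff)
      qed (use s[of i] in \<open>auto simp: abs_le_iff\<close>)
      then show "norm ((h (s i) x - h t x) / (s i - t)) \<le> B x"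
        using s[of i] by (simp add: divide_simps)
    qed
  qed
  moreover have "(\<integral>x. (h (s i) x - h t x) / (s i - t) \<partial>M)
      = ((\<integral>x. h (s i) x \<partial>M) - (\<integral>x. h t x \<partial>M)) / (s i - t)" for i
    by (simp only: integral_divide_zero Bochner_Integration.integral_diff[OF int int])
  ultimately have "(\<lambda>i. ((\<integral>x. h (s i) x \<partial>M) - (\<integral>x. h t x \<partial>M)) / (s i - t)) \<longlonglongrightarrow> (\<integral>x. h' t x \<partial>M)"
    by (simp only:)
  moreover have "eventually (\<lambda>i. ((\<integral>x. h (s i) x \<partial>M) - (\<integral>x. h t x \<partial>M)) / (s i - t)
      = ((\<integral>x. h (X i) x \<partial>M) - (\<integral>x. h t x \<partial>M)) / (X i - t)) sequentially"
    using ev by eventually_elim simp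
  ultimately show "(\<lambda>i. ((\<integral>x. h (X i) x \<partial>M) - (\<integral>x. h t x \<partial>M)) / (X i - t)) \<longlonglongrightarrow> (\<integral>x. h' t x \<partial>M)"
    by (simp add: tendsto_cong)
qed

text \<open>Two independent copies of a centred Gaussian have a rotationally invariant joint
  density, so the reflection with rows \<open>(c, s)\<close> and \<open>(s, -c)\<close> preserves
  their law.\<close>

lemma nn_integral_normal_rotate:
  fixes h :: "real \<times> real \<Rightarrow> ennreal"
  assumes \<sigma>: "\<sigma> > 0" and s: "s > 0" and cs: "c\<^sup>2 + s\<^sup>2 = 1"
    and [measurable]: "h \<in> borel_measurable (borel \<Otimes>\<^sub>M borel)"
  shows "(\<integral>\<^sup>+x. \<integral>\<^sup>+y. h (c * x + s * y, s * x + - c * y) \<partial>normal_law 0 \<sigma> \<partial>normal_law 0 \<sigma>)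
    = (\<integral>\<^sup>+x. \<integral>\<^sup>+y. h (x, y) \<partial>normal_law 0 \<sigma> \<partial>normal_law 0 \<sigma>)"
proof -
  let ?n = "normal_density 0 \<sigma>"
  have unfold2: "(\<integral>\<^sup>+x. \<integral>\<^sup>+y. g (x, y) \<partial>normal_law 0 \<sigma> \<partial>normal_law 0 \<sigma>)
      = (\<integral>\<^sup>+x. \<integral>\<^sup>+y. ennreal (?n x * ?n y) * g (x, y) \<partial>lborel \<partial>lborel)"
    if [measurable]: "g \<in> borel_measurable (borel \<Otimes>\<^sub>M borel)" for g :: "real \<times> real \<Rightarrow> ennreal"
    by (simp add: nn_integral_density nn_integral_cmult[symmetric] ennreal_mult mult_ac)
  have rot: "?n (c * a + s * b) * ?n (s * a + - c * b) = ?n a * ?n b" for a b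
  proof -
    have "(c * a + s * b)\<^sup>2 + (s * a + - c * b)\<^sup>2 = (c\<^sup>2 + s\<^sup>2) * (a\<^sup>2 + b\<^sup>2)"
      by (simp add: power2_eq_square algebra_simps)
    then have "(c * a + s * b)\<^sup>2 + (s * a + - c * b)\<^sup>2 = a\<^sup>2 + b\<^sup>2" by (simp only: cs mult_1)
    then have "- (c * a + s * b)\<^sup>2 / (2 * \<sigma>\<^sup>2) + - (s * a + - c * b)\<^sup>2 / (2 * \<sigma>\<^sup>2)
        = - a\<^sup>2 / (2 * \<sigma>\<^sup>2) + - b\<^sup>2 / (2 * \<sigma>\<^sup>2)"
      by (metis add_divide_distrib minus_add_distrib)
    then have "exp (- (c * a + s * b)\<^sup>2 / (2 * \<sigma>\<^sup>2)) * exp (- (s * a + - c * b)\<^sup>2 / (2 * \<sigma>\<^sup>2))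
        = exp (- a\<^sup>2 / (2 * \<sigma>\<^sup>2)) * exp (- b\<^sup>2 / (2 * \<sigma>\<^sup>2))"
      by (simp only: exp_add[symmetric])
    then show ?thesis by (simp add: normal_density_def)
  qed
  have e1: "s * x + - c * ((a - c * x) / s) = (x - c * a) / s" for x a
  proof -
    have "s * x + - c * ((a - c * x) / s) = ((c\<^sup>2 + s\<^sup>2) * x - c * a) / s"
      using s by (simp add: field_simps power2_eq_square)
    then show ?thesis by (simp add: cs)
  qed
  have e2: "(a - c * (c * a + s * b)) / s = s * a + - c * b" for a b
  proof -
    have "a - c * (c * a + s * b) = (1 - c\<^sup>2) * a - c * s * b" by (simp add: power2_eq_square algebra_simps)
    also have "1 - c\<^sup>2 = s\<^sup>2" using cs by linarith
    finally show ?thesis using s by (simp add: field_simps power2_eq_square)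
  qed
  have "(\<integral>\<^sup>+x. \<integral>\<^sup>+y. h (c * x + s * y, s * x + - c * y) \<partial>normal_law 0 \<sigma> \<partial>normal_law 0 \<sigma>)
      = (\<integral>\<^sup>+x. \<integral>\<^sup>+y. ennreal (?n x * ?n y) * h (c * x + s * y, s * x + - c * y) \<partial>lborel \<partial>lborel)"
    using unfold2[of "\<lambda>z. h (c * fst z + s * snd z, s * fst z + - c * snd z)"] by simp
  \<comment> \<open>Two one-dimensional substitutions replace the planar one:
    \<open>a = c * x + s * y\<close> at fixed \<open>x\<close>, then, after exchanging the
    integrals, \<open>x = c * a + s * b\<close> at fixed \<open>a\<close>. The Jacobians
    \<open>1 / s\<close> and \<open>s\<close> cancel.\<close>
  also have "\<dots> = (\<integral>\<^sup>+x. \<bar>1 / s\<bar> * (\<integral>\<^sup>+a. ennreal (?n x * ?n ((a - c * x) / s)) * h (a, (x - c * a) / s) \<partial>lborel) \<partial>lborel)"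
  proof (rule nn_integral_cong)
    fix x
    have "- (c * x) / s + 1 / s * a = (a - c * x) / s" "c * x + s * ((a - c * x) / s) = a" for a
      using s by (simp_all add: field_simps)
    then show "(\<integral>\<^sup>+y. ennreal (?n x * ?n y) * h (c * x + s * y, s * x + - c * y) \<partial>lborel)
        = \<bar>1 / s\<bar> * (\<integral>\<^sup>+a. ennreal (?n x * ?n ((a - c * x) / s)) * h (a, (x - c * a) / s) \<partial>lborel)"
      using s by (subst nn_integral_real_affine[where c="1 / s" and t="- (c * x) / s"]) (auto simp only: e1, auto)
  qed
  also have "\<dots> = (\<integral>\<^sup>+a. \<bar>1 / s\<bar> * (\<integral>\<^sup>+x. ennreal (?n x * ?n ((a - c * x) / s)) * h (a, (x - c * a) / s) \<partial>lborel) \<partial>lborel)"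
    by (subst (1 2) nn_integral_cmult[symmetric], measurable, measurable) (rule lborel_pair.Fubini', measurable)
  also have "\<dots> = (\<integral>\<^sup>+a. \<integral>\<^sup>+b. ennreal (?n a * ?n b) * h (a, b) \<partial>lborel \<partial>lborel)"
  proof (rule nn_integral_cong)
    fix a
    have *: "(c * a + s * b - c * a) / s = b" for b using s by simp
    have "(\<integral>\<^sup>+x. ennreal (?n x * ?n ((a - c * x) / s)) * h (a, (x - c * a) / s) \<partial>lborel)
        = \<bar>s\<bar> * (\<integral>\<^sup>+b. ennreal (?n a * ?n b) * h (a, b) \<partial>lborel)"
      using s by (subst nn_integral_real_affine[where c=s and t="c * a"]) (simp_all only: * e2 rot, auto)
    then show "\<bar>1 / s\<bar> * (\<integral>\<^sup>+x. ennreal (?n x * ?n ((a - c * x) / s)) * h (a, (x - c * a) / s) \<partial>lborel)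
        = (\<integral>\<^sup>+b. ennreal (?n a * ?n b) * h (a, b) \<partial>lborel)"
      using s by (simp add: mult.assoc[symmetric] ennreal_mult'[symmetric])
  qed
  also have "\<dots> = (\<integral>\<^sup>+x. \<integral>\<^sup>+y. h (x, y) \<partial>normal_law 0 \<sigma> \<partial>normal_law 0 \<sigma>)"
    by (rule unfold2[symmetric]) measurable
  finally show ?thesis .
qed

text \<open>The observation is \<open>r * S p u\<close> plus independent noise of standard deviation
  \<open>\<sigma> p\<close>. The noise is fixed and only \<open>r\<close> varies, so
  \<open>r\<^sup>2\<close> plays the part of the signal-to-noise ratio.\<close>

locale gaussian_channel = prob_space \<gamma> for \<gamma> :: "'u measure" +
  fixes I :: "'i set" and \<sigma> :: "'i \<Rightarrow> real" and S :: "'i \<Rightarrow> 'u \<Rightarrow> real"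
  assumes fin: "finite I" and sd_pos: "\<And>p. \<sigma> p > 0"
    and S_moments: "\<And>p. p \<in> I \<Longrightarrow> moments \<gamma> (S p)"
begin

definition noise :: "('i \<Rightarrow> real) measure" where
  "noise = PiM I (\<lambda>p. normal_law 0 (\<sigma> p))"

text \<open>Density of the observation given \<open>u\<close> relative to pure noise: the square of
  \<open>y\<close> cancels in this ratio and leaves a linear and a quadratic term in the
  signal.\<close>

definition lik :: "real \<Rightarrow> ('i \<Rightarrow> real) \<Rightarrow> 'u \<Rightarrow> real" where
  "lik r y u = exp (\<Sum>p\<in>I. (y p * (r * S p u) - (r * S p u)\<^sup>2 / 2) / (\<sigma> p)\<^sup>2)"

definition Z :: "real \<Rightarrow> ('i \<Rightarrow> real) \<Rightarrow> real" where
  "Z r y = (\<integral>u. lik r y u \<partial>\<gamma>)"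

definition post :: "real \<Rightarrow> ('i \<Rightarrow> real) \<Rightarrow> 'u measure" where
  "post r y = density \<gamma> (\<lambda>u. ennreal (lik r y u / Z r y))"

definition avg :: "real \<Rightarrow> ('u \<Rightarrow> real) \<Rightarrow> ('i \<Rightarrow> real) \<Rightarrow> real" where
  "avg r f y = (\<integral>u. f u \<partial>post r y)"

text \<open>As a density against prior times pure noise, it uses one reference measure for every
  \<open>r\<close> and makes the posterior explicit. \<open>joint_eq_distr\<close> identifies it
  with the law of signal and observation in the actual experiment.\<close>

definition joint :: "real \<Rightarrow> ('u \<times> ('i \<Rightarrow> real)) measure" where
  "joint r = density (\<gamma> \<Otimes>\<^sub>M noise) (\<lambda>z. ennreal (lik r (snd z) (fst z)))"

lemma S_measurable[measurable]: "p \<in> I \<Longrightarrow> S p \<in> borel_measurable \<gamma>"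
  using S_moments moments_measurable by blast

lemma component_measurable[measurable]: "p \<in> I \<Longrightarrow> (\<lambda>y. y p) \<in> borel_measurable noise"
  unfolding noise_def by measurable

sublocale PN: product_prob_space "\<lambda>p. normal_law 0 (\<sigma> p)" UNIV
  by (simp add: product_prob_space_def product_sigma_finite_def prob_space_imp_sigma_finite
      product_prob_space_axioms_def prob_space_normal_density sd_pos)

sublocale noise: prob_space noise
  unfolding noise_def by (intro prob_space_PiM prob_space_normal_density sd_pos)

sublocale UN: pair_prob_space \<gamma> noise ..

lemma space_noise: "space noise = (\<Pi>\<^sub>E p\<in>I. UNIV)"
  by (simp add: noise_def space_PiM)

lemma measurable_into_noise:
  "f \<in> space M \<rightarrow> (\<Pi>\<^sub>E p\<in>I. UNIV) \<Longrightarrow> (\<And>p. p \<in> I \<Longrightarrow> (\<lambda>x. f x p) \<in> borel_measurable M) \<Longrightarrow> f \<in> measurable M noise"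
  unfolding noise_def by (rule measurable_PiM_single') (auto)

lemma lik_measurable[measurable]: "(\<lambda>z. lik r (snd z) (fst z)) \<in> borel_measurable (\<gamma> \<Otimes>\<^sub>M noise)"
  unfolding lik_def by measurable

lemma lik_measurable_u[measurable]: "lik r y \<in> borel_measurable \<gamma>"
  unfolding lik_def[abs_def] by measurable

lemma lik_pos: "0 < lik r y u"
  by (simp add: lik_def)

text \<open>Completing the square makes the likelihood ratio bounded in \<open>u\<close>, so no growth condition on the
  signal is needed for posterior integrals.\<close>

lemma lik_le: "lik r y u \<le> exp (\<Sum>p\<in>I. (y p)\<^sup>2 / (2 * (\<sigma> p)\<^sup>2))"
proof -
  have "(y p * (r * S p u) - (r * S p u)\<^sup>2 / 2) / (\<sigma> p)\<^sup>2 \<le> (y p)\<^sup>2 / (2 * (\<sigma> p)\<^sup>2)" for p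
  proof -
    have "y p * (r * S p u) - (r * S p u)\<^sup>2 / 2 \<le> (y p)\<^sup>2 / 2"
      using sum_squares_bound[of "y p" "r * S p u"] by (simp add: power2_eq_square)
    then have "(y p * (r * S p u) - (r * S p u)\<^sup>2 / 2) / (\<sigma> p)\<^sup>2 \<le> ((y p)\<^sup>2 / 2) / (\<sigma> p)\<^sup>2"
      by (intro divide_right_mono) auto
    then show ?thesis by simp
  qed
  then show ?thesis unfolding lik_def by (auto intro: sum_mono)
qed

lemma integrable_lik:
  assumes "integrable \<gamma> f"
  shows "integrable \<gamma> (\<lambda>u. f u * lik r y u)"
proof (rule Bochner_Integration.integrable_bound)
  show "integrable \<gamma> (\<lambda>u. exp (\<Sum>p\<in>I. (y p)\<^sup>2 / (2 * (\<sigma> p)\<^sup>2)) * f u)"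
    using assms by simp
  show "(\<lambda>u. f u * lik r y u) \<in> borel_measurable \<gamma>" using assms by auto
  show "AE u in \<gamma>. norm (f u * lik r y u) \<le> norm (exp (\<Sum>p\<in>I. (y p)\<^sup>2 / (2 * (\<sigma> p)\<^sup>2)) * f u)"
    using lik_le[of r y] lik_pos[of r y]
    by (auto simp: abs_mult mult.commute less_imp_le intro!: AE_I2 mult_left_mono)
qed

lemma integrable_lik1: "integrable \<gamma> (lik r y)"
  using integrable_lik[of "\<lambda>_. 1"] by simp

lemma Z_pos: "0 < Z r y"
proof -
  have "0 < (\<integral>\<^sup>+u. ennreal (lik r y u) \<partial>\<gamma>)"
  proof (rule ccontr)
    assume "\<not> ?thesis"
    then have "AE u in \<gamma>. ennreal (lik r y u) = 0"
      by (subst nn_integral_0_iff_AE[symmetric]) auto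
    then have "AE u in \<gamma>. False"
      by (rule AE_mp) (auto simp: ennreal_eq_0_iff not_le lik_pos)
    then show False using AE_False by blast
  qed
  then show ?thesis unfolding Z_def
    using integrable_lik1[of r y] lik_pos[of r y]
    by (subst (asm) nn_integral_eq_integral) (auto simp: less_imp_le)
qed

lemma Z_measurable[measurable]: "Z r \<in> borel_measurable noise"
  unfolding Z_def[abs_def]
  by (rule borel_measurable_lebesgue_integral) (unfold lik_def case_prod_beta', measurable)

lemma prob_space_post: "prob_space (post r y)"
proof
  have "emeasure (post r y) (space (post r y)) = (\<integral>\<^sup>+u. ennreal (lik r y u / Z r y) \<partial>\<gamma>)"
    unfolding post_def by (subst emeasure_density) (auto cong: nn_integral_cong)
  also have "\<dots> = ennreal (\<integral>u. lik r y u / Z r y \<partial>\<gamma>)"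
    using integrable_lik1[of r y] lik_pos[of r y] Z_pos[of r y]
    by (intro nn_integral_eq_integral) (auto simp: less_imp_le)
  also have "\<dots> = 1" using Z_pos[of r y] by (simp flip: Z_def)
  finally show "emeasure (post r y) (space (post r y)) = 1" .
qed

lemma space_post[simp]: "space (post r y) = space \<gamma>"
  and sets_post[simp, measurable_cong]: "sets (post r y) = sets \<gamma>"
  by (simp_all add: post_def)

lemma avg_eq:
  assumes [measurable]: "f \<in> borel_measurable \<gamma>"
  shows "avg r f y = (\<integral>u. f u * lik r y u \<partial>\<gamma>) / Z r y"
  unfolding avg_def post_def using lik_pos[of r y] Z_pos[of r y]
  by (subst integral_density) (auto simp: less_imp_le mult.commute)

lemma integrable_post:
  fixes f :: "'u \<Rightarrow> real"
  assumes "integrable \<gamma> f"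
  shows "integrable (post r y) f"
proof -
  have [measurable]: "f \<in> borel_measurable \<gamma>" using assms by auto
  have "integrable \<gamma> (\<lambda>u. lik r y u / Z r y * f u)"
    using integrable_lik[OF assms, of r y] by (simp add: mult.commute)
  then show ?thesis unfolding post_def using lik_pos[of r y] Z_pos[of r y]
    by (subst integrable_density) (auto simp: less_imp_le)
qed

lemma moments_post: "moments \<gamma> f \<Longrightarrow> moments (post r y) f"
  by (auto simp: moments_def intro: integrable_post)

lemma sets_joint[simp, measurable_cong]: "sets (joint r) = sets (\<gamma> \<Otimes>\<^sub>M noise)"
  and space_joint[simp]: "space (joint r) = space \<gamma> \<times> space noise"
  by (simp_all add: joint_def space_pair_measure)

lemma nn_integral_joint:
  assumes F[measurable]: "F \<in> borel_measurable (\<gamma> \<Otimes>\<^sub>M noise)"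
  shows "(\<integral>\<^sup>+z. F z \<partial>joint r)
    = (\<integral>\<^sup>+y. ennreal (Z r y) * (\<integral>\<^sup>+u. F (u, y) \<partial>post r y) \<partial>noise)"
proof -
  have "(\<integral>\<^sup>+z. F z \<partial>joint r) = (\<integral>\<^sup>+z. ennreal (lik r (snd z) (fst z)) * F z \<partial>(\<gamma> \<Otimes>\<^sub>M noise))"
    unfolding joint_def by (rule nn_integral_density) measurable
  also have "\<dots> = (\<integral>\<^sup>+y. (\<integral>\<^sup>+u. ennreal (lik r y u) * F (u, y) \<partial>\<gamma>) \<partial>noise)"
    by (subst UN.nn_integral_snd[symmetric]) (auto simp: case_prod_beta')
  also have "\<dots> = (\<integral>\<^sup>+y. ennreal (Z r y) * (\<integral>\<^sup>+u. F (u, y) \<partial>post r y) \<partial>noise)"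
  proof (rule nn_integral_cong)
    fix y assume y: "y \<in> space noise"
    have [measurable]: "(\<lambda>u. F (u, y)) \<in> borel_measurable \<gamma>" using y by measurable
    have "ennreal (Z r y) * (\<integral>\<^sup>+u. F (u, y) \<partial>post r y)
        = (\<integral>\<^sup>+u. ennreal (Z r y) * (ennreal (lik r y u / Z r y) * F (u, y)) \<partial>\<gamma>)"
      unfolding post_def by (subst nn_integral_density) (auto simp: nn_integral_cmult)
    also have "\<dots> = (\<integral>\<^sup>+u. ennreal (lik r y u) * F (u, y) \<partial>\<gamma>)"
      using Z_pos[of r y] lik_pos[of r y]
      by (intro nn_integral_cong) (simp flip: ennreal_mult mult.assoc add: less_imp_le)
    finally show "(\<integral>\<^sup>+u. ennreal (lik r y u) * F (u, y) \<partial>\<gamma>)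
      = ennreal (Z r y) * (\<integral>\<^sup>+u. F (u, y) \<partial>post r y)" by simp
  qed
  finally show ?thesis .
qed

section \<open>Shifted noise and the law of the observation\<close>

lemma noise_eqI:
  assumes "sets M = sets noise" "sets N = sets noise"
    and fin_M: "emeasure M (space noise) \<noteq> \<infinity>"
    and box: "\<And>A. (\<And>p. p \<in> I \<Longrightarrow> A p \<in> sets borel) \<Longrightarrow> emeasure M (Pi\<^sub>E I A) = emeasure N (Pi\<^sub>E I A)"
  shows "M = N"
proof (rule measure_eqI_PiM_finite[where I=I and M="\<lambda>p. normal_law 0 (\<sigma> p)" and A="\<lambda>_. space noise"])
  show "range (\<lambda>_. space noise) \<subseteq> prod_algebra I (\<lambda>p. normal_law 0 (\<sigma> p))"
    unfolding space_noise using prod_algebraI_finite[OF fin, of "\<lambda>_. UNIV" "\<lambda>p. normal_law 0 (\<sigma> p)"] by auto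
  show "(\<Union>i. space noise) = space (PiM I (\<lambda>p. normal_law 0 (\<sigma> p)))" by (simp add: noise_def)
qed (use assms in \<open>auto simp: fin noise_def\<close>)

lemma box_measurable[measurable]: "(\<And>p. p \<in> I \<Longrightarrow> A p \<in> sets borel) \<Longrightarrow> Pi\<^sub>E I A \<in> sets noise"
  unfolding noise_def using fin by (intro sets_PiM_I_finite) auto

lemma indicator_box:
  "w \<in> space noise \<Longrightarrow> indicator (Pi\<^sub>E I A) w = (\<Prod>p\<in>I. indicator (A p) (w p) :: ennreal)"
  using fin by (auto simp: space_noise indicator_def PiE_iff)

text \<open>Finite-dimensional Cameron-Martin formula: on boxes both sides factorise over the
  coordinates, where \<open>nn_integral_normal_shift\<close> applies.\<close>

lemma noise_shift:
  "distr noise noise (\<lambda>w. \<lambda>p\<in>I. w p + a p)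
    = density noise (\<lambda>w. ennreal (exp (\<Sum>p\<in>I. (w p * a p - (a p)\<^sup>2 / 2) / (\<sigma> p)\<^sup>2)))" (is "?D = ?E")
proof (rule noise_eqI)
  have shift[measurable]: "(\<lambda>w. \<lambda>p\<in>I. w p + a p) \<in> measurable noise noise"
    by (rule measurable_into_noise) (auto simp: restrict_def cong: measurable_cong)
  show "sets ?D = sets noise" "sets ?E = sets noise" by simp_all
  have "emeasure ?D (space ?D) = 1" using noise.prob_space_distr[OF shift] prob_space.emeasure_space_1 by blast
  then show "emeasure ?D (space noise) \<noteq> \<infinity>" by simp
  fix A :: "'i \<Rightarrow> real set" assume A': "\<And>p. p \<in> I \<Longrightarrow> A p \<in> sets borel"
  note [measurable] = A'
  have AE: "Pi\<^sub>E I A \<in> sets noise" by (rule box_measurable) (rule A')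
  have "emeasure ?D (Pi\<^sub>E I A) = (\<integral>\<^sup>+w. indicator (Pi\<^sub>E I A) (\<lambda>p\<in>I. w p + a p) \<partial>noise)"
    using AE nn_integral_distr[OF shift, of "indicator (Pi\<^sub>E I A)"] nn_integral_indicator[of "Pi\<^sub>E I A" ?D]
    by simp
  also have "\<dots> = (\<integral>\<^sup>+w. (\<Prod>p\<in>I. indicator (A p) (w p + a p)) \<partial>noise)"
    by (intro nn_integral_cong, subst indicator_box) (auto simp: space_noise)
  also have "\<dots> = (\<Prod>p\<in>I. \<integral>\<^sup>+x. indicator (A p) (x + a p) \<partial>normal_law 0 (\<sigma> p))"
    unfolding noise_def using A' fin by (subst PN.product_nn_integral_prod) auto
  also have "\<dots> = (\<Prod>p\<in>I. \<integral>\<^sup>+x. indicator (A p) x * ennreal (exp ((x * a p - (a p)\<^sup>2 / 2) / (\<sigma> p)\<^sup>2)) \<partial>normal_law 0 (\<sigma> p))"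
    using A' sd_pos by (intro prod.cong refl nn_integral_normal_shift) auto
  also have "\<dots> = (\<integral>\<^sup>+w. (\<Prod>p\<in>I. indicator (A p) (w p) * ennreal (exp ((w p * a p - (a p)\<^sup>2 / 2) / (\<sigma> p)\<^sup>2))) \<partial>noise)"
    unfolding noise_def using A' fin by (subst PN.product_nn_integral_prod) auto
  also have "\<dots> = (\<integral>\<^sup>+w. ennreal (exp (\<Sum>p\<in>I. (w p * a p - (a p)\<^sup>2 / 2) / (\<sigma> p)\<^sup>2)) * indicator (Pi\<^sub>E I A) w \<partial>noise)"
    by (intro nn_integral_cong) (simp add: indicator_box prod.distrib exp_sum fin prod_ennreal mult.commute)
  also have "\<dots> = emeasure ?E (Pi\<^sub>E I A)"
    using AE by (subst emeasure_density) auto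
  finally show "emeasure ?D (Pi\<^sub>E I A) = emeasure ?E (Pi\<^sub>E I A)" .
qed

definition observe :: "real \<Rightarrow> 'u \<Rightarrow> ('i \<Rightarrow> real) \<Rightarrow> 'i \<Rightarrow> real" where
  "observe r u w = (\<lambda>p\<in>I. w p + r * S p u)"

lemma observe_measurable[measurable]:
  "(\<lambda>z. observe r (fst z) (snd z)) \<in> measurable (\<gamma> \<Otimes>\<^sub>M noise) noise"
  unfolding observe_def by (rule measurable_into_noise) (auto simp: restrict_def cong: measurable_cong)

lemma nn_integral_observe:
  assumes F[measurable]: "F \<in> borel_measurable (\<gamma> \<Otimes>\<^sub>M noise)"
  shows "(\<integral>\<^sup>+u. \<integral>\<^sup>+w. F (u, observe r u w) \<partial>noise \<partial>\<gamma>) = (\<integral>\<^sup>+z. F z \<partial>joint r)"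
proof -
  have "(\<integral>\<^sup>+w. F (u, observe r u w) \<partial>noise) = (\<integral>\<^sup>+w. ennreal (lik r w u) * F (u, w) \<partial>noise)"
    if u: "u \<in> space \<gamma>" for u
  proof -
    have [measurable]: "(\<lambda>w. F (u, w)) \<in> borel_measurable noise" using u by measurable
    have [measurable]: "(\<lambda>w. \<lambda>p\<in>I. w p + r * S p u) \<in> measurable noise noise"
      by (rule measurable_into_noise) (auto simp: restrict_def cong: measurable_cong)
    have "(\<integral>\<^sup>+w. F (u, observe r u w) \<partial>noise)
        = (\<integral>\<^sup>+w. F (u, w) \<partial>distr noise noise (\<lambda>w. \<lambda>p\<in>I. w p + r * S p u))"
      by (subst nn_integral_distr) (auto simp: observe_def)
    also have "\<dots> = (\<integral>\<^sup>+w. ennreal (lik r w u) * F (u, w) \<partial>noise)"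
      unfolding noise_shift lik_def by (subst nn_integral_density) auto
    finally show ?thesis .
  qed
  then have "(\<integral>\<^sup>+u. \<integral>\<^sup>+w. F (u, observe r u w) \<partial>noise \<partial>\<gamma>)
      = (\<integral>\<^sup>+u. \<integral>\<^sup>+w. ennreal (lik r w u) * F (u, w) \<partial>noise \<partial>\<gamma>)"
    by (rule nn_integral_cong)
  also have "\<dots> = (\<integral>\<^sup>+z. F z \<partial>joint r)"
    unfolding joint_def
    by (subst nn_integral_density, measurable, subst noise.nn_integral_fst[symmetric]) auto
  finally show ?thesis .
qed

lemma joint_eq_distr:
  "joint r = distr (\<gamma> \<Otimes>\<^sub>M noise) (\<gamma> \<Otimes>\<^sub>M noise) (\<lambda>z. (fst z, observe r (fst z) (snd z)))" (is "_ = ?D")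
proof (rule measure_eqI)
  show "sets (joint r) = sets ?D" by simp
  fix A assume "A \<in> sets (joint r)"
  then have A[measurable]: "A \<in> sets (\<gamma> \<Otimes>\<^sub>M noise)" by simp
  have "emeasure (joint r) A = (\<integral>\<^sup>+u. \<integral>\<^sup>+w. indicator A (u, observe r u w) \<partial>noise \<partial>\<gamma>)"
    by (subst nn_integral_observe) auto
  also have "\<dots> = (\<integral>\<^sup>+z. indicator A (fst z, observe r (fst z) (snd z)) \<partial>(\<gamma> \<Otimes>\<^sub>M noise))"
    by (subst noise.nn_integral_fst[symmetric]) auto
  also have "\<dots> = emeasure ?D A"
    using nn_integral_distr[of "\<lambda>z. (fst z, observe r (fst z) (snd z))" "\<gamma> \<Otimes>\<^sub>M noise" "\<gamma> \<Otimes>\<^sub>M noise" "indicator A"]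
      nn_integral_indicator[of A ?D] by simp
  finally show "emeasure (joint r) A = emeasure ?D A" .
qed

lemma prob_space_joint: "prob_space (joint r)"
  unfolding joint_eq_distr by (intro UN.prob_space_distr) measurable


sublocale joint: prob_space "joint r" for r by (rule prob_space_joint)
sublocale post: prob_space "post r y" for r y by (rule prob_space_post)

section \<open>Posterior averages and resampling from the posterior\<close>

lemma avg_mult_right: "avg r (\<lambda>u. f u * c) y = avg r f y * c"
  by (simp add: avg_def)

lemma avg_mult_left: "avg r (\<lambda>u. c * f u) y = c * avg r f y"
  by (simp add: avg_def)

lemma avg_const: "avg r (\<lambda>u. c) y = c"
  using post.prob_space[of r y] by (simp add: avg_def)

lemma avg_add: "integrable \<gamma> f \<Longrightarrow> integrable \<gamma> g \<Longrightarrow> avg r (\<lambda>u. f u + g u) y = avg r f y + avg r g y"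
  by (simp add: avg_def integrable_post)

lemma avg_diff: "integrable \<gamma> f \<Longrightarrow> integrable \<gamma> g \<Longrightarrow> avg r (\<lambda>u. f u - g u) y = avg r f y - avg r g y"
  by (simp add: avg_def integrable_post)

lemma avg_sum: "(\<And>i. i \<in> A \<Longrightarrow> integrable \<gamma> (f i)) \<Longrightarrow> avg r (\<lambda>u. \<Sum>i\<in>A. f i u) y = (\<Sum>i\<in>A. avg r (f i) y)"
  by (simp add: avg_def integrable_post)

lemma avg_mono: "integrable \<gamma> f \<Longrightarrow> integrable \<gamma> g \<Longrightarrow> (\<And>u. f u \<le> g u) \<Longrightarrow> avg r f y \<le> avg r g y"
  by (simp add: avg_def integrable_post integral_mono)

lemma avg_nonneg: "(\<And>u. 0 \<le> f u) \<Longrightarrow> 0 \<le> avg r f y"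
  by (simp add: avg_def)

lemma avg_measurable2:
  assumes [measurable]: "F \<in> borel_measurable (\<gamma> \<Otimes>\<^sub>M noise)"
  shows "(\<lambda>y. avg r (\<lambda>u. F (u, y)) y) \<in> borel_measurable noise"
proof -
  have [measurable]: "(\<lambda>z. lik r (fst z) (snd z)) \<in> borel_measurable (noise \<Otimes>\<^sub>M \<gamma>)"
    unfolding lik_def by measurable
  have "(\<lambda>y. (\<integral>u. F (u, y) * lik r y u \<partial>\<gamma>) / Z r y) \<in> borel_measurable noise"
    by measurable
  then show ?thesis
    by (subst measurable_cong[where g="\<lambda>y. (\<integral>u. F (u, y) * lik r y u \<partial>\<gamma>) / Z r y"])
      (auto simp: avg_eq)
qed

lemma avg_measurable[measurable]:
  assumes [measurable]: "f \<in> borel_measurable \<gamma>"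
  shows "avg r f \<in> borel_measurable noise"
  using avg_measurable2[of "\<lambda>z. f (fst z)" r] by simp

lemma integral_joint:
  fixes F :: "'u \<times> ('i \<Rightarrow> real) \<Rightarrow> real"
  assumes F: "integrable (joint r) F"
  shows "integrable noise (\<lambda>y. Z r y * avg r (\<lambda>u. F (u, y)) y)"
    and "(\<integral>z. F z \<partial>joint r) = (\<integral>y. Z r y * avg r (\<lambda>u. F (u, y)) y \<partial>noise)"
proof -
  have [measurable]: "F \<in> borel_measurable (\<gamma> \<Otimes>\<^sub>M noise)" using F by auto
  have i: "integrable (\<gamma> \<Otimes>\<^sub>M noise) (\<lambda>(u, y). lik r y u * F (u, y))"
    using F lik_pos unfolding joint_def
    by (subst (asm) integrable_density) (auto simp: less_imp_le case_prod_beta')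
  have eq: "(\<integral>u. lik r y u * F (u, y) \<partial>\<gamma>) = Z r y * avg r (\<lambda>u. F (u, y)) y" if "y \<in> space noise" for y
    using Z_pos[of r y] that by (subst avg_eq) (auto simp: mult.commute)
  show "integrable noise (\<lambda>y. Z r y * avg r (\<lambda>u. F (u, y)) y)"
    by (rule iffD1[OF Bochner_Integration.integrable_cong[OF refl eq] UN.integrable_snd[OF i]])
  have "(\<integral>z. F z \<partial>joint r) = (\<integral>z. lik r (snd z) (fst z) * F z \<partial>(\<gamma> \<Otimes>\<^sub>M noise))"
    using lik_pos unfolding joint_def by (subst integral_density) (auto simp: less_imp_le)
  also have "\<dots> = (\<integral>y. (\<integral>u. lik r y u * F (u, y) \<partial>\<gamma>) \<partial>noise)"
    using UN.integral_snd[OF i] by (simp add: case_prod_beta')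
  also have "\<dots> = (\<integral>y. Z r y * avg r (\<lambda>u. F (u, y)) y \<partial>noise)"
    by (intro Bochner_Integration.integral_cong) (auto simp: eq)
  finally show "(\<integral>z. F z \<partial>joint r) = (\<integral>y. Z r y * avg r (\<lambda>u. F (u, y)) y \<partial>noise)" .
qed

text \<open>Tower property: replacing the signal by a fresh sample from the posterior, given the
  observation, does not change the joint law.\<close>

lemma nishimori:
  fixes F :: "'u \<times> ('i \<Rightarrow> real) \<Rightarrow> real"
  assumes F: "integrable (joint r) F"
  shows "integrable (joint r) (\<lambda>z. avg r (\<lambda>u. F (u, snd z)) (snd z))"
    and "(\<integral>z. avg r (\<lambda>u. F (u, snd z)) (snd z) \<partial>joint r) = (\<integral>z. F z \<partial>joint r)"
proof -
  have [measurable]: "F \<in> borel_measurable (\<gamma> \<Otimes>\<^sub>M noise)" using F by auto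
  note avg_measurable2[of F, measurable]
  show i: "integrable (joint r) (\<lambda>z. avg r (\<lambda>u. F (u, snd z)) (snd z))"
  proof (rule integrableI_bounded)
    show "(\<lambda>z. avg r (\<lambda>u. F (u, snd z)) (snd z)) \<in> borel_measurable (joint r)" by measurable
    \<comment> \<open>For non-integrable \<open>g\<close> the average is 0 by convention, so the
      bound holds for every \<open>g\<close>.\<close>
    have le: "ennreal (norm (avg r g y)) \<le> (\<integral>\<^sup>+u. ennreal (norm (g u)) \<partial>post r y)" for g y
      by (cases "integrable (post r y) g")
        (auto simp: avg_def not_integrable_integral_eq intro: integral_norm_bound_ennreal[of _ g, simplified])
    have "(\<integral>\<^sup>+z. ennreal (norm (avg r (\<lambda>u. F (u, snd z)) (snd z))) \<partial>joint r)
        = (\<integral>\<^sup>+y. ennreal (Z r y) * ennreal (norm (avg r (\<lambda>u. F (u, y)) y)) \<partial>noise)"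
      using post.emeasure_space_1[of r] by (subst nn_integral_joint) auto
    also have "\<dots> \<le> (\<integral>\<^sup>+y. ennreal (Z r y) * (\<integral>\<^sup>+u. ennreal (norm (F (u, y))) \<partial>post r y) \<partial>noise)"
      by (intro nn_integral_mono mult_left_mono le) simp
    also have "\<dots> = (\<integral>\<^sup>+z. ennreal (norm (F z)) \<partial>joint r)"
      by (subst nn_integral_joint) auto
    also have "\<dots> < \<infinity>" using F by (simp add: integrable_iff_bounded)
    finally show "(\<integral>\<^sup>+z. ennreal (norm (avg r (\<lambda>u. F (u, snd z)) (snd z))) \<partial>joint r) < \<infinity>" .
  qed
  show "(\<integral>z. avg r (\<lambda>u. F (u, snd z)) (snd z) \<partial>joint r) = (\<integral>z. F z \<partial>joint r)"
    using integral_joint(2)[OF i] integral_joint(2)[OF F] by (simp add: avg_const)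
qed

lemma distr_joint_fst: "distr (joint r) \<gamma> fst = \<gamma>"
  unfolding joint_eq_distr by (subst distr_distr) (auto simp: comp_def noise.distr_pair_fst)

lemma moments_joint_fst:
  assumes "moments \<gamma> f"
  shows "moments (joint r) (\<lambda>z. f (fst z))"
  using assms moments_distr[of fst "joint r" \<gamma> f] by (simp add: distr_joint_fst moments_measurable)

lemma integral_joint_fst:
  fixes f :: "'u \<Rightarrow> real"
  assumes "f \<in> borel_measurable \<gamma>"
  shows "(\<integral>z. f (fst z) \<partial>joint r) = (\<integral>u. f u \<partial>\<gamma>)"
  using integral_distr[of fst "joint r" \<gamma> f] assms by (simp add: distr_joint_fst)

lemma moments_noise: "p \<in> I \<Longrightarrow> moments noise (\<lambda>w. w p)"
  using moments_distr[of "\<lambda>w. w p" noise "normal_law 0 (\<sigma> p)" "\<lambda>x. x"] moments_normal_law[OF sd_pos, of 0 p]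
    distr_PiM_component[of I "\<lambda>p. normal_law 0 (\<sigma> p)" p] by (simp add: noise_def prob_space_normal_density sd_pos)

lemma distr_product_snd: "distr (\<gamma> \<Otimes>\<^sub>M noise) noise snd = noise"
proof (intro measure_eqI)
  fix A assume A: "A \<in> sets (distr (\<gamma> \<Otimes>\<^sub>M noise) noise snd)"
  from A have "emeasure (distr (\<gamma> \<Otimes>\<^sub>M noise) noise snd) A = emeasure (\<gamma> \<Otimes>\<^sub>M noise) (space \<gamma> \<times> A)"
    by (auto simp add: emeasure_distr space_pair_measure dest: sets.sets_into_space intro!: arg_cong2[where f=emeasure])
  with A show "emeasure (distr (\<gamma> \<Otimes>\<^sub>M noise) noise snd) A = emeasure noise A"
    by (simp add: noise.emeasure_pair_measure_Times emeasure_space_1)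
qed simp

lemma moments_joint_component:
  assumes p: "p \<in> I"
  shows "moments (joint r) (\<lambda>z. snd z p)"
proof -
  have "moments (\<gamma> \<Otimes>\<^sub>M noise) (\<lambda>z. snd z p)"
    using moments_noise[OF p] distr_product_snd moments_distr[of snd "\<gamma> \<Otimes>\<^sub>M noise" noise "\<lambda>w. w p"] p by simp
  moreover have "moments (\<gamma> \<Otimes>\<^sub>M noise) (\<lambda>z. S p (fst z))"
    using S_moments[OF p] noise.distr_pair_fst[of \<gamma>] moments_distr[of fst "\<gamma> \<Otimes>\<^sub>M noise" \<gamma> "S p"] p by simp
  ultimately have "moments (\<gamma> \<Otimes>\<^sub>M noise) (\<lambda>z. snd z p + r * S p (fst z))"
    by (intro moments_add moments_mult UN.moments_const)
  moreover have "(\<lambda>z. (fst z, observe r (fst z) (snd z))) \<in> measurable (\<gamma> \<Otimes>\<^sub>M noise) (\<gamma> \<Otimes>\<^sub>M noise)"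
    by measurable
  ultimately show ?thesis
    unfolding joint_eq_distr using p by (subst moments_distr) (auto simp: observe_def simp del: measurable_pair_iff)
qed

text \<open>Jensen moves an even power inside the posterior average and \<open>nishimori\<close>
  brings it back to a moment of the prior; \<open>1 + a ^ (2 * n)\<close> covers the odd
  powers.\<close>

lemma moments_avg:
  assumes f: "moments \<gamma> f"
  shows "moments (joint r) (\<lambda>z. avg r f (snd z))"
proof (rule moments_bound)
  note moments_measurable[OF f, measurable]
  show "(\<lambda>z. avg r f (snd z)) \<in> borel_measurable (joint r)" by measurable
  show "integrable (joint r) (\<lambda>z. 1 + avg r (\<lambda>u. f u ^ (2 * n)) (snd z))" for n
    using nishimori(1)[OF moments_integrable[OF joint.moments_power[OF moments_joint_fst[OF f]]], of r "2 * n"]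
    by simp
  show "\<bar>avg r f (snd z)\<bar> ^ n \<le> 1 + avg r (\<lambda>u. f u ^ (2 * n)) (snd z)" for n z
  proof -
    have "\<bar>a\<bar> ^ n \<le> 1 + a ^ (2 * n)" for a :: real
    proof -
      have "b \<le> 1 + b\<^sup>2" if "b \<ge> 0" for b :: real
        using sum_squares_bound[of b 1] that by simp
      from this[of "\<bar>a\<bar> ^ n"] show ?thesis
        by (simp add: power_even_eq flip: power_abs)
    qed
    moreover have "avg r f (snd z) ^ (2 * n) \<le> avg r (\<lambda>u. f u ^ (2 * n)) (snd z)"
      unfolding avg_def by (rule post.expectation_power_even_le[OF moments_post[OF f]])
    ultimately show ?thesis by (meson add_left_mono order_trans)
  qed
qed


section \<open>Derivatives in the observation and Gaussian integration by parts\<close>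

lemma lik_has_derivative:
  assumes p: "p \<in> I"
  shows "((\<lambda>s. lik r (y(p := s)) u) has_real_derivative
    lik r (y(p := s)) u * (r / (\<sigma> p)\<^sup>2 * S p u)) (at s)"
proof -
  define C where "C = (\<Sum>q\<in>I - {p}. (y q * (r * S q u) - (r * S q u)\<^sup>2 / 2) / (\<sigma> q)\<^sup>2)"
  have eq: "lik r (y(p := s)) u = exp (C + (s * (r * S p u) - (r * S p u)\<^sup>2 / 2) / (\<sigma> p)\<^sup>2)" for s
    unfolding lik_def C_def by (subst sum.remove[OF fin p]) (simp add: add.commute)
  have "((\<lambda>s. exp (C + (s * (r * S p u) - (r * S p u)\<^sup>2 / 2) / (\<sigma> p)\<^sup>2)) has_real_derivative
      exp (C + (s * (r * S p u) - (r * S p u)\<^sup>2 / 2) / (\<sigma> p)\<^sup>2) * (r / (\<sigma> p)\<^sup>2 * S p u)) (at s)"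
    using sd_pos[of p] by (auto intro!: derivative_eq_intros simp: field_simps power4_eq_xxxx power2_eq_square)
  then show ?thesis unfolding eq .
qed

lemma integral_lik_has_derivative:
  assumes p: "p \<in> I" and f: "moments \<gamma> f"
  shows "((\<lambda>s. \<integral>u. f u * lik r (y(p := s)) u \<partial>\<gamma>) has_real_derivative
    r / (\<sigma> p)\<^sup>2 * (\<integral>u. f u * S p u * lik r (y(p := s)) u \<partial>\<gamma>)) (at s)"
proof -
  note [measurable] = moments_measurable[OF f] S_measurable[OF p]
  \<comment> \<open>A majorant of the likelihood for all \<open>t\<close> within distance 1 of
    \<open>s\<close>: in \<open>lik_le\<close>, coordinate \<open>p\<close> is replaced by the
    largest modulus it can take.\<close>
  define E where "E = exp (\<Sum>q\<in>I. ((y(p := \<bar>s\<bar> + 1)) q)\<^sup>2 / (2 * (\<sigma> q)\<^sup>2))"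
  have bound: "lik r (y(p := t)) u \<le> E" if "\<bar>t - s\<bar> \<le> 1" for t u
  proof -
    have "\<bar>t\<bar> \<le> \<bar>s\<bar> + 1" using that by linarith
    then have "t\<^sup>2 \<le> (\<bar>s\<bar> + 1)\<^sup>2" by (metis abs_ge_zero power2_abs power_mono)
    then have "(\<Sum>q\<in>I. ((y(p := t)) q)\<^sup>2 / (2 * (\<sigma> q)\<^sup>2)) \<le> (\<Sum>q\<in>I. ((y(p := \<bar>s\<bar> + 1)) q)\<^sup>2 / (2 * (\<sigma> q)\<^sup>2))"
      by (intro sum_mono divide_right_mono) auto
    then show ?thesis unfolding E_def using lik_le[of r "y(p := t)" u] by (meson exp_le_cancel_iff order_trans)
  qed
  have "((\<lambda>s. \<integral>u. f u * lik r (y(p := s)) u \<partial>\<gamma>) has_real_derivative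
      (\<integral>u. f u * (lik r (y(p := s)) u * (r / (\<sigma> p)\<^sup>2 * S p u)) \<partial>\<gamma>)) (at s)"
  proof (rule has_real_derivative_integral[where B="\<lambda>u. \<bar>r\<bar> / (\<sigma> p)\<^sup>2 * E * \<bar>f u * S p u\<bar>"])
    show "((\<lambda>s. f u * lik r (y(p := s)) u) has_real_derivative
        f u * (lik r (y(p := s)) u * (r / (\<sigma> p)\<^sup>2 * S p u))) (at s)" for s u
      by (rule DERIV_cmult[OF lik_has_derivative[OF p]])
    show "integrable \<gamma> (\<lambda>u. f u * lik r (y(p := s)) u)" for s
      by (intro integrable_lik moments_integrable f)
    show "(\<lambda>u. f u * (lik r (y(p := s)) u * (r / (\<sigma> p)\<^sup>2 * S p u))) \<in> borel_measurable \<gamma>"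
      by measurable
    show "\<bar>f u * (lik r (y(p := t)) u * (r / (\<sigma> p)\<^sup>2 * S p u))\<bar> \<le> \<bar>r\<bar> / (\<sigma> p)\<^sup>2 * E * \<bar>f u * S p u\<bar>"
      if "\<bar>t - s\<bar> \<le> 1" for t u
    proof -
      have "\<bar>f u * (lik r (y(p := t)) u * (r / (\<sigma> p)\<^sup>2 * S p u))\<bar>
          = lik r (y(p := t)) u * (\<bar>r\<bar> / (\<sigma> p)\<^sup>2 * \<bar>f u * S p u\<bar>)"
        using lik_pos[of r "y(p := t)" u] by (simp add: abs_mult mult_ac less_imp_le)
      also have "\<dots> \<le> E * (\<bar>r\<bar> / (\<sigma> p)\<^sup>2 * \<bar>f u * S p u\<bar>)"
        using bound[OF that] by (intro mult_right_mono) auto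
      finally show ?thesis by (simp add: mult_ac)
    qed
    show "integrable \<gamma> (\<lambda>u. \<bar>r\<bar> / (\<sigma> p)\<^sup>2 * E * \<bar>f u * S p u\<bar>)"
      using f S_moments[OF p] by (intro integrable_mult_right integrable_abs moments_integrable moments_mult)
  qed
  moreover have "(\<integral>u. f u * (lik r (y(p := s)) u * (r / (\<sigma> p)\<^sup>2 * S p u)) \<partial>\<gamma>)
      = r / (\<sigma> p)\<^sup>2 * (\<integral>u. f u * S p u * lik r (y(p := s)) u \<partial>\<gamma>)"
    by (subst integral_mult_right_zero[symmetric]) (simp add: mult_ac)
  ultimately show ?thesis by (simp only:)
qed

lemma Z_has_derivative:
  assumes p: "p \<in> I"
  shows "((\<lambda>s. Z r (y(p := s))) has_real_derivative
    r / (\<sigma> p)\<^sup>2 * (Z r (y(p := s)) * avg r (S p) (y(p := s)))) (at s)"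
  using integral_lik_has_derivative[OF p moments_const[of 1], of r y s] Z_pos[of r "y(p := s)"] p
  by (simp add: Z_def[symmetric] avg_eq)

text \<open>The log-likelihood is affine in \<open>y p\<close> with slope proportional to
  \<open>S p\<close>, so the quotient rule produces a posterior covariance with
  \<open>S p\<close>.\<close>

lemma avg_has_derivative:
  assumes p: "p \<in> I" and f: "moments \<gamma> f"
  shows "((\<lambda>s. avg r f (y(p := s))) has_real_derivative
    r / (\<sigma> p)\<^sup>2 * (avg r (\<lambda>u. f u * S p u) (y(p := s)) - avg r f (y(p := s)) * avg r (S p) (y(p := s)))) (at s)"
proof -
  note [measurable] = moments_measurable[OF f] S_measurable[OF p]
  have z: "Z r (y(p := s)) \<noteq> 0" using Z_pos[of r "y(p := s)"] by simp
  let ?N = "\<lambda>s. \<integral>u. f u * lik r (y(p := s)) u \<partial>\<gamma>"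
  let ?M = "\<integral>u. f u * S p u * lik r (y(p := s)) u \<partial>\<gamma>"
  have "((\<lambda>s. ?N s / Z r (y(p := s))) has_real_derivative
     (r / (\<sigma> p)\<^sup>2 * ?M * Z r (y(p := s)) - ?N s * (r / (\<sigma> p)\<^sup>2 * (Z r (y(p := s)) * avg r (S p) (y(p := s)))))
      / (Z r (y(p := s)) * Z r (y(p := s)))) (at s)"
    by (rule DERIV_divide[OF integral_lik_has_derivative[OF p f] Z_has_derivative[OF p] z])
  moreover have "(a * M * Zz - N * (a * (Zz * b))) / (Zz * Zz) = a * (M / Zz - N / Zz * b)" if "Zz \<noteq> 0" for a M N b Zz :: real
    using that by (simp add: field_simps)
  note this[OF z]
  ultimately have "((\<lambda>s. ?N s / Z r (y(p := s))) has_real_derivative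
     r / (\<sigma> p)\<^sup>2 * (?M / Z r (y(p := s)) - ?N s / Z r (y(p := s)) * avg r (S p) (y(p := s)))) (at s)"
    by (simp only:)
  then show ?thesis by (simp add: avg_eq[of f] avg_eq[of "\<lambda>u. f u * S p u"])
qed

lemma isCont_avg:
  assumes "p \<in> I" "moments \<gamma> f"
  shows "isCont (\<lambda>s. avg r f (y(p := s))) s"
  using avg_has_derivative[OF assms] by (rule DERIV_isCont)

lemma integral_joint_snd:
  fixes h :: "('i \<Rightarrow> real) \<Rightarrow> real"
  assumes "integrable (joint r) (\<lambda>z. h (snd z))"
  shows "integrable noise (\<lambda>y. Z r y * h y)"
    and "(\<integral>z. h (snd z) \<partial>joint r) = (\<integral>y. Z r y * h y \<partial>noise)"
  using integral_joint[OF assms] by (simp_all add: avg_const)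

text \<open>Under pure noise the observation is centred Gaussian, so Stein's identity applies to
  \<open>Z r y * g y\<close>; the derivative of \<open>g\<close> gives the first term and the
  derivative of \<open>Z\<close> the drift \<open>avg r (S p)\<close>.\<close>

lemma gaussian_ibp:
  fixes g g' :: "('i \<Rightarrow> real) \<Rightarrow> real"
  assumes p: "p \<in> I"
    and deriv: "\<And>y s. ((\<lambda>s. g (y(p := s))) has_real_derivative g' (y(p := s))) (at s)"
    and cont: "\<And>y s. isCont (\<lambda>s. g' (y(p := s))) s"
    and g: "moments (joint r) (\<lambda>z. g (snd z))" and g': "moments (joint r) (\<lambda>z. g' (snd z))"
  shows "(\<integral>z. snd z p * g (snd z) \<partial>joint r)
    = (\<sigma> p)\<^sup>2 * (\<integral>z. g' (snd z) \<partial>joint r) + r * (\<integral>z. avg r (S p) (snd z) * g (snd z) \<partial>joint r)"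
proof -
  note m = moments_avg[OF S_moments[OF p], of r] moments_joint_component[OF p, of r] g g'
  let ?G = "\<lambda>y. Z r y * g y"
  let ?G' = "\<lambda>y. r / (\<sigma> p)\<^sup>2 * (Z r y * (avg r (S p) y * g y)) + Z r y * g' y"
  have i0: "integrable noise ?G" by (rule integral_joint_snd(1)[OF moments_integrable[OF g]])
  have i1: "integrable (joint r) (\<lambda>z. snd z p * g (snd z))" using m by (intro moments_integrable moments_mult)
  have i2: "integrable (joint r) (\<lambda>z. avg r (S p) (snd z) * g (snd z))" using m by (intro moments_integrable moments_mult)
  have i3: "integrable (joint r) (\<lambda>z. g' (snd z))" using m by (intro moments_integrable)
  note j1 = integral_joint_snd[where h="\<lambda>y. y p * g y", OF i1]
  note j2 = integral_joint_snd[where h="\<lambda>y. avg r (S p) y * g y", OF i2]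
  note j3 = integral_joint_snd[where h="g'", OF i3]
  have "(\<integral>y. (y p - 0) * ?G y \<partial>noise) = (\<sigma> p)\<^sup>2 * (\<integral>y. ?G' y \<partial>noise)"
    unfolding noise_def
  proof (rule stein_PiM[where m="\<lambda>_. 0"])
    show "((\<lambda>s. ?G (y(p := s))) has_real_derivative ?G' (y(p := s))) (at s)" for y s
      by (rule DERIV_cong[OF DERIV_mult[OF Z_has_derivative[OF p] deriv]]) simp
    show "isCont (\<lambda>s. ?G' (y(p := s))) s" for y s
      by (intro continuous_intros isCont_avg[OF p S_moments[OF p]] cont
          DERIV_isCont[OF deriv] DERIV_isCont[OF Z_has_derivative[OF p]])
    show "integrable (PiM I (\<lambda>j. normal_law 0 (\<sigma> j))) ?G" using i0 by (simp add: noise_def)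
    show "integrable (PiM I (\<lambda>j. normal_law 0 (\<sigma> j))) (\<lambda>x. (x p - 0) * ?G x)"
      using j1(1) by (simp add: noise_def mult_ac)
    show "integrable (PiM I (\<lambda>j. normal_law 0 (\<sigma> j))) ?G'"
      using j2(1) j3(1) by (auto simp: noise_def)
  qed (use fin p sd_pos in auto)
  moreover have "(\<integral>y. ?G' y \<partial>noise) = r / (\<sigma> p)\<^sup>2 * (\<integral>y. Z r y * (avg r (S p) y * g y) \<partial>noise)
      + (\<integral>y. Z r y * g' y \<partial>noise)"
    using j2(1) j3(1) by simp
  ultimately show ?thesis
    unfolding j1(2) j2(2) j3(2) using sd_pos[of p] by (simp add: mult_ac distrib_left)
qed


subsection \<open>Splitting an observation\<close>

text \<open>Used with coefficients \<open>(c, s)\<close> and \<open>(s, -c)\<close>, the rows of a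
  reflection: an orthogonal matrix that is its own inverse.\<close>

definition combine :: "real \<Rightarrow> real \<Rightarrow> ('i \<Rightarrow> real) \<Rightarrow> ('i \<Rightarrow> real) \<Rightarrow> 'i \<Rightarrow> real" where
  "combine a b x y = (\<lambda>p\<in>I. a * x p + b * y p)"

lemma combine_measurable[measurable]:
  assumes f: "f \<in> measurable M noise" and g: "g \<in> measurable M noise"
  shows "(\<lambda>z. combine a b (f z) (g z)) \<in> measurable M noise"
proof (rule measurable_into_noise)
  fix p assume p: "p \<in> I"
  have [measurable]: "(\<lambda>x. f x p) \<in> borel_measurable M" "(\<lambda>x. g x p) \<in> borel_measurable M"
    using measurable_compose[OF f component_measurable[OF p]] measurable_compose[OF g component_measurable[OF p]] by auto
  show "(\<lambda>x. combine a b (f x) (g x) p) \<in> borel_measurable M"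
    using p by (simp add: combine_def)
qed (simp add: combine_def)

text \<open>Agreement on products of boxes is extended one factor at a time: with one factor fixed,
  both sides are finite measures in the other that agree on boxes, so \<open>noise_eqI\<close>
  applies.\<close>

lemma noise_pair_eqI:
  assumes sets[measurable_cong]: "sets M = sets (noise \<Otimes>\<^sub>M noise)" and fm: "finite_measure M"
    and box: "\<And>A B. (\<And>p. p \<in> I \<Longrightarrow> A p \<in> sets borel) \<Longrightarrow> (\<And>p. p \<in> I \<Longrightarrow> B p \<in> sets borel) \<Longrightarrow>
      emeasure M (Pi\<^sub>E I A \<times> Pi\<^sub>E I B) = emeasure noise (Pi\<^sub>E I A) * emeasure noise (Pi\<^sub>E I B)"
  shows "noise \<Otimes>\<^sub>M noise = M"
proof -
  interpret M: finite_measure M by fact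
  have sp: "space M = space noise \<times> space noise"
    using sets_eq_imp_space_eq[OF sets] by (simp add: space_pair_measure)
  have 1: "emeasure (distr (density M (indicator (space noise \<times> B))) noise fst) A = emeasure M (A \<times> B)"
    if [measurable]: "A \<in> sets noise" "B \<in> sets noise" for A B
  proof -
    have "emeasure (distr (density M (indicator (space noise \<times> B))) noise fst) A
        = emeasure (density M (indicator (space noise \<times> B))) (fst -` A \<inter> space M)"
      by (subst emeasure_distr) auto
    also have "\<dots> = emeasure M ((space noise \<times> B) \<inter> (fst -` A \<inter> space M))"
      by (subst emeasure_density) (auto simp: mult.commute Int_ac simp flip: indicator_inter_arith intro!: nn_integral_indicator)
    also have "(space noise \<times> B) \<inter> (fst -` A \<inter> space M) = A \<times> B"
      using sets.sets_into_space[OF that(1)] sets.sets_into_space[OF that(2)] by (auto simp: sp)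
    finally show ?thesis .
  qed
  have 2: "emeasure (distr (density M (indicator (A \<times> space noise))) noise snd) B = emeasure M (A \<times> B)"
    if [measurable]: "A \<in> sets noise" "B \<in> sets noise" for A B
  proof -
    have "emeasure (distr (density M (indicator (A \<times> space noise))) noise snd) B
        = emeasure (density M (indicator (A \<times> space noise))) (snd -` B \<inter> space M)"
      by (subst emeasure_distr) auto
    also have "\<dots> = emeasure M ((A \<times> space noise) \<inter> (snd -` B \<inter> space M))"
      by (subst emeasure_density) (auto simp: mult.commute Int_ac simp flip: indicator_inter_arith intro!: nn_integral_indicator)
    also have "(A \<times> space noise) \<inter> (snd -` B \<inter> space M) = A \<times> B"
      using sets.sets_into_space[OF that(1)] sets.sets_into_space[OF that(2)] by (auto simp: sp)
    finally show ?thesis .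
  qed
  have step1: "emeasure M (A \<times> Pi\<^sub>E I B) = emeasure noise A * emeasure noise (Pi\<^sub>E I B)"
    if A: "A \<in> sets noise" and B: "\<And>p. p \<in> I \<Longrightarrow> B p \<in> sets borel" for A B
  proof -
    have B': "Pi\<^sub>E I B \<in> sets noise" by (rule box_measurable) (rule B)
    have "distr (density M (indicator (space noise \<times> Pi\<^sub>E I B))) noise fst
        = density noise (\<lambda>_. emeasure noise (Pi\<^sub>E I B))"
    proof (rule noise_eqI)
      show "emeasure (distr (density M (indicator (space noise \<times> Pi\<^sub>E I B))) noise fst) (space noise) \<noteq> \<infinity>"
        using 1[of "space noise" "Pi\<^sub>E I B"] B' M.emeasure_finite by simp
      show "emeasure (distr (density M (indicator (space noise \<times> Pi\<^sub>E I B))) noise fst) (Pi\<^sub>E I A)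
          = emeasure (density noise (\<lambda>_. emeasure noise (Pi\<^sub>E I B))) (Pi\<^sub>E I A)"
        if "\<And>p. p \<in> I \<Longrightarrow> A p \<in> sets borel" for A
        using 1[OF box_measurable[OF that] B'] box[OF that B] box_measurable[OF that]
        by (simp add: emeasure_density_const mult.commute)
    qed auto
    then show ?thesis using 1[OF A B'] A by (simp add: emeasure_density_const mult.commute)
  qed
  have step2: "emeasure M (A \<times> B) = emeasure noise A * emeasure noise B"
    if A: "A \<in> sets noise" and B: "B \<in> sets noise" for A B
  proof -
    have "distr (density M (indicator (A \<times> space noise))) noise snd = density noise (\<lambda>_. emeasure noise A)"
    proof (rule noise_eqI)
      show "emeasure (distr (density M (indicator (A \<times> space noise))) noise snd) (space noise) \<noteq> \<infinity>"
        using 2[of A "space noise"] A M.emeasure_finite by simp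
      show "emeasure (distr (density M (indicator (A \<times> space noise))) noise snd) (Pi\<^sub>E I B)
          = emeasure (density noise (\<lambda>_. emeasure noise A)) (Pi\<^sub>E I B)"
        if "\<And>p. p \<in> I \<Longrightarrow> B p \<in> sets borel" for B
        using 2[OF A box_measurable[OF that]] step1[OF A that] box_measurable[OF that]
        by (simp add: emeasure_density_const)
    qed auto
    then show ?thesis using 2[OF A B] B by (simp add: emeasure_density_const)
  qed
  show ?thesis
    by (rule pair_measure_eqI[OF noise.sigma_finite_measure_axioms noise.sigma_finite_measure_axioms])
      (simp_all add: sets step2)
qed

lemma noise_rotate:
  assumes s: "s > 0" and cs: "c\<^sup>2 + s\<^sup>2 = 1"
  shows "noise \<Otimes>\<^sub>M noise = distr (noise \<Otimes>\<^sub>M noise) (noise \<Otimes>\<^sub>M noise)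
    (\<lambda>z. (combine c s (fst z) (snd z), combine s (- c) (fst z) (snd z)))" (is "_ = ?D")
proof (rule noise_pair_eqI)
  interpret NN: pair_prob_space noise noise ..
  have [measurable]: "(\<lambda>z. (combine c s (fst z) (snd z), combine s (- c) (fst z) (snd z)))
      \<in> measurable (noise \<Otimes>\<^sub>M noise) (noise \<Otimes>\<^sub>M noise)" by measurable
  show "sets ?D = sets (noise \<Otimes>\<^sub>M noise)" by simp
  show "finite_measure ?D" by (intro prob_space.finite_measure NN.prob_space_distr) measurable
  fix A B :: "'i \<Rightarrow> real set"
  assume A[measurable]: "\<And>p. p \<in> I \<Longrightarrow> A p \<in> sets borel" and B[measurable]: "\<And>p. p \<in> I \<Longrightarrow> B p \<in> sets borel"
  have AB[measurable]: "Pi\<^sub>E I A \<times> Pi\<^sub>E I B \<in> sets (noise \<Otimes>\<^sub>M noise)" using A B by (intro pair_measureI box_measurable)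
  have "emeasure ?D (Pi\<^sub>E I A \<times> Pi\<^sub>E I B)
      = (\<integral>\<^sup>+z. indicator (Pi\<^sub>E I A \<times> Pi\<^sub>E I B) (combine c s (fst z) (snd z), combine s (- c) (fst z) (snd z)) \<partial>(noise \<Otimes>\<^sub>M noise))"
  proof -
    have "emeasure ?D (Pi\<^sub>E I A \<times> Pi\<^sub>E I B) = (\<integral>\<^sup>+z. indicator (Pi\<^sub>E I A \<times> Pi\<^sub>E I B) z \<partial>?D)"
      using AB by simp
    then show ?thesis by (subst (asm) nn_integral_distr) auto
  qed
  also have "\<dots> = (\<integral>\<^sup>+x. \<integral>\<^sup>+y. indicator (Pi\<^sub>E I A \<times> Pi\<^sub>E I B) (combine c s x y, combine s (- c) x y) \<partial>noise \<partial>noise)"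
    by (subst noise.nn_integral_fst[symmetric]) auto
  also have "\<dots> = (\<integral>\<^sup>+x. \<integral>\<^sup>+y. (\<Prod>p\<in>I. indicator (A p) (c * x p + s * y p) * indicator (B p) (s * x p + - c * y p)) \<partial>noise \<partial>noise)"
    by (intro nn_integral_cong)
      (simp add: indicator_times indicator_box combine_def space_noise prod.distrib)
  also have "\<dots> = (\<integral>\<^sup>+x. (\<Prod>p\<in>I. \<integral>\<^sup>+y. indicator (A p) (c * x p + s * y) * indicator (B p) (s * x p + - c * y) \<partial>normal_law 0 (\<sigma> p)) \<partial>noise)"
    unfolding noise_def using A B fin by (subst PN.product_nn_integral_prod) auto
  also have "\<dots> = (\<Prod>p\<in>I. \<integral>\<^sup>+x. \<integral>\<^sup>+y. indicator (A p) (c * x + s * y) * indicator (B p) (s * x + - c * y) \<partial>normal_law 0 (\<sigma> p) \<partial>normal_law 0 (\<sigma> p))"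
    unfolding noise_def using A B fin by (subst PN.product_nn_integral_prod) auto
  also have "\<dots> = (\<Prod>p\<in>I. \<integral>\<^sup>+x. \<integral>\<^sup>+y. indicator (A p) x * indicator (B p) y \<partial>normal_law 0 (\<sigma> p) \<partial>normal_law 0 (\<sigma> p))"
    using A B nn_integral_normal_rotate[OF sd_pos s cs, where h="\<lambda>z. indicator (A _) (fst z) * indicator (B _) (snd z)"]
    by (intro prod.cong refl) simp
  also have "\<dots> = (\<Prod>p\<in>I. emeasure (normal_law 0 (\<sigma> p)) (A p) * emeasure (normal_law 0 (\<sigma> p)) (B p))"
    using A B by (intro prod.cong refl) (simp add: nn_integral_cmult nn_integral_multc)
  also have "\<dots> = emeasure noise (Pi\<^sub>E I A) * emeasure noise (Pi\<^sub>E I B)"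
    unfolding noise_def using A B fin by (simp add: PN.emeasure_PiM prod.distrib)
  finally show "emeasure ?D (Pi\<^sub>E I A \<times> Pi\<^sub>E I B) = emeasure noise (Pi\<^sub>E I A) * emeasure noise (Pi\<^sub>E I B)" .
qed


sublocale JN: pair_prob_space "joint r" noise for r ..

lemma moments_JN_fst:
  assumes "moments (joint r) F"
  shows "moments (joint r \<Otimes>\<^sub>M noise) (\<lambda>\<omega>. F (fst \<omega>))"
proof -
  have "moments (distr (joint r \<Otimes>\<^sub>M noise) (joint r) fst) F"
    using assms by (simp add: noise.distr_pair_fst)
  then show ?thesis
    by (subst (asm) moments_distr) (use assms in \<open>auto intro: moments_measurable\<close>)
qed

lemma integral_JN_fst:
  fixes F :: "_ \<Rightarrow> real"
  assumes "F \<in> borel_measurable (joint r)"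
  shows "(\<integral>\<omega>. F (fst \<omega>) \<partial>(joint r \<Otimes>\<^sub>M noise)) = (\<integral>z. F z \<partial>joint r)"
  using integral_distr[of fst "joint r \<Otimes>\<^sub>M noise" "joint r" F] assms by (simp add: noise.distr_pair_fst)

lemma moments_JN_snd:
  assumes p: "p \<in> I"
  shows "moments (joint r \<Otimes>\<^sub>M noise) (\<lambda>\<omega>. snd \<omega> p)"
proof -
  have "distr (joint r \<Otimes>\<^sub>M noise) noise snd = noise"
  proof (intro measure_eqI)
    fix A assume A: "A \<in> sets (distr (joint r \<Otimes>\<^sub>M noise) noise snd)"
    then have "emeasure (distr (joint r \<Otimes>\<^sub>M noise) noise snd) A = emeasure (joint r \<Otimes>\<^sub>M noise) (space (joint r) \<times> A)"
      by (auto simp add: emeasure_distr space_pair_measure simp del: space_joint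
          dest: sets.sets_into_space intro!: arg_cong2[where f=emeasure])
    with A show "emeasure (distr (joint r \<Otimes>\<^sub>M noise) noise snd) A = emeasure noise A"
      using joint.emeasure_space_1[of r] sets.top[of "joint r"]
      by (simp add: noise.emeasure_pair_measure_Times)
  qed simp
  then show ?thesis
    using moments_distr[of snd "joint r \<Otimes>\<^sub>M noise" noise "\<lambda>w. w p"] moments_noise[OF p] p by simp
qed

lemma observe_measurable'[measurable]:
  "f \<in> measurable M \<gamma> \<Longrightarrow> g \<in> measurable M noise \<Longrightarrow> (\<lambda>x. observe r (f x) (g x)) \<in> measurable M noise"
  using measurable_compose[of "\<lambda>x. (f x, g x)" M "\<gamma> \<Otimes>\<^sub>M noise", OF _ observe_measurable[of r]] by simp

text \<open>Reflecting the pair (observation at \<open>r\<close>, fresh noise) turns its mean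
  \<open>(r * S, 0)\<close> into \<open>(r * c * S, r * s * S)\<close> and keeps the two noises
  independent. The result has the law of two independent observations of the same signal at
  \<open>r * c\<close> and \<open>r * s\<close>.\<close>

lemma split_distr:
  assumes s: "s > 0" and cs: "c\<^sup>2 + s\<^sup>2 = 1"
  shows "distr (joint (r * c) \<Otimes>\<^sub>M noise) (\<gamma> \<Otimes>\<^sub>M (noise \<Otimes>\<^sub>M noise))
      (\<lambda>\<omega>. (fst (fst \<omega>), (snd (fst \<omega>), observe (r * s) (fst (fst \<omega>)) (snd \<omega>))))
    = distr (joint r \<Otimes>\<^sub>M noise) (\<gamma> \<Otimes>\<^sub>M (noise \<Otimes>\<^sub>M noise))
      (\<lambda>\<omega>. (fst (fst \<omega>), (combine c s (snd (fst \<omega>)) (snd \<omega>), combine s (- c) (snd (fst \<omega>)) (snd \<omega>))))"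
    (is "?D1 = ?D2")
proof (rule measure_eqI)
  show "sets ?D1 = sets ?D2" by simp
  fix X assume "X \<in> sets ?D1"
  then have X[measurable]: "X \<in> sets (\<gamma> \<Otimes>\<^sub>M (noise \<Otimes>\<^sub>M noise))" by simp
  let ?F = "indicator X :: _ \<Rightarrow> ennreal"
  have "emeasure ?D1 X = (\<integral>\<^sup>+\<omega>. ?F (fst (fst \<omega>), (snd (fst \<omega>), observe (r * s) (fst (fst \<omega>)) (snd \<omega>))) \<partial>(joint (r * c) \<Otimes>\<^sub>M noise))"
  proof -
    have "emeasure ?D1 X = (\<integral>\<^sup>+z. ?F z \<partial>?D1)" using X by simp
    then show ?thesis by (subst (asm) nn_integral_distr) auto
  qed
  also have "\<dots> = (\<integral>\<^sup>+z. \<integral>\<^sup>+w. ?F (fst z, (snd z, observe (r * s) (fst z) w)) \<partial>noise \<partial>joint (r * c))"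
    by (subst noise.nn_integral_fst[symmetric]) auto
  also have "\<dots> = (\<integral>\<^sup>+u. \<integral>\<^sup>+w'. \<integral>\<^sup>+w. ?F (u, (observe (r * c) u w', observe (r * s) u w)) \<partial>noise \<partial>noise \<partial>\<gamma>)"
    by (subst nn_integral_observe[symmetric]) auto
  also have "\<dots> = (\<integral>\<^sup>+u. \<integral>\<^sup>+w. \<integral>\<^sup>+x. ?F (u, (combine c s (observe r u w) x, combine s (- c) (observe r u w) x)) \<partial>noise \<partial>noise \<partial>\<gamma>)"
  proof (rule nn_integral_cong)
    fix u assume u[measurable]: "u \<in> space \<gamma>"
    have [measurable]: "(\<lambda>h. ?F (u, (observe (r * c) u (fst h), observe (r * s) u (snd h)))) \<in> borel_measurable (noise \<Otimes>\<^sub>M noise)"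
      by measurable
    have e: "observe (r * c) u (combine c s w x) = combine c s (observe r u w) x"
        "observe (r * s) u (combine s (- c) w x) = combine s (- c) (observe r u w) x" for w x
      by (auto simp: observe_def combine_def fun_eq_iff algebra_simps)
    have "(\<integral>\<^sup>+w'. \<integral>\<^sup>+w. ?F (u, (observe (r * c) u w', observe (r * s) u w)) \<partial>noise \<partial>noise)
        = (\<integral>\<^sup>+h. ?F (u, (observe (r * c) u (fst h), observe (r * s) u (snd h))) \<partial>(noise \<Otimes>\<^sub>M noise))"
      by (subst noise.nn_integral_fst[symmetric]) auto
    also have "\<dots> = (\<integral>\<^sup>+h. ?F (u, (combine c s (observe r u (fst h)) (snd h), combine s (- c) (observe r u (fst h)) (snd h))) \<partial>(noise \<Otimes>\<^sub>M noise))"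
      by (subst noise_rotate[OF s cs], subst nn_integral_distr) (auto simp: e)
    also have "\<dots> = (\<integral>\<^sup>+w. \<integral>\<^sup>+x. ?F (u, (combine c s (observe r u w) x, combine s (- c) (observe r u w) x)) \<partial>noise \<partial>noise)"
      by (subst noise.nn_integral_fst[symmetric]) auto
    finally show "(\<integral>\<^sup>+w'. \<integral>\<^sup>+w. ?F (u, (observe (r * c) u w', observe (r * s) u w)) \<partial>noise \<partial>noise)
        = (\<integral>\<^sup>+w. \<integral>\<^sup>+x. ?F (u, (combine c s (observe r u w) x, combine s (- c) (observe r u w) x)) \<partial>noise \<partial>noise)" .
  qed
  also have "\<dots> = (\<integral>\<^sup>+z. \<integral>\<^sup>+x. ?F (fst z, (combine c s (snd z) x, combine s (- c) (snd z) x)) \<partial>noise \<partial>joint r)"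
    by (subst nn_integral_observe[symmetric]) auto
  also have "\<dots> = (\<integral>\<^sup>+\<omega>. ?F (fst (fst \<omega>), (combine c s (snd (fst \<omega>)) (snd \<omega>), combine s (- c) (snd (fst \<omega>)) (snd \<omega>))) \<partial>(joint r \<Otimes>\<^sub>M noise))"
    by (subst noise.nn_integral_fst[symmetric]) auto
  also have "\<dots> = emeasure ?D2 X"
  proof -
    have "emeasure ?D2 X = (\<integral>\<^sup>+z. ?F z \<partial>?D2)" using X by simp
    then show ?thesis by (subst (asm) nn_integral_distr) auto
  qed
  finally show "emeasure ?D1 X = emeasure ?D2 X" .
qed

lemma split_transfer:
  fixes G :: "'u \<times> (('i \<Rightarrow> real) \<times> ('i \<Rightarrow> real)) \<Rightarrow> real"
  assumes s: "s > 0" and cs: "c\<^sup>2 + s\<^sup>2 = 1"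
    and G[measurable]: "G \<in> borel_measurable (\<gamma> \<Otimes>\<^sub>M (noise \<Otimes>\<^sub>M noise))"
  shows "moments (joint (r * c) \<Otimes>\<^sub>M noise) (\<lambda>\<omega>. G (fst (fst \<omega>), (snd (fst \<omega>), observe (r * s) (fst (fst \<omega>)) (snd \<omega>))))
    \<longleftrightarrow> moments (joint r \<Otimes>\<^sub>M noise) (\<lambda>\<omega>. G (fst (fst \<omega>), (combine c s (snd (fst \<omega>)) (snd \<omega>), combine s (- c) (snd (fst \<omega>)) (snd \<omega>))))"
    and "(\<integral>\<omega>. G (fst (fst \<omega>), (snd (fst \<omega>), observe (r * s) (fst (fst \<omega>)) (snd \<omega>))) \<partial>(joint (r * c) \<Otimes>\<^sub>M noise))
      = (\<integral>\<omega>. G (fst (fst \<omega>), (combine c s (snd (fst \<omega>)) (snd \<omega>), combine s (- c) (snd (fst \<omega>)) (snd \<omega>))) \<partial>(joint r \<Otimes>\<^sub>M noise))"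
proof -
  have m1: "(\<lambda>\<omega>. (fst (fst \<omega>), (snd (fst \<omega>), observe (r * s) (fst (fst \<omega>)) (snd \<omega>))))
      \<in> measurable (joint (r * c) \<Otimes>\<^sub>M noise) (\<gamma> \<Otimes>\<^sub>M (noise \<Otimes>\<^sub>M noise))" by measurable
  have m2: "(\<lambda>\<omega>. (fst (fst \<omega>), (combine c s (snd (fst \<omega>)) (snd \<omega>), combine s (- c) (snd (fst \<omega>)) (snd \<omega>))))
      \<in> measurable (joint r \<Otimes>\<^sub>M noise) (\<gamma> \<Otimes>\<^sub>M (noise \<Otimes>\<^sub>M noise))" by measurable
  note D = split_distr[OF s cs, of r]
  show "moments (joint (r * c) \<Otimes>\<^sub>M noise) (\<lambda>\<omega>. G (fst (fst \<omega>), (snd (fst \<omega>), observe (r * s) (fst (fst \<omega>)) (snd \<omega>))))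
    \<longleftrightarrow> moments (joint r \<Otimes>\<^sub>M noise) (\<lambda>\<omega>. G (fst (fst \<omega>), (combine c s (snd (fst \<omega>)) (snd \<omega>), combine s (- c) (snd (fst \<omega>)) (snd \<omega>))))"
    using moments_distr[OF m1 G] moments_distr[OF m2 G] D by simp
  show "(\<integral>\<omega>. G (fst (fst \<omega>), (snd (fst \<omega>), observe (r * s) (fst (fst \<omega>)) (snd \<omega>))) \<partial>(joint (r * c) \<Otimes>\<^sub>M noise))
      = (\<integral>\<omega>. G (fst (fst \<omega>), (combine c s (snd (fst \<omega>)) (snd \<omega>), combine s (- c) (snd (fst \<omega>)) (snd \<omega>))) \<partial>(joint r \<Otimes>\<^sub>M noise))"
    using integral_distr[OF m1 G] integral_distr[OF m2 G] D by simp
qed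

text \<open>The first row of the statement that the reflection is an involution: the two partial
  observations determine the full one.\<close>

lemma combine_combine:
  assumes cs: "c\<^sup>2 + s\<^sup>2 = 1" and y: "y \<in> space noise"
  shows "combine c s (combine c s y x) (combine s (- c) y x) = y"
proof
  fix p
  have "c * (c * y p + s * x p) + s * (s * y p + - c * x p) = (c\<^sup>2 + s\<^sup>2) * y p"
    by (simp add: power2_eq_square algebra_simps)
  then show "combine c s (combine c s y x) (combine s (- c) y x) p = y p"
    using y by (cases "p \<in> I") (auto simp: combine_def cs space_noise PiE_iff extensional_def)
qed

text \<open>In the reflected picture \<open>T\<close> depends on the full observation and on noise
  independent of it and of the signal, so \<open>nishimori\<close> applies with that noise frozen.
  Since \<open>T\<close> is arbitrary, \<open>avg r f\<close> at the recombined observation is the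
  conditional expectation of \<open>f\<close> given both parts.\<close>

lemma split_conditional:
  assumes s: "s > 0" and cs: "c\<^sup>2 + s\<^sup>2 = 1" and f: "moments \<gamma> f"
    and T[measurable]: "T \<in> borel_measurable (noise \<Otimes>\<^sub>M noise)"
    and Tm: "moments (joint (r * c) \<Otimes>\<^sub>M noise) (\<lambda>\<omega>. T (snd (fst \<omega>), observe (r * s) (fst (fst \<omega>)) (snd \<omega>)))"
  shows "(\<integral>\<omega>. f (fst (fst \<omega>)) * T (snd (fst \<omega>), observe (r * s) (fst (fst \<omega>)) (snd \<omega>)) \<partial>(joint (r * c) \<Otimes>\<^sub>M noise))
    = (\<integral>\<omega>. avg r f (combine c s (snd (fst \<omega>)) (observe (r * s) (fst (fst \<omega>)) (snd \<omega>)))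
        * T (snd (fst \<omega>), observe (r * s) (fst (fst \<omega>)) (snd \<omega>)) \<partial>(joint (r * c) \<Otimes>\<^sub>M noise))" (is ?A)
proof -
  note [measurable] = moments_measurable[OF f]
  let ?c = "\<lambda>z x. (combine c s (snd z) x, combine s (- c) (snd z) x)"
  let ?J = "joint r \<Otimes>\<^sub>M noise"
  have Tm2: "moments ?J (\<lambda>\<omega>. T (?c (fst \<omega>) (snd \<omega>)))"
    using split_transfer(1)[OF s cs, of "\<lambda>z. T (snd z)" r] Tm by simp
  have i1: "integrable ?J (\<lambda>\<omega>. f (fst (fst \<omega>)) * T (?c (fst \<omega>) (snd \<omega>)))"
    by (intro moments_integrable moments_mult Tm2 moments_JN_fst[of r "\<lambda>z. f (fst z)"] moments_joint_fst f)
  have i2: "integrable ?J (\<lambda>\<omega>. avg r f (snd (fst \<omega>)) * T (?c (fst \<omega>) (snd \<omega>)))"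
    by (intro moments_integrable moments_mult Tm2 moments_JN_fst[of r "\<lambda>z. avg r f (snd z)"] moments_avg f)
  have "(\<integral>\<omega>. f (fst (fst \<omega>)) * T (snd (fst \<omega>), observe (r * s) (fst (fst \<omega>)) (snd \<omega>)) \<partial>(joint (r * c) \<Otimes>\<^sub>M noise))
      = (\<integral>\<omega>. f (fst (fst \<omega>)) * T (?c (fst \<omega>) (snd \<omega>)) \<partial>?J)"
    using split_transfer(2)[OF s cs, of "\<lambda>z. f (fst z) * T (snd z)" r] by simp
  also have "\<dots> = (\<integral>x. (\<integral>z. f (fst z) * T (?c z x) \<partial>joint r) \<partial>noise)"
    using JN.integral_snd[of r "\<lambda>z x. f (fst z) * T (?c z x)"] i1 by (simp add: case_prod_beta')
  also have "\<dots> = (\<integral>x. (\<integral>z. avg r f (snd z) * T (?c z x) \<partial>joint r) \<partial>noise)"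
  proof (rule integral_cong_AE)
    show "(\<lambda>x. \<integral>z. f (fst z) * T (?c z x) \<partial>joint r) \<in> borel_measurable noise"
      "(\<lambda>x. \<integral>z. avg r f (snd z) * T (?c z x) \<partial>joint r) \<in> borel_measurable noise"
      by (intro joint.borel_measurable_lebesgue_integral; simp add: case_prod_beta')+
    have "AE x in noise. integrable (joint r) (\<lambda>z. f (fst z) * T (?c z x))"
      using JN.AE_integrable_snd[of r "\<lambda>z x. f (fst z) * T (?c z x)"] i1 by (simp add: case_prod_beta')
    then show "AE x in noise. (\<integral>z. f (fst z) * T (?c z x) \<partial>joint r) = (\<integral>z. avg r f (snd z) * T (?c z x) \<partial>joint r)"
    proof (rule AE_mp, intro AE_I2 impI)
      fix x assume i: "integrable (joint r) (\<lambda>z. f (fst z) * T (?c z x))"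
      show "(\<integral>z. f (fst z) * T (?c z x) \<partial>joint r) = (\<integral>z. avg r f (snd z) * T (?c z x) \<partial>joint r)"
        using nishimori(2)[OF i] by (simp add: avg_mult_right)
    qed
  qed
  also have "\<dots> = (\<integral>\<omega>. avg r f (snd (fst \<omega>)) * T (?c (fst \<omega>) (snd \<omega>)) \<partial>?J)"
    using JN.integral_snd[of r "\<lambda>z x. avg r f (snd z) * T (?c z x)"] i2 by (simp add: case_prod_beta')
  also have "\<dots> = (\<integral>\<omega>. avg r f (combine c s (combine c s (snd (fst \<omega>)) (snd \<omega>)) (combine s (- c) (snd (fst \<omega>)) (snd \<omega>)))
      * T (?c (fst \<omega>) (snd \<omega>)) \<partial>?J)"
    by (intro Bochner_Integration.integral_cong) (auto simp: space_pair_measure combine_combine[OF cs])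
  also have "\<dots> = (\<integral>\<omega>. avg r f (combine c s (snd (fst \<omega>)) (observe (r * s) (fst (fst \<omega>)) (snd \<omega>)))
        * T (snd (fst \<omega>), observe (r * s) (fst (fst \<omega>)) (snd \<omega>)) \<partial>(joint (r * c) \<Otimes>\<^sub>M noise))"
    using split_transfer(2)[OF s cs, of "\<lambda>z. avg r f (combine c s (fst (snd z)) (snd (snd z))) * T (snd z)" r] by simp
  finally show ?A .
qed

lemma split_avg:
  assumes s: "s > 0" and cs: "c\<^sup>2 + s\<^sup>2 = 1" and f: "moments \<gamma> f"
  shows "moments (joint (r * c) \<Otimes>\<^sub>M noise)
      (\<lambda>\<omega>. avg r f (combine c s (snd (fst \<omega>)) (observe (r * s) (fst (fst \<omega>)) (snd \<omega>))))"
    and "(\<integral>\<omega>. (avg r f (combine c s (snd (fst \<omega>)) (observe (r * s) (fst (fst \<omega>)) (snd \<omega>))))\<^sup>2 \<partial>(joint (r * c) \<Otimes>\<^sub>M noise))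
      = (\<integral>z. (avg r f (snd z))\<^sup>2 \<partial>joint r)"
proof -
  note [measurable] = moments_measurable[OF f]
  let ?J = "joint r \<Otimes>\<^sub>M noise"
  have eq: "avg r f (combine c s (combine c s (snd (fst \<omega>)) (snd \<omega>)) (combine s (- c) (snd (fst \<omega>)) (snd \<omega>)))
      = avg r f (snd (fst \<omega>))" if "\<omega> \<in> space ?J" for \<omega>
    using that by (auto simp: space_pair_measure combine_combine[OF cs])
  have "moments ?J (\<lambda>\<omega>. avg r f (combine c s (combine c s (snd (fst \<omega>)) (snd \<omega>)) (combine s (- c) (snd (fst \<omega>)) (snd \<omega>))))"
    by (rule JN.moments_dominated[OF _ moments_abs[OF moments_JN_fst[OF moments_avg[OF f, of r]]]]) (measurable, simp add: eq)
  then show "moments (joint (r * c) \<Otimes>\<^sub>M noise)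
      (\<lambda>\<omega>. avg r f (combine c s (snd (fst \<omega>)) (observe (r * s) (fst (fst \<omega>)) (snd \<omega>))))"
    using split_transfer(1)[OF s cs, of "\<lambda>z. avg r f (combine c s (fst (snd z)) (snd (snd z)))" r] by simp
  have "(\<integral>\<omega>. (avg r f (combine c s (snd (fst \<omega>)) (observe (r * s) (fst (fst \<omega>)) (snd \<omega>))))\<^sup>2 \<partial>(joint (r * c) \<Otimes>\<^sub>M noise))
      = (\<integral>\<omega>. (avg r f (combine c s (combine c s (snd (fst \<omega>)) (snd \<omega>)) (combine s (- c) (snd (fst \<omega>)) (snd \<omega>))))\<^sup>2 \<partial>?J)"
    using split_transfer(2)[OF s cs, of "\<lambda>z. (avg r f (combine c s (fst (snd z)) (snd (snd z))))\<^sup>2" r] by simp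
  also have "\<dots> = (\<integral>\<omega>. (avg r f (snd (fst \<omega>)))\<^sup>2 \<partial>?J)"
    by (intro Bochner_Integration.integral_cong) (auto simp: eq)
  also have "\<dots> = (\<integral>z. (avg r f (snd z))\<^sup>2 \<partial>joint r)"
    using integral_JN_fst[of "\<lambda>z. (avg r f (snd z))\<^sup>2" r] by simp
  finally show "(\<integral>\<omega>. (avg r f (combine c s (snd (fst \<omega>)) (observe (r * s) (fst (fst \<omega>)) (snd \<omega>))))\<^sup>2 \<partial>(joint (r * c) \<Otimes>\<^sub>M noise))
      = (\<integral>z. (avg r f (snd z))\<^sup>2 \<partial>joint r)" .
qed


section \<open>First two moments of linear statistics of the noise\<close>

lemma noise_mean:
  assumes p: "p \<in> I"
  shows "(\<integral>w. w p \<partial>noise) = 0"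
  using stein_PiM[where I=I and i=p and \<sigma>=\<sigma> and m="\<lambda>_. 0" and g="\<lambda>_. 1" and g'="\<lambda>_. 0"]
    fin p sd_pos moments_integrable[OF moments_noise[OF p]]
    noise.integrable_const[where a="1::real"] noise.integrable_const[where a="0::real"]
  by (auto simp: noise_def)

lemma noise_covariance:
  assumes p: "p \<in> I" and q: "q \<in> I"
  shows "(\<integral>w. w p * w q \<partial>noise) = (if p = q then (\<sigma> p)\<^sup>2 else 0)"
proof -
  have "(\<integral>w. (w p - 0) * w q \<partial>noise) = (\<sigma> p)\<^sup>2 * (\<integral>w. (if p = q then 1 else 0) \<partial>noise)"
    unfolding noise_def
  proof (rule stein_PiM[where m="\<lambda>_. 0" and g="\<lambda>w. w q" and g'="\<lambda>_. if p = q then 1 else 0"])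
    show "((\<lambda>t. (x(p := t)) q) has_real_derivative (if p = q then 1 else 0)) (at t)" for x t
      by auto
    show "integrable (PiM I (\<lambda>j. normal_law 0 (\<sigma> j))) (\<lambda>x. x q)"
      "integrable (PiM I (\<lambda>j. normal_law 0 (\<sigma> j))) (\<lambda>x. (x p - 0) * x q)"
      using moments_integrable[OF moments_noise[OF q]]
        moments_integrable[OF moments_mult[OF moments_noise[OF p] moments_noise[OF q]]]
      by (auto simp: noise_def)
    show "integrable (PiM I (\<lambda>j. normal_law 0 (\<sigma> j))) (\<lambda>_. if p = q then 1 else 0)"
      unfolding noise_def[symmetric] by simp
  qed (use fin p sd_pos in auto)
  then show ?thesis by (simp add: noise.prob_space)
qed

lemma noise_linear:
  "(\<integral>w. (\<Sum>p\<in>I. a p * w p) + h \<partial>noise) = h"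
  "(\<integral>w. ((\<Sum>p\<in>I. a p * w p) + h)\<^sup>2 \<partial>noise) = (\<Sum>p\<in>I. (a p)\<^sup>2 * (\<sigma> p)\<^sup>2) + h\<^sup>2"
proof -
  have i1: "integrable noise (\<lambda>w. a p * w p)" if "p \<in> I" for p
    using that by (intro integrable_mult_right moments_integrable moments_noise)
  have i2: "integrable noise (\<lambda>w. (a p * a q) * (w p * w q))" if "p \<in> I" "q \<in> I" for p q
    using that by (intro integrable_mult_right moments_integrable moments_mult moments_noise)
  have m: "(\<integral>w. (\<Sum>p\<in>I. a p * w p) \<partial>noise) = 0"
    by (subst Bochner_Integration.integral_sum) (auto simp: noise_mean moments_integrable[OF moments_noise])
  show "(\<integral>w. (\<Sum>p\<in>I. a p * w p) + h \<partial>noise) = h"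
    by (subst Bochner_Integration.integral_add[OF Bochner_Integration.integrable_sum[OF i1]]) (auto simp: m noise.prob_space)
  have sq: "((\<Sum>p\<in>I. a p * w p) + h)\<^sup>2
      = (\<Sum>p\<in>I. \<Sum>q\<in>I. (a p * a q) * (w p * w q)) + (2 * h * (\<Sum>p\<in>I. a p * w p) + h\<^sup>2)" for w :: "'i \<Rightarrow> real"
    by (simp add: power2_sum power2_eq_square[of "sum _ _"] sum_product mult_ac)
  have "(\<integral>w. ((\<Sum>p\<in>I. a p * w p) + h)\<^sup>2 \<partial>noise)
      = (\<integral>w. (\<Sum>p\<in>I. \<Sum>q\<in>I. (a p * a q) * (w p * w q)) \<partial>noise) + (\<integral>w. 2 * h * (\<Sum>p\<in>I. a p * w p) + h\<^sup>2 \<partial>noise)"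
    unfolding sq using i1 i2 by (intro Bochner_Integration.integral_add) auto
  also have "(\<integral>w. (\<Sum>p\<in>I. \<Sum>q\<in>I. (a p * a q) * (w p * w q)) \<partial>noise)
      = (\<Sum>p\<in>I. \<Sum>q\<in>I. (a p * a q) * (if p = q then (\<sigma> p)\<^sup>2 else 0))"
    using i2 by (simp add: Bochner_Integration.integral_sum noise_covariance)
  also have "\<dots> = (\<Sum>p\<in>I. (a p)\<^sup>2 * (\<sigma> p)\<^sup>2)"
    by (simp add: if_distrib[where f="\<lambda>x. _ * x"] fin power2_eq_square cong: if_cong)
  also have "(\<integral>w. 2 * h * (\<Sum>p\<in>I. a p * w p) + h\<^sup>2 \<partial>noise) = h\<^sup>2"
    by (subst Bochner_Integration.integral_add[OF integrable_mult_right[OF Bochner_Integration.integrable_sum[OF i1]]])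
      (auto simp: m noise.prob_space)
  finally show "(\<integral>w. ((\<Sum>p\<in>I. a p * w p) + h)\<^sup>2 \<partial>noise) = (\<Sum>p\<in>I. (a p)\<^sup>2 * (\<sigma> p)\<^sup>2) + h\<^sup>2" .
qed

section \<open>Gain from a further observation\<close>

definition cov :: "real \<Rightarrow> ('u \<Rightarrow> real) \<Rightarrow> ('u \<Rightarrow> real) \<Rightarrow> ('i \<Rightarrow> real) \<Rightarrow> real" where
  "cov r f g y = avg r (\<lambda>u. f u * g u) y - avg r f y * avg r g y"

text \<open>As in nonlinear filtering, its expectation is the rate at which the second moment of
  \<open>avg r f\<close> grows per unit of signal-to-noise ratio; below it is only reached through
  finite increments.\<close>

definition sensitivity :: "real \<Rightarrow> ('u \<Rightarrow> real) \<Rightarrow> ('i \<Rightarrow> real) \<Rightarrow> real" where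
  "sensitivity r f y = (\<Sum>p\<in>I. (cov r f (S p) y)\<^sup>2 / (\<sigma> p)\<^sup>2)"

definition spread :: "real \<Rightarrow> 'u \<times> ('i \<Rightarrow> real) \<Rightarrow> real" where
  "spread r z = (\<Sum>p\<in>I. (S p (fst z) - avg r (S p) (snd z))\<^sup>2 / (\<sigma> p)\<^sup>2)"

lemma moments_cov:
  "moments \<gamma> f \<Longrightarrow> moments \<gamma> g \<Longrightarrow> moments (joint r) (\<lambda>z. cov r f g (snd z))"
  unfolding cov_def by (intro moments_diff moments_mult moments_avg)

lemma moments_sensitivity: "moments \<gamma> f \<Longrightarrow> moments (joint r) (\<lambda>z. sensitivity r f (snd z))"
  unfolding sensitivity_def
  by (intro joint.moments_sum joint.moments_divide joint.moments_power moments_cov S_moments)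

lemma moments_spread: "moments (joint r) (spread r)"
  unfolding spread_def[abs_def]
  by (intro joint.moments_sum joint.moments_divide joint.moments_power moments_diff moments_avg
      moments_joint_fst S_moments)

lemma avg_centered_product:
  assumes f: "moments \<gamma> f" and g: "moments \<gamma> g"
  shows "avg r (\<lambda>u. (f u - avg r f y) * (g u - avg r g y)) y = cov r f g y"
proof -
  let ?a = "avg r f y" and ?b = "avg r g y"
  have "avg r (\<lambda>u. (f u - ?a) * (g u - ?b)) y = avg r (\<lambda>u. (f u * g u - f u * ?b) - (?a * g u - ?a * ?b)) y"
    by (simp add: algebra_simps)
  also have "\<dots> = (avg r (\<lambda>u. f u * g u) y - ?a * ?b) - (?a * ?b - ?a * ?b)"
  proof -
    have i: "integrable \<gamma> (\<lambda>u. f u * g u)" "integrable \<gamma> (\<lambda>u. f u * ?b)" "integrable \<gamma> (\<lambda>u. ?a * g u)"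
        "integrable \<gamma> (\<lambda>u. ?a * ?b)"
      by (intro moments_integrable moments_mult moments_const f g)+
    show ?thesis
      by (simp only: avg_diff[OF Bochner_Integration.integrable_diff[OF i(1,2)] Bochner_Integration.integrable_diff[OF i(3,4)]]
          avg_diff[OF i(1,2)] avg_diff[OF i(3,4)] avg_mult_left avg_mult_right avg_const)
  qed
  finally show ?thesis by (simp add: cov_def)
qed

text \<open>Lower bound for the gain from a second observation \<open>y''\<close>: the gain is tested against the linear
  statistic \<open>\<Sum>\<^sub>p cov(f, S\<^sub>p) (y''\<^sub>p - r s E[S\<^sub>p | y]) / \<sigma>\<^sub>p\<^sup>2\<close>.\<close>

lemma increment_single:
  fixes r c s :: real
  assumes s: "s > 0" and cs: "c\<^sup>2 + s\<^sup>2 = 1" and f: "moments \<gamma> f"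
  defines "J \<equiv> joint (r * c)"
  defines "\<Delta> \<equiv> (\<integral>z. (avg r f (snd z))\<^sup>2 \<partial>joint r) - (\<integral>z. (avg (r * c) f (snd z))\<^sup>2 \<partial>J)"
  shows "0 \<le> \<Delta>"
    and "\<bar>r * s\<bar> * (\<integral>z. sensitivity (r * c) f (snd z) \<partial>J)
      \<le> sqrt \<Delta> * sqrt ((\<integral>z. sensitivity (r * c) f (snd z) \<partial>J)
          + (r * s)\<^sup>2 * (\<integral>z. sensitivity (r * c) f (snd z) * spread (r * c) z \<partial>J))"
proof -
  define \<Omega> where "\<Omega> = J \<Otimes>\<^sub>M noise"
  interpret \<Omega>: prob_space \<Omega> unfolding \<Omega>_def J_def by (rule JN.prob_space_axioms)
  let ?A = "\<lambda>z. sensitivity (r * c) f (snd z)"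
  define obs where "obs = (\<lambda>\<omega>::('u \<times> ('i \<Rightarrow> real)) \<times> ('i \<Rightarrow> real). observe (r * s) (fst (fst \<omega>)) (snd \<omega>))"
  define V where "V = (\<lambda>\<omega>. avg r f (combine c s (snd (fst \<omega>)) (obs \<omega>)))"
  define W where "W = (\<lambda>\<omega>::('u \<times> ('i \<Rightarrow> real)) \<times> ('i \<Rightarrow> real). avg (r * c) f (snd (fst \<omega>)))"
  define a where "a = (\<lambda>p y. cov (r * c) f (S p) y / (\<sigma> p)\<^sup>2)"
  define b where "b = (\<lambda>p. avg (r * c) (S p))"
  define T where "T = (\<lambda>x. \<Sum>p\<in>I. a p (fst x) * (snd x p - r * s * b p (fst x)))"
  define h where "h = (\<lambda>z. r * s * (\<Sum>p\<in>I. a p (snd z) * (S p (fst z) - b p (snd z))))"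
  define TT where "TT = (\<lambda>\<omega>. T (snd (fst \<omega>), obs \<omega>))"
  note [measurable] = moments_measurable[OF f]
  have ma: "moments J (\<lambda>z. a p (snd z))" if "p \<in> I" for p
    unfolding a_def J_def by (intro joint.moments_divide moments_cov f S_moments that)
  have mbp: "moments J (\<lambda>z. b p (snd z))" if "p \<in> I" for p
    unfolding b_def J_def by (intro moments_avg S_moments that)
  have mS: "moments J (\<lambda>z. S p (fst z))" if "p \<in> I" for p
    unfolding J_def by (intro moments_joint_fst S_moments that)
  have mh: "moments J h"
    unfolding h_def J_def
    by (intro joint.moments_sum joint.moments_const moments_mult moments_diff ma[unfolded J_def] mbp[unfolded J_def] mS[unfolded J_def])
  have lift: "moments \<Omega> (\<lambda>\<omega>. F (fst \<omega>))" if "moments J F" for F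
    unfolding \<Omega>_def J_def by (rule moments_JN_fst[OF that[unfolded J_def]])
  have lift_int: "(\<integral>\<omega>. F (fst \<omega>) \<partial>\<Omega>) = (\<integral>z. F z \<partial>J)" if "moments J F" for F
    unfolding \<Omega>_def J_def by (rule integral_JN_fst) (use that in \<open>auto dest: moments_measurable simp: J_def\<close>)
  have mW: "moments \<Omega> W"
    unfolding W_def using lift[of "\<lambda>z. avg (r * c) f (snd z)"] moments_avg[OF f] by (simp add: J_def)
  have mV: "moments \<Omega> V" and V2: "(\<integral>\<omega>. (V \<omega>)\<^sup>2 \<partial>\<Omega>) = (\<integral>z. (avg r f (snd z))\<^sup>2 \<partial>joint r)"
    unfolding V_def obs_def \<Omega>_def J_def by (rule split_avg[OF s cs f])+
  have TT_eq: "TT \<omega> = (\<Sum>p\<in>I. a p (snd (fst \<omega>)) * snd \<omega> p) + h (fst \<omega>)" for \<omega>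
  proof -
    have "TT \<omega> = (\<Sum>p\<in>I. a p (snd (fst \<omega>)) * snd \<omega> p + r * s * (a p (snd (fst \<omega>)) * (S p (fst (fst \<omega>)) - b p (snd (fst \<omega>)))))"
      unfolding TT_def T_def obs_def observe_def by (intro sum.cong refl) (simp add: algebra_simps)
    then show ?thesis by (simp add: sum.distrib h_def sum_distrib_left)
  qed
  have mTT: "moments \<Omega> TT"
    unfolding TT_eq[abs_def]
    by (intro moments_add \<Omega>.moments_sum moments_mult lift[of h] mh lift[of "\<lambda>z. a _ (snd z)"] ma)
      (auto simp: \<Omega>_def J_def moments_JN_snd)
  have a_meas[measurable]: "a p \<in> borel_measurable noise" if "p \<in> I" for p
    unfolding a_def cov_def using that by measurable
  have b_meas[measurable]: "b p \<in> borel_measurable noise" if "p \<in> I" for p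
    unfolding b_def using that by measurable
  have T_meas[measurable]: "T \<in> borel_measurable (noise \<Otimes>\<^sub>M noise)"
    unfolding T_def by measurable
  \<comment> \<open>\<open>V\<close> is the conditional expectation of \<open>f\<close> given both
    observations, so either may be paired with a statistic of the two.\<close>
  have fT: "(\<integral>\<omega>. f (fst (fst \<omega>)) * TT \<omega> \<partial>\<Omega>) = (\<integral>\<omega>. V \<omega> * TT \<omega> \<partial>\<Omega>)"
    using split_conditional[OF s cs f T_meas, of r] mTT
    unfolding TT_def V_def obs_def \<Omega>_def J_def by simp
  have fW: "(\<integral>\<omega>. f (fst (fst \<omega>)) * W \<omega> \<partial>\<Omega>) = (\<integral>\<omega>. V \<omega> * W \<omega> \<partial>\<Omega>)"
    using split_conditional[OF s cs f, of "\<lambda>x. avg (r * c) f (fst x)" r] mW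
    unfolding W_def V_def obs_def \<Omega>_def J_def by simp
  have mf: "moments \<Omega> (\<lambda>\<omega>. f (fst (fst \<omega>)))"
    using lift[of "\<lambda>z. f (fst z)"] moments_joint_fst[OF f] by (simp add: J_def)
  have WW: "(\<integral>\<omega>. f (fst (fst \<omega>)) * W \<omega> \<partial>\<Omega>) = (\<integral>z. (avg (r * c) f (snd z))\<^sup>2 \<partial>J)"
  proof -
    have m: "moments J (\<lambda>z. f (fst z) * avg (r * c) f (snd z))"
      unfolding J_def by (intro moments_mult moments_joint_fst moments_avg f)
    have "(\<integral>\<omega>. f (fst (fst \<omega>)) * W \<omega> \<partial>\<Omega>) = (\<integral>z. f (fst z) * avg (r * c) f (snd z) \<partial>J)"
      unfolding W_def by (rule lift_int[OF m])
    also have "\<dots> = (\<integral>z. (avg (r * c) f (snd z))\<^sup>2 \<partial>J)"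
      using nishimori(2)[OF moments_integrable[OF m[unfolded J_def]]]
      by (simp add: avg_mult_right power2_eq_square J_def)
    finally show ?thesis .
  qed
  have W2: "(\<integral>\<omega>. (W \<omega>)\<^sup>2 \<partial>\<Omega>) = (\<integral>z. (avg (r * c) f (snd z))\<^sup>2 \<partial>J)"
    unfolding W_def
    by (rule lift_int[of "\<lambda>z. (avg (r * c) f (snd z))\<^sup>2"]) (unfold J_def, intro joint.moments_power moments_avg f)
  \<comment> \<open>Pythagoras: \<open>W\<close> conditions on less than \<open>V\<close>, so by
    \<open>fW\<close> and \<open>WW\<close> the pairing of \<open>V\<close> with \<open>W\<close>
    equals the second moment of \<open>W\<close>, and the gain becomes a squared distance.\<close>
  have "(\<integral>\<omega>. (V \<omega> - W \<omega>)\<^sup>2 \<partial>\<Omega>) = (\<integral>\<omega>. (V \<omega>)\<^sup>2 - 2 * (V \<omega> * W \<omega>) + (W \<omega>)\<^sup>2 \<partial>\<Omega>)"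
    by (simp add: power2_diff algebra_simps)
  also have "\<dots> = (\<integral>\<omega>. (V \<omega>)\<^sup>2 \<partial>\<Omega>) - 2 * (\<integral>\<omega>. V \<omega> * W \<omega> \<partial>\<Omega>) + (\<integral>\<omega>. (W \<omega>)\<^sup>2 \<partial>\<Omega>)"
  proof -
    have "integrable \<Omega> (\<lambda>\<omega>. (V \<omega>)\<^sup>2)" "integrable \<Omega> (\<lambda>\<omega>. V \<omega> * W \<omega>)" "integrable \<Omega> (\<lambda>\<omega>. (W \<omega>)\<^sup>2)"
      using mV mW by (auto intro!: moments_integrable \<Omega>.moments_power moments_mult)
    then show ?thesis by simp
  qed
  also have "\<dots> = \<Delta>" using V2 W2 WW fW by (simp add: \<Delta>_def)
  finally have VW: "(\<integral>\<omega>. (V \<omega> - W \<omega>)\<^sup>2 \<partial>\<Omega>) = \<Delta>" .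
  then show "0 \<le> \<Delta>" using Bochner_Integration.integral_nonneg[of \<Omega> "\<lambda>\<omega>. (V \<omega> - W \<omega>)\<^sup>2"] by simp
  have fub: "(\<integral>\<omega>. F \<omega> \<partial>\<Omega>) = (\<integral>z. (\<integral>w. F (z, w) \<partial>noise) \<partial>J)" if "moments \<Omega> F" for F
    using JN.integral_fst'[of "r * c" F] moments_integrable[OF that] by (simp add: \<Omega>_def J_def)
  \<comment> \<open>The fresh noise has mean 0, so only the drift \<open>h\<close> of the test
    statistic contributes; its posterior pairing with \<open>f\<close> produces the covariances with
    the signal.\<close>
  have fWT: "(\<integral>\<omega>. (f (fst (fst \<omega>)) - W \<omega>) * TT \<omega> \<partial>\<Omega>) = r * s * (\<integral>z. ?A z \<partial>J)"
  proof -
    have m: "moments J (\<lambda>z. (f (fst z) - avg (r * c) f (snd z)) * h z)"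
      using mh unfolding J_def by (intro moments_mult moments_diff moments_joint_fst moments_avg f)
    have "(\<integral>\<omega>. (f (fst (fst \<omega>)) - W \<omega>) * TT \<omega> \<partial>\<Omega>)
        = (\<integral>z. (\<integral>w. (f (fst z) - avg (r * c) f (snd z)) * ((\<Sum>p\<in>I. a p (snd z) * w p) + h z) \<partial>noise) \<partial>J)"
      by (subst fub[OF moments_mult[OF moments_diff[OF mf mW] mTT]]) (simp add: W_def TT_eq)
    also have "\<dots> = (\<integral>z. (f (fst z) - avg (r * c) f (snd z)) * h z \<partial>J)"
      by (simp add: noise_linear(1))
    also have "\<dots> = (\<integral>z. avg (r * c) (\<lambda>u. (f u - avg (r * c) f (snd z)) * h (u, snd z)) (snd z) \<partial>J)"
      using nishimori(2)[OF moments_integrable[OF m[unfolded J_def]]] by (simp add: J_def)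
    also have "\<dots> = (\<integral>z. r * s * ?A z \<partial>J)"
    proof (intro Bochner_Integration.integral_cong refl)
      fix z :: "'u \<times> ('i \<Rightarrow> real)"
      let ?y = "snd z"
      have "avg (r * c) (\<lambda>u. (f u - avg (r * c) f ?y) * h (u, ?y)) ?y
          = avg (r * c) (\<lambda>u. \<Sum>p\<in>I. r * s * a p ?y * ((f u - avg (r * c) f ?y) * (S p u - b p ?y))) ?y"
        by (simp add: h_def sum_distrib_left mult_ac)
      also have "\<dots> = (\<Sum>p\<in>I. r * s * a p ?y * cov (r * c) f (S p) ?y)"
        using f S_moments unfolding b_def
        by (subst avg_sum)
          (auto simp: avg_mult_left avg_centered_product
            intro!: integrable_mult_right moments_integrable moments_mult moments_diff moments_const)
      also have "\<dots> = r * s * ?A z"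
        by (simp add: a_def sensitivity_def sum_distrib_left power2_eq_square mult_ac)
      finally show "avg (r * c) (\<lambda>u. (f u - avg (r * c) f ?y) * h (u, ?y)) ?y = r * s * ?A z" .
    qed
    finally show ?thesis by simp
  qed
  have mA: "moments J ?A" unfolding J_def by (rule moments_sensitivity[OF f])
  have mAG: "moments J (\<lambda>z. ?A z * spread (r * c) z)"
    using mA unfolding J_def by (intro moments_mult moments_spread)
  \<comment> \<open>The noise part of the statistic has variance exactly \<open>?A\<close>; its
    drift is bounded by Cauchy-Schwarz, which brings in \<open>spread\<close>.\<close>
  have T2: "(\<integral>\<omega>. (TT \<omega>)\<^sup>2 \<partial>\<Omega>) \<le> (\<integral>z. ?A z \<partial>J) + (r * s)\<^sup>2 * (\<integral>z. ?A z * spread (r * c) z \<partial>J)"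
  proof -
    have "(\<integral>\<omega>. (TT \<omega>)\<^sup>2 \<partial>\<Omega>) = (\<integral>z. (\<integral>w. ((\<Sum>p\<in>I. a p (snd z) * w p) + h z)\<^sup>2 \<partial>noise) \<partial>J)"
      by (subst fub[OF \<Omega>.moments_power[OF mTT]]) (simp add: TT_eq)
    also have "\<dots> = (\<integral>z. (\<Sum>p\<in>I. (a p (snd z))\<^sup>2 * (\<sigma> p)\<^sup>2) + (h z)\<^sup>2 \<partial>J)"
      by (simp add: noise_linear(2))
    also have "\<dots> \<le> (\<integral>z. ?A z + (r * s)\<^sup>2 * (?A z * spread (r * c) z) \<partial>J)"
    proof (rule integral_mono)
      show "integrable J (\<lambda>z. (\<Sum>p\<in>I. (a p (snd z))\<^sup>2 * (\<sigma> p)\<^sup>2) + (h z)\<^sup>2)"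
        using ma mh unfolding J_def by (intro moments_integrable joint.moments_intros)
      show "integrable J (\<lambda>z. ?A z + (r * s)\<^sup>2 * (?A z * spread (r * c) z))"
        using mA mAG unfolding J_def
        by (intro moments_integrable moments_add moments_mult[OF joint.moments_const])
      fix z :: "'u \<times> ('i \<Rightarrow> real)"
      have 1: "(\<Sum>p\<in>I. (a p (snd z))\<^sup>2 * (\<sigma> p)\<^sup>2) = ?A z"
        unfolding sensitivity_def a_def
        by (intro sum.cong refl) (use sd_pos in \<open>simp add: power2_eq_square less_imp_neq[symmetric]\<close>)
      have "(\<Sum>p\<in>I. a p (snd z) * (S p (fst z) - b p (snd z)))\<^sup>2
          = (\<Sum>p\<in>I. (cov (r * c) f (S p) (snd z) / \<sigma> p) * ((S p (fst z) - b p (snd z)) / \<sigma> p))\<^sup>2"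
        by (simp add: a_def power2_eq_square)
      also have "\<dots> \<le> ?A z * spread (r * c) z"
        using Cauchy_Schwarz_ineq_sum[of "\<lambda>p. cov (r * c) f (S p) (snd z) / \<sigma> p" "\<lambda>p. (S p (fst z) - b p (snd z)) / \<sigma> p" I]
        by (simp add: sensitivity_def spread_def power_divide b_def)
      finally have "(h z)\<^sup>2 \<le> (r * s)\<^sup>2 * (?A z * spread (r * c) z)"
        unfolding h_def power_mult_distrib[of "r * s"] by (intro mult_left_mono) auto
      then show "(\<Sum>p\<in>I. (a p (snd z))\<^sup>2 * (\<sigma> p)\<^sup>2) + (h z)\<^sup>2 \<le> ?A z + (r * s)\<^sup>2 * (?A z * spread (r * c) z)"
        using 1 by simp
    qed
    also have "\<dots> = (\<integral>z. ?A z \<partial>J) + (r * s)\<^sup>2 * (\<integral>z. ?A z * spread (r * c) z \<partial>J)"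
      using moments_integrable[OF mA] moments_integrable[OF mAG] by simp
    finally show ?thesis .
  qed
  have "r * s * (\<integral>z. ?A z \<partial>J) = (\<integral>\<omega>. (V \<omega> - W \<omega>) * TT \<omega> \<partial>\<Omega>)"
  proof -
    have i: "integrable \<Omega> (\<lambda>\<omega>. f (fst (fst \<omega>)) * TT \<omega>)" "integrable \<Omega> (\<lambda>\<omega>. W \<omega> * TT \<omega>)" "integrable \<Omega> (\<lambda>\<omega>. V \<omega> * TT \<omega>)"
      using mf mW mV mTT by (auto intro!: moments_integrable moments_mult)
    show ?thesis unfolding fWT[symmetric] left_diff_distrib
      using i by (simp add: fT)
  qed
  then have "\<bar>r * s * (\<integral>z. ?A z \<partial>J)\<bar> \<le> sqrt (\<integral>\<omega>. (V \<omega> - W \<omega>)\<^sup>2 \<partial>\<Omega>) * sqrt (\<integral>\<omega>. (TT \<omega>)\<^sup>2 \<partial>\<Omega>)"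
    using \<Omega>.moments_cauchy_schwarz[OF moments_diff[OF mV mW] mTT] by simp
  also have "\<dots> \<le> sqrt \<Delta> * sqrt ((\<integral>z. ?A z \<partial>J) + (r * s)\<^sup>2 * (\<integral>z. ?A z * spread (r * c) z \<partial>J))"
    unfolding VW using T2 by (intro mult_left_mono) (auto simp: \<open>0 \<le> \<Delta>\<close>)
  finally have "\<bar>r * s * (\<integral>z. ?A z \<partial>J)\<bar> \<le> sqrt \<Delta> * sqrt ((\<integral>z. ?A z \<partial>J) + (r * s)\<^sup>2 * (\<integral>z. ?A z * spread (r * c) z \<partial>J))" .
  moreover have "0 \<le> (\<integral>z. ?A z \<partial>J)"
    by (intro Bochner_Integration.integral_nonneg) (auto simp: sensitivity_def intro!: sum_nonneg)
  ultimately show "\<bar>r * s\<bar> * (\<integral>z. ?A z \<partial>J) \<le> sqrt \<Delta> * sqrt ((\<integral>z. ?A z \<partial>J)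
          + (r * s)\<^sup>2 * (\<integral>z. ?A z * spread (r * c) z \<partial>J))"
    by (simp add: abs_mult)
qed

end

section \<open>The spiked GOE model\<close>

definition upper :: "nat \<Rightarrow> (nat \<times> nat) set" where
  "upper d = {(i, j). i \<le> j \<and> j < d}"

definition goe_sd :: "nat \<Rightarrow> nat \<times> nat \<Rightarrow> real" where
  "goe_sd d = (\<lambda>(i, j). if i = j then sqrt (2 / real d) else sqrt (1 / real d))"

lemma finite_upper: "finite (upper d)"
  by (rule finite_subset[of _ "{..<d} \<times> {..<d}"]) (auto simp: upper_def)

text \<open>The GOE variances \<open>2 / d\<close> on the diagonal and \<open>1 / d\<close> above it
  are what makes the weighted sum over the triangle a uniform sum over the square: an off-diagonal
  entry occurs twice in the square, a diagonal one once.\<close>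

lemma sum_upper:
  fixes F :: "nat \<Rightarrow> nat \<Rightarrow> real"
  assumes sym: "\<And>i j. F i j = F j i"
  shows "(\<Sum>p\<in>upper d. F (fst p) (snd p) / (goe_sd d p)\<^sup>2) = real d / 2 * (\<Sum>i<d. \<Sum>j<d. F i j)"
proof -
  let ?A = "{(i, j). i < j \<and> j < d}" and ?B = "{(i, j). i = j \<and> j < d}" and ?C = "{(i, j). j < i \<and> i < d}"
  have fin: "finite ?A" "finite ?B" "finite ?C"
    by (rule finite_subset[of _ "{..<d} \<times> {..<d}"]; auto)+
  have AC: "(\<Sum>p\<in>?C. F (fst p) (snd p)) = (\<Sum>p\<in>?A. F (fst p) (snd p))"
    by (rule sum.reindex_bij_witness[where i="\<lambda>(i, j). (j, i)" and j="\<lambda>(i, j). (j, i)"]) (auto simp: sym)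
  have "(\<Sum>i<d. \<Sum>j<d. F i j) = (\<Sum>p\<in>{..<d} \<times> {..<d}. F (fst p) (snd p))"
    by (simp add: sum.cartesian_product case_prod_beta')
  also have "{..<d} \<times> {..<d} = ?A \<union> (?B \<union> ?C)" by auto
  also have "(\<Sum>p\<in>?A \<union> (?B \<union> ?C). F (fst p) (snd p))
      = 2 * (\<Sum>p\<in>?A. F (fst p) (snd p)) + (\<Sum>p\<in>?B. F (fst p) (snd p))"
    using fin by (subst sum.union_disjoint, simp, simp, force, subst sum.union_disjoint) (auto simp: AC)
  finally have full: "(\<Sum>i<d. \<Sum>j<d. F i j) = 2 * (\<Sum>p\<in>?A. F (fst p) (snd p)) + (\<Sum>p\<in>?B. F (fst p) (snd p))" .
  have "upper d = ?A \<union> ?B" by (auto simp: upper_def)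
  then have "(\<Sum>p\<in>upper d. F (fst p) (snd p) / (goe_sd d p)\<^sup>2)
      = (\<Sum>p\<in>?A. F (fst p) (snd p) / (goe_sd d p)\<^sup>2) + (\<Sum>p\<in>?B. F (fst p) (snd p) / (goe_sd d p)\<^sup>2)"
    using fin by (simp add: sum.union_disjoint disjoint_iff)
  also have "(\<Sum>p\<in>?A. F (fst p) (snd p) / (goe_sd d p)\<^sup>2) = (\<Sum>p\<in>?A. real d * F (fst p) (snd p))"
    by (intro sum.cong refl) (auto simp: goe_sd_def)
  also have "(\<Sum>p\<in>?B. F (fst p) (snd p) / (goe_sd d p)\<^sup>2) = (\<Sum>p\<in>?B. real d / 2 * F (fst p) (snd p))"
    by (intro sum.cong refl) (auto simp: goe_sd_def)
  finally show ?thesis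
    unfolding full sum_distrib_left[symmetric] by (simp add: algebra_simps)
qed

lemma spike_law_eq: "spike_law d m = PiM {..<d} (\<lambda>i. normal_law (m / sqrt (real d)) (sqrt (1 / real d)))"
  by (simp add: spike_law_def)

lemma prob_space_spike_law: "d > 0 \<Longrightarrow> prob_space (spike_law d m)"
  unfolding spike_law_eq by (intro prob_space_PiM prob_space_normal_density) simp

lemma moments_spike_coordinate:
  assumes "d > 0" "i < d"
  shows "moments (spike_law d m) (\<lambda>u. u i)"
proof -
  have s: "0 < sqrt (1 / real d)" using assms by simp
  show ?thesis
    using moments_distr[of "\<lambda>u. u i" "spike_law d m" "normal_law (m / sqrt d) (sqrt (1 / d))" "\<lambda>x. x"]
      moments_normal_law[OF s, of "m / sqrt d"]
      distr_PiM_component[of "{..<d}" "\<lambda>_. normal_law (m / sqrt d) (sqrt (1 / d))" i] assms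
    by (simp add: spike_law_eq prob_space_normal_density s)
qed

text \<open>Bounds the twelfth moment of \<open>1 + (m + g)\<^sup>2\<close> with standard Gaussian
  \<open>g\<close>, for all means of modulus at most \<open>M\<close>. The exponent is
  \<open>3 * 4\<close>: fourth moments of the cube in \<open>envelope\<close> are needed.\<close>

definition moment_bound :: "real \<Rightarrow> real" where
  "moment_bound M = (\<integral>g. (1 + 2 * M\<^sup>2 + 2 * g\<^sup>2) ^ 12 \<partial>normal_law 0 1)"

lemma integral_normal_affine:
  fixes f :: "real \<Rightarrow> real"
  assumes \<sigma>: "\<sigma> > 0" and [measurable]: "f \<in> borel_measurable borel"
  shows "(\<integral>x. f x \<partial>normal_law \<mu> \<sigma>) = (\<integral>g. f (\<mu> + \<sigma> * g) \<partial>normal_law 0 1)"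
proof -
  have dens: "normal_density \<mu> \<sigma> (\<mu> + \<sigma> * g) = normal_density 0 1 g / \<sigma>" for g
    using \<sigma> by (simp add: normal_density_def real_sqrt_mult power_mult_distrib)
  have "(\<integral>x. f x \<partial>normal_law \<mu> \<sigma>) = (\<integral>x. normal_density \<mu> \<sigma> x * f x \<partial>lborel)"
    by (simp add: integral_density)
  also have "\<dots> = \<sigma> * (\<integral>g. normal_density \<mu> \<sigma> (\<mu> + \<sigma> * g) * f (\<mu> + \<sigma> * g) \<partial>lborel)"
    using \<sigma> by (subst lborel_integral_real_affine[where c=\<sigma> and t=\<mu>]) auto
  also have "\<dots> = (\<integral>g. normal_density 0 1 g * f (\<mu> + \<sigma> * g) \<partial>lborel)"
    using \<sigma> by (subst integral_mult_right_zero[symmetric]) (simp add: dens)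
  also have "\<dots> = (\<integral>g. f (\<mu> + \<sigma> * g) \<partial>normal_law 0 1)"
    by (simp add: integral_density)
  finally show ?thesis .
qed

lemma power_mean_12:
  fixes f :: "nat \<Rightarrow> real"
  assumes "d > 0"
  shows "((\<Sum>i<d. f i) / d) ^ 12 \<le> (\<Sum>i<d. f i ^ 12) / d"
  using convex_on_sum[of "{..<d}" UNIV "\<lambda>x::real. x ^ 12" "\<lambda>_. 1 / d" f] convex_power_even[of 12] assms
  by (auto simp: sum_divide_distrib)

lemma power4_sum_le:
  fixes a b :: real
  shows "(a + b) ^ 4 \<le> 8 * (a ^ 4 + b ^ 4)"
proof -
  have sq: "(x + y)\<^sup>2 \<le> 2 * (x\<^sup>2 + y\<^sup>2)" for x y :: real
    using sum_squares_bound[of x y] by (simp add: power2_sum)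
  have "((a + b)\<^sup>2)\<^sup>2 \<le> (2 * (a\<^sup>2 + b\<^sup>2))\<^sup>2" by (intro power_mono sq) auto
  also have "\<dots> = 4 * (a\<^sup>2 + b\<^sup>2)\<^sup>2" by (simp only: power_mult_distrib) simp
  also have "\<dots> \<le> 4 * (2 * ((a\<^sup>2)\<^sup>2 + (b\<^sup>2)\<^sup>2))" by (intro mult_left_mono sq) auto
  finally show ?thesis by simp
qed

lemma square_sum_le: "(a + b)\<^sup>2 \<le> 2 * a\<^sup>2 + 2 * b\<^sup>2" "(a - b)\<^sup>2 \<le> 2 * a\<^sup>2 + 2 * b\<^sup>2" for a b :: real
  using sum_squares_bound[of a b] sum_squares_bound[of a "-b"] by (simp_all add: power2_sum power2_diff)

lemma isCont_update: "isCont (\<lambda>t::real. (x(i := t)) j) t"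
  by (cases "j = i") auto

text \<open>This and the next four definitions chain the error bounds proved below, with the mean
  replaced by \<open>m\<^sub>1\<close> or \<open>m\<^sub>2\<close>, its moment by \<open>B\<close>,
  and the root and the ratio by their bounds \<open>Q\<close> and \<open>R\<close>. Being explicit,
  one sequence in \<open>d\<close> serves all means between \<open>m\<^sub>1\<close> and
  \<open>m\<^sub>2\<close>.\<close>

definition third_rate :: "real \<Rightarrow> real \<Rightarrow> nat \<Rightarrow> real" where
  "third_rate B \<epsilon> d = sqrt (2048 * B\<^sup>2 * (1 + \<epsilon>) / (\<epsilon> * real d))"

definition cov_rate :: "real \<Rightarrow> real \<Rightarrow> real \<Rightarrow> nat \<Rightarrow> real" where
  "cov_rate B \<epsilon> m\<^sub>1 d = 2 / m\<^sub>1 * (third_rate B \<epsilon> d / (2 * m\<^sub>1) + 3 * sqrt (8 * (16 * B)) * sqrt (1 / real d))"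

definition overlap_rate :: "real \<Rightarrow> real \<Rightarrow> real \<Rightarrow> nat \<Rightarrow> real" where
  "overlap_rate B \<epsilon> m\<^sub>1 d = sqrt (16 * B) * sqrt (cov_rate B \<epsilon> m\<^sub>1 d)"

definition var_rate :: "real \<Rightarrow> real \<Rightarrow> real \<Rightarrow> real \<Rightarrow> real \<Rightarrow> real \<Rightarrow> nat \<Rightarrow> real" where
  "var_rate B \<epsilon> m\<^sub>1 m\<^sub>2 Q R d = Q / m\<^sub>1\<^sup>2 * (sqrt (8 * (16 * B + Q ^ 4))
    * ((4 * R + R * (1 + m\<^sub>2\<^sup>2)) * sqrt (overlap_rate B \<epsilon> m\<^sub>1 d) + m\<^sub>2 * sqrt (1 / real d) + R * sqrt ((2 + 4 * m\<^sub>2\<^sup>2) / real d)))"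

definition cross_rate :: "real \<Rightarrow> real \<Rightarrow> real \<Rightarrow> real \<Rightarrow> real \<Rightarrow> real \<Rightarrow> nat \<Rightarrow> real" where
  "cross_rate B \<epsilon> m\<^sub>1 m\<^sub>2 Q R d = cov_rate B \<epsilon> m\<^sub>1 d + 2 * overlap_rate B \<epsilon> m\<^sub>1 d
    + sqrt (8 * (16 * B + Q ^ 4)) * sqrt (var_rate B \<epsilon> m\<^sub>1 m\<^sub>2 Q R d)"

lemma cross_rate_tendsto: "(\<lambda>d. cross_rate B \<epsilon> m\<^sub>1 m\<^sub>2 Q R d) \<longlonglongrightarrow> 0"
proof -
  have inv: "(\<lambda>d. c / real d) \<longlonglongrightarrow> 0" for c by (rule lim_const_over_n)
  have sq: "(\<lambda>d. sqrt (f d)) \<longlonglongrightarrow> 0" if "f \<longlonglongrightarrow> 0" for f :: "nat \<Rightarrow> real"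
    using tendsto_real_sqrt[OF that] by simp
  have t: "third_rate B \<epsilon> \<longlonglongrightarrow> 0"
    unfolding third_rate_def[abs_def] by (rule sq) (use inv[of "2048 * B\<^sup>2 * (1 + \<epsilon>) / \<epsilon>"] in simp)
  have k: "cov_rate B \<epsilon> m\<^sub>1 \<longlonglongrightarrow> 0"
    unfolding cov_rate_def[abs_def]
    by (intro tendsto_mult_right_zero tendsto_add_zero tendsto_divide_zero t sq inv)
  have o: "overlap_rate B \<epsilon> m\<^sub>1 \<longlonglongrightarrow> 0"
    unfolding overlap_rate_def[abs_def] by (intro tendsto_mult_right_zero sq k)
  have v: "var_rate B \<epsilon> m\<^sub>1 m\<^sub>2 Q R \<longlonglongrightarrow> 0"
    unfolding var_rate_def[abs_def] by (intro tendsto_mult_right_zero tendsto_add_zero sq o inv)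
  show ?thesis
    unfolding cross_rate_def[abs_def] by (intro tendsto_mult_right_zero tendsto_add_zero sq o k v)
qed

locale spiked_goe =
  fixes d :: nat and m :: real
  assumes d_pos: "d > 0"
begin

sublocale gaussian_channel "spike_law d m" "upper d" "goe_sd d" "\<lambda>p u. u (fst p) * u (snd p)"
proof -
  interpret prob_space "spike_law d m" by (rule prob_space_spike_law[OF d_pos])
  show "gaussian_channel (spike_law d m) (upper d) (goe_sd d) (\<lambda>p u. u (fst p) * u (snd p))"
  proof
    show "finite (upper d)" by (rule finite_upper)
    show "0 < goe_sd d p" for p using d_pos by (auto simp: goe_sd_def split: prod.split)
    show "moments (spike_law d m) (\<lambda>u. u (fst p) * u (snd p))" if "p \<in> upper d" for p
      using that d_pos by (intro moments_mult moments_spike_coordinate) (auto simp: upper_def)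
  qed
qed

abbreviation "\<gamma> \<equiv> spike_law d m"

lemma noise_eq_goe_law: "noise = goe_law d"
  unfolding noise_def goe_law_def upper_def[symmetric]
  by (intro arg_cong2[where f=PiM] refl) (auto simp: fun_eq_iff goe_sd_def)

lemma moments_coord: "i < d \<Longrightarrow> moments \<gamma> (\<lambda>u. u i)"
  by (rule moments_spike_coordinate[OF d_pos])

definition sqnorm :: "(nat \<Rightarrow> real) \<Rightarrow> real" where
  "sqnorm u = (\<Sum>i<d. (u i)\<^sup>2)"

lemma sqnorm_nonneg: "0 \<le> sqnorm u"
  by (simp add: sqnorm_def sum_nonneg)

lemma moments_sqnorm: "moments \<gamma> sqnorm"
  unfolding sqnorm_def[abs_def] by (intro moments_sum moments_power moments_coord) auto

section \<open>The likelihood of the spike and Stein's identity under the posterior\<close>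

lemma lik_eq:
  "lik r y u = exp (real d / 2 * r * (\<Sum>i<d. \<Sum>j<d. goe_matrix y i j * (u i * u j)) - real d / 4 * r\<^sup>2 * (sqnorm u)\<^sup>2)"
proof -
  let ?F = "\<lambda>i j. goe_matrix y i j * (r * (u i * u j)) - (r * (u i * u j))\<^sup>2 / 2"
  have "(\<Sum>p\<in>upper d. (y p * (r * (u (fst p) * u (snd p))) - (r * (u (fst p) * u (snd p)))\<^sup>2 / 2) / (goe_sd d p)\<^sup>2)
      = (\<Sum>p\<in>upper d. ?F (fst p) (snd p) / (goe_sd d p)\<^sup>2)"
    by (intro sum.cong refl) (auto simp: goe_matrix_def upper_def min_def max_def)
  also have "\<dots> = real d / 2 * (\<Sum>i<d. \<Sum>j<d. ?F i j)"
    by (rule sum_upper) (simp add: goe_matrix_def min.commute max.commute mult_ac)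
  also have "(\<Sum>i<d. \<Sum>j<d. ?F i j) = r * (\<Sum>i<d. \<Sum>j<d. goe_matrix y i j * (u i * u j)) - r\<^sup>2 / 2 * (sqnorm u)\<^sup>2"
    by (simp add: sqnorm_def sum_subtractf power2_eq_square[of "sum _ _"] sum_product power_mult_distrib sum_distrib_left mult_ac)
  finally show ?thesis unfolding lik_def by (simp add: algebra_simps)
qed

lemma lik_signal_derivative:
  assumes k: "k < d"
  shows "((\<lambda>t. lik r y (u(k := t))) has_real_derivative
    lik r y (u(k := t)) * (real d * (r * (\<Sum>j<d. goe_matrix y k j * (u(k := t)) j) - r\<^sup>2 * sqnorm (u(k := t)) * (u(k := t)) k))) (at t)"
proof -
  let ?\<delta> = "\<lambda>i. if i = k then 1 else 0 :: real"
  have c: "((\<lambda>t. (u(k := t)) i) has_real_derivative ?\<delta> i) (at t)" for i t by auto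
  have sym: "goe_matrix y i j = goe_matrix y j i" for i j by (simp add: goe_matrix_def min.commute max.commute)
  let ?M = "\<Sum>j<d. goe_matrix y k j * (u(k := t)) j"
  have q: "((\<lambda>t. \<Sum>i<d. \<Sum>j<d. goe_matrix y i j * ((u(k := t)) i * (u(k := t)) j)) has_real_derivative 2 * ?M) (at t)"
  proof -
    have "((\<lambda>t. \<Sum>i<d. \<Sum>j<d. goe_matrix y i j * ((u(k := t)) i * (u(k := t)) j)) has_real_derivative
      (\<Sum>i<d. \<Sum>j<d. goe_matrix y i j * (?\<delta> i * (u(k := t)) j + ?\<delta> j * (u(k := t)) i))) (at t)"
      by (intro DERIV_sum DERIV_cmult DERIV_mult c)
    moreover have "(\<Sum>i<d. \<Sum>j<d. goe_matrix y i j * (?\<delta> i * (u(k := t)) j + ?\<delta> j * (u(k := t)) i)) = 2 * ?M"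
    proof -
      have "(\<Sum>i<d. \<Sum>j<d. goe_matrix y i j * (?\<delta> i * (u(k := t)) j + ?\<delta> j * (u(k := t)) i))
        = (\<Sum>i<d. ?\<delta> i * (\<Sum>j<d. goe_matrix y i j * (u(k := t)) j)) + (\<Sum>i<d. \<Sum>j<d. ?\<delta> j * (goe_matrix y i j * (u(k := t)) i))"
        by (simp add: distrib_left sum.distrib sum_distrib_left mult_ac)
      also have "(\<Sum>i<d. ?\<delta> i * (\<Sum>j<d. goe_matrix y i j * (u(k := t)) j)) = ?M"
        using k by (simp add: if_distrib[where f="\<lambda>x. x * _"] cong: if_cong)
      also have "(\<Sum>i<d. \<Sum>j<d. ?\<delta> j * (goe_matrix y i j * (u(k := t)) i)) = ?M"
        using k by (simp add: if_distrib[where f="\<lambda>x. x * _"] sym[of _ k] cong: if_cong)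
      finally show ?thesis by simp
    qed
    ultimately show ?thesis by (simp only:)
  qed
  have n: "((\<lambda>t. sqnorm (u(k := t))) has_real_derivative 2 * (u(k := t)) k) (at t)"
  proof -
    have "((\<lambda>t. \<Sum>i<d. ((u(k := t)) i)\<^sup>2) has_real_derivative (\<Sum>i<d. real 2 * (?\<delta> i * ((u(k := t)) i) ^ (2 - Suc 0)))) (at t)"
      by (intro DERIV_sum DERIV_power c)
    moreover have "(\<Sum>i<d. real 2 * (?\<delta> i * ((u(k := t)) i) ^ (2 - Suc 0))) = 2 * (u(k := t)) k"
      using k by (simp add: if_distrib[where f="\<lambda>x. x * _"] sum_distrib_left[symmetric] del: fun_upd_apply cong: if_cong)
    ultimately show ?thesis unfolding sqnorm_def by (simp only:)
  qed
  have "((\<lambda>t. exp (real d / 2 * r * (\<Sum>i<d. \<Sum>j<d. goe_matrix y i j * ((u(k := t)) i * (u(k := t)) j)) - real d / 4 * r\<^sup>2 * (sqnorm (u(k := t)))\<^sup>2))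
    has_real_derivative
      exp (real d / 2 * r * (\<Sum>i<d. \<Sum>j<d. goe_matrix y i j * ((u(k := t)) i * (u(k := t)) j)) - real d / 4 * r\<^sup>2 * (sqnorm (u(k := t)))\<^sup>2)
      * (real d / 2 * r * (2 * ?M) - real d / 4 * r\<^sup>2 * (real 2 * ((2 * (u(k := t)) k) * sqnorm (u(k := t)) ^ (2 - Suc 0))))) (at t)"
    by (intro DERIV_fun_exp DERIV_diff DERIV_cmult q DERIV_power n)
  then show ?thesis
    unfolding lik_eq by (rule DERIV_cong) (simp add: algebra_simps del: fun_upd_apply)
qed

text \<open>Stein's identity for the Gaussian prior with \<open>lik r y\<close> as test function,
  divided by \<open>Z r y\<close>. The gradient of the log-likelihood supplies the matrix acting on
  the posterior mean and the cubic correction.\<close>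

lemma posterior_stein:
  assumes k: "k < d"
  shows "avg r (\<lambda>u. u k) y - m / sqrt (real d)
    = r * (\<Sum>j<d. goe_matrix y k j * avg r (\<lambda>u. u j) y) - r\<^sup>2 * avg r (\<lambda>u. sqnorm u * u k) y"
proof -
  let ?f = "\<lambda>u. real d * (r * (\<Sum>j<d. goe_matrix y k j * u j) - r\<^sup>2 * (sqnorm u * u k))"
  have f: "moments \<gamma> ?f"
    using k by (intro moments_intros moments_coord moments_sqnorm) auto
  have g': "moments \<gamma> (\<lambda>u. u k - m / sqrt (real d))" by (intro moments_intros moments_coord k)
  have "(\<integral>u. (u k - m / sqrt (real d)) * lik r y u \<partial>\<gamma>)
      = (sqrt (1 / real d))\<^sup>2 * (\<integral>u. ?f u * lik r y u \<partial>\<gamma>)"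
    unfolding spike_law_eq
  proof (rule stein_PiM)
    show "((\<lambda>t. lik r y (u(k := t))) has_real_derivative ?f (u(k := t)) * lik r y (u(k := t))) (at t)" for u t
      using lik_signal_derivative[OF k, of r y u t] by (simp add: mult_ac del: fun_upd_apply)
    show "isCont (\<lambda>t. ?f (u(k := t)) * lik r y (u(k := t))) t" for u t
    proof -
      have "isCont (\<lambda>t. (u(k := t)) i) t" for i by (cases "i = k") auto
      then show ?thesis
        unfolding sqnorm_def by (intro continuous_intros DERIV_isCont[OF lik_signal_derivative[OF k]])
    qed
  qed (use k d_pos integrable_lik1[of r y] integrable_lik[OF moments_integrable[OF f], of r y]
        integrable_lik[OF moments_integrable[OF g'], of r y] in \<open>auto simp: spike_law_eq\<close>)
  then have "avg r (\<lambda>u. u k - m / sqrt (real d)) y = 1 / real d * avg r ?f y"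
    using moments_measurable[OF f] moments_measurable[OF g'] d_pos by (simp add: avg_eq real_sqrt_divide power_divide)
  also have "avg r ?f y = real d * (r * (\<Sum>j<d. goe_matrix y k j * avg r (\<lambda>u. u j) y) - r\<^sup>2 * avg r (\<lambda>u. sqnorm u * u k) y)"
  proof -
    have i: "integrable \<gamma> (\<lambda>u. r * (\<Sum>j<d. goe_matrix y k j * u j))" "integrable \<gamma> (\<lambda>u. r\<^sup>2 * (sqnorm u * u k))"
      using k by (intro moments_integrable moments_intros moments_coord moments_sqnorm; auto)+
    have i2: "integrable \<gamma> (\<lambda>u. goe_matrix y k j * u j)" if "j \<in> {..<d}" for j
      using that by (intro moments_integrable moments_intros moments_coord) auto
    have "avg r (\<lambda>u. \<Sum>j<d. goe_matrix y k j * u j) y = (\<Sum>j<d. goe_matrix y k j * avg r (\<lambda>u. u j) y)"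
      using avg_sum[of "{..<d}" "\<lambda>j u. goe_matrix y k j * u j", OF i2] by (simp only: avg_mult_left)
    then show ?thesis
      by (simp only: avg_mult_left avg_diff[OF i])
  qed
  also have "avg r (\<lambda>u. u k - m / sqrt (real d)) y = avg r (\<lambda>u. u k) y - m / sqrt (real d)"
    using moments_integrable[OF moments_coord[OF k]] by (simp add: avg_diff avg_const)
  finally show ?thesis using d_pos by simp
qed


section \<open>Posterior mean, overlap with the signal, and the quadratic identity\<close>

definition post_mean :: "real \<Rightarrow> nat \<Rightarrow> (nat \<times> nat \<Rightarrow> real) \<Rightarrow> real" where
  "post_mean r i y = avg r (\<lambda>u. u i) y"

definition mean_sq :: "real \<Rightarrow> (nat \<times> nat \<Rightarrow> real) \<Rightarrow> real" where
  "mean_sq r y = (\<Sum>i<d. (post_mean r i y)\<^sup>2)"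

definition overlap :: "real \<Rightarrow> (nat \<Rightarrow> real) \<times> (nat \<times> nat \<Rightarrow> real) \<Rightarrow> real" where
  "overlap r z = (\<Sum>i<d. post_mean r i (snd z) * fst z i)"

definition dir_sum :: "(nat \<Rightarrow> real) \<Rightarrow> real" where
  "dir_sum u = (\<Sum>i<d. u i) / sqrt (real d)"

lemma moments_post_mean: "i < d \<Longrightarrow> moments (joint r) (\<lambda>z. post_mean r i (snd z))"
  unfolding post_mean_def by (intro moments_avg moments_coord)

lemma moments_mean_sq: "moments (joint r) (\<lambda>z. mean_sq r (snd z))"
  unfolding mean_sq_def by (intro joint.moments_sum joint.moments_power moments_post_mean) auto

lemma moments_joint_coord: "i < d \<Longrightarrow> moments (joint r) (\<lambda>z. fst z i)"
  using moments_joint_fst[OF moments_coord, of i r] by simp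

lemma moments_overlap: "moments (joint r) (overlap r)"
  unfolding overlap_def[abs_def]
  by (intro joint.moments_sum moments_mult moments_post_mean moments_joint_coord) auto

lemma moments_dir_sum: "moments \<gamma> dir_sum"
  unfolding dir_sum_def[abs_def] by (intro moments_divide moments_sum moments_coord) auto

lemma moments_joint_sqnorm: "moments (joint r) (\<lambda>z. sqnorm (fst z))"
  using moments_joint_fst[OF moments_sqnorm] .

lemma moments_joint_dir_sum: "moments (joint r) (\<lambda>z. dir_sum (fst z))"
  using moments_joint_fst[OF moments_dir_sum] .

lemma mean_sq_nonneg: "0 \<le> mean_sq r y"
  by (simp add: mean_sq_def sum_nonneg)

text \<open>\<open>gaussian_ibp\<close> for the product of the weight \<open>mean_sq - q\<close>
  with two posterior means, at the sorted index since only the triangle is observed. The noise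
  variance cancels, so diagonal and off-diagonal entries obey the same formula. The three summands
  come from differentiating the weight, differentiating the two means, and the drift.\<close>

lemma matrix_entry_ibp:
  assumes k: "k < d" and j: "j < d"
  shows "(\<integral>z. goe_matrix (snd z) k j * ((mean_sq r (snd z) - q) * (post_mean r k (snd z) * post_mean r j (snd z))) \<partial>joint r)
    = r * (\<integral>z. (\<Sum>a<d. 2 * (post_mean r a (snd z) * cov r (\<lambda>u. u a) (\<lambda>u. u k * u j) (snd z))) * (post_mean r k (snd z) * post_mean r j (snd z))
        + (mean_sq r (snd z) - q) * (cov r (\<lambda>u. u k) (\<lambda>u. u k * u j) (snd z) * post_mean r j (snd z)
            + cov r (\<lambda>u. u j) (\<lambda>u. u k * u j) (snd z) * post_mean r k (snd z))
        + avg r (\<lambda>u. u k * u j) (snd z) * ((mean_sq r (snd z) - q) * (post_mean r k (snd z) * post_mean r j (snd z))) \<partial>joint r)"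
proof -
  define p where "p = (min k j, max k j)"
  have p: "p \<in> upper d" using k j by (auto simp: p_def upper_def)
  let ?S = "\<lambda>u :: nat \<Rightarrow> real. u k * u j"
  have S: "u (fst p) * u (snd p) = u k * u j" for u :: "nat \<Rightarrow> real"
    by (auto simp: p_def min_def max_def)
  have mS: "moments \<gamma> ?S" by (intro moments_mult moments_coord k j)
  define c where "c = r / (goe_sd d p)\<^sup>2"
  define g where "g = (\<lambda>y. (mean_sq r y - q) * (post_mean r k y * post_mean r j y))"
  define h where "h = (\<lambda>y. (\<Sum>a<d. 2 * (post_mean r a y * cov r (\<lambda>u. u a) ?S y)) * (post_mean r k y * post_mean r j y)
        + (mean_sq r y - q) * (cov r (\<lambda>u. u k) ?S y * post_mean r j y + cov r (\<lambda>u. u j) ?S y * post_mean r k y))"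
  have mg: "moments (joint r) (\<lambda>z. g (snd z))"
    unfolding g_def by (intro moments_mult moments_diff moments_mean_sq moments_post_mean joint.moments_const k j)
  have mh: "moments (joint r) (\<lambda>z. h (snd z))"
    unfolding h_def
    by (intro moments_mult moments_add moments_diff joint.moments_sum moments_mean_sq moments_post_mean joint.moments_const
        moments_cov moments_coord mS k j) auto
  have dpm: "((\<lambda>s. post_mean r i (y(p := s))) has_real_derivative (r / (goe_sd d p)\<^sup>2 * cov r (\<lambda>u. u i) ?S (y(p := s)))) (at s)"
    if "i < d" for i y s
    unfolding post_mean_def cov_def using avg_has_derivative[OF p moments_coord[OF that], of r y s] unfolding S .
  have cavg: "isCont (\<lambda>s. avg r f (y(p := s))) s" if "moments \<gamma> f" for f y s
    by (rule isCont_avg[OF p that])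
  have deriv: "((\<lambda>s. g (y(p := s))) has_real_derivative (r / (goe_sd d p)\<^sup>2 * h (y(p := s)))) (at s)" for y s
  proof -
    have "((\<lambda>s. mean_sq r (y(p := s))) has_real_derivative
        (\<Sum>a<d. real 2 * ((r / (goe_sd d p)\<^sup>2 * cov r (\<lambda>u. u a) ?S (y(p := s))) * post_mean r a (y(p := s)) ^ (2 - Suc 0)))) (at s)"
      unfolding mean_sq_def by (intro DERIV_sum DERIV_power dpm) auto
    then have "((\<lambda>s. mean_sq r (y(p := s))) has_real_derivative
        (r / (goe_sd d p)\<^sup>2 * (\<Sum>a<d. 2 * (post_mean r a (y(p := s)) * cov r (\<lambda>u. u a) ?S (y(p := s)))))) (at s)"
      by (rule DERIV_cong) (simp add: sum_distrib_left mult_ac)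
    from DERIV_mult[OF DERIV_diff[OF this DERIV_const[of q]] DERIV_mult[OF dpm[OF k] dpm[OF j]]]
    show ?thesis unfolding g_def h_def by (rule DERIV_cong) (simp only: c_def[symmetric], simp add: algebra_simps)
  qed
  have cont: "isCont (\<lambda>s. r / (goe_sd d p)\<^sup>2 * h (y(p := s))) s" for y s
    unfolding h_def mean_sq_def post_mean_def cov_def
    by (intro isCont_mult isCont_add isCont_diff isCont_sum isCont_power continuous_const ballI
        cavg moments_coord moments_mult k j) auto
  have "(\<integral>z. snd z p * g (snd z) \<partial>joint r)
      = (goe_sd d p)\<^sup>2 * (\<integral>z. r / (goe_sd d p)\<^sup>2 * h (snd z) \<partial>joint r) + r * (\<integral>z. avg r ?S (snd z) * g (snd z) \<partial>joint r)"
    using gaussian_ibp[OF p deriv cont mg moments_mult[OF joint.moments_const mh]] unfolding S .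
  also have "(goe_sd d p)\<^sup>2 * (\<integral>z. r / (goe_sd d p)\<^sup>2 * h (snd z) \<partial>joint r) = r * (\<integral>z. h (snd z) \<partial>joint r)"
    using sd_pos[of p] by (subst integral_mult_right_zero) simp
  also have "r * (\<integral>z. h (snd z) \<partial>joint r) + r * (\<integral>z. avg r ?S (snd z) * g (snd z) \<partial>joint r)
      = r * (\<integral>z. h (snd z) + avg r ?S (snd z) * g (snd z) \<partial>joint r)"
  proof -
    have "integrable (joint r) (\<lambda>z. avg r ?S (snd z) * g (snd z))"
      by (intro moments_integrable moments_mult moments_avg mg moments_coord k j)
    then show ?thesis using moments_integrable[OF mh] by (simp add: distrib_left)
  qed
  finally show ?thesis by (simp add: g_def h_def p_def goe_matrix_def)
qed

lemma nishimori_moments: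
  assumes "moments (joint r) F"
  shows "(\<integral>z. avg r (\<lambda>u. F (u, snd z)) (snd z) \<partial>joint r) = (\<integral>z. F z \<partial>joint r)"
  by (rule nishimori(2)[OF moments_integrable[OF assms]])

lemma avg_overlap_mult:
  assumes "moments \<gamma> f"
  shows "avg r (\<lambda>u. f u * overlap r (u, y)) y = (\<Sum>j<d. post_mean r j y * avg r (\<lambda>u. f u * u j) y)"
proof -
  have "avg r (\<lambda>u. f u * overlap r (u, y)) y = avg r (\<lambda>u. \<Sum>j<d. post_mean r j y * (f u * u j)) y"
    by (simp add: overlap_def sum_distrib_left mult_ac)
  also have "\<dots> = (\<Sum>j<d. post_mean r j y * avg r (\<lambda>u. f u * u j) y)"
    using assms by (subst avg_sum) (auto simp: avg_mult_left
        intro!: integrable_mult_right moments_integrable moments_mult moments_coord)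
  finally show ?thesis .
qed

lemma avg_overlap: "avg r (\<lambda>u. overlap r (u, y)) y = mean_sq r y"
  using avg_overlap_mult[OF moments_const[of 1], of r y]
  by (simp add: mean_sq_def post_mean_def power2_eq_square)

lemma moments_overlap_u: "moments \<gamma> (\<lambda>u. overlap r (u, y))"
  unfolding overlap_def by (auto intro!: moments_intros moments_coord)

lemma avg_overlap_sq:
  "avg r (\<lambda>u. (overlap r (u, y))\<^sup>2) y = (\<Sum>k<d. \<Sum>j<d. post_mean r k y * post_mean r j y * avg r (\<lambda>u. u k * u j) y)"
proof -
  have "avg r (\<lambda>u. overlap r (u, y) * overlap r (u, y)) y = (\<Sum>j<d. post_mean r j y * avg r (\<lambda>u. u j * overlap r (u, y)) y)"
    by (subst avg_overlap_mult[OF moments_overlap_u]) (simp add: mult.commute)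
  also have "\<dots> = (\<Sum>j<d. post_mean r j y * (\<Sum>k<d. post_mean r k y * avg r (\<lambda>u. u j * u k) y))"
    by (intro sum.cong refl arg_cong2[where f="(*)"] avg_overlap_mult moments_coord) auto
  finally show ?thesis by (simp add: power2_eq_square sum_distrib_left mult.assoc)
qed

text \<open>Both sides are the posterior covariance of the overlap with its own square, since
  contracting a coordinate with the posterior mean yields the overlap.\<close>

lemma avg_overlap_cube:
  "(\<Sum>k<d. \<Sum>j<d. \<Sum>a<d. post_mean r k y * post_mean r j y * (post_mean r a y * cov r (\<lambda>u. u a) (\<lambda>u. u k * u j) y))
    = avg r (\<lambda>u. (overlap r (u, y) - mean_sq r y) * (overlap r (u, y))\<^sup>2) y"
proof -
  have m: "moments \<gamma> (\<lambda>u. (overlap r (u, y))\<^sup>2)" by (intro moments_power moments_overlap_u)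
  have "avg r (\<lambda>u. (overlap r (u, y))\<^sup>2 * overlap r (u, y)) y
      = (\<Sum>a<d. post_mean r a y * avg r (\<lambda>u. (overlap r (u, y))\<^sup>2 * u a) y)"
    by (rule avg_overlap_mult[OF m])
  also have "\<dots> = (\<Sum>a<d. post_mean r a y * (\<Sum>k<d. post_mean r k y * (\<Sum>j<d. post_mean r j y * avg r (\<lambda>u. u a * u k * u j) y)))"
  proof (intro sum.cong refl arg_cong2[where f="(*)"])
    fix a assume a: "a \<in> {..<d}"
    have "avg r (\<lambda>u. (overlap r (u, y))\<^sup>2 * u a) y = avg r (\<lambda>u. (u a * overlap r (u, y)) * overlap r (u, y)) y"
      by (simp add: power2_eq_square mult_ac)
    also have "\<dots> = (\<Sum>k<d. post_mean r k y * avg r (\<lambda>u. (u a * u k) * overlap r (u, y)) y)"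
      using a by (subst avg_overlap_mult) (auto intro!: moments_mult moments_overlap_u moments_coord simp: mult_ac)
    also have "\<dots> = (\<Sum>k<d. post_mean r k y * (\<Sum>j<d. post_mean r j y * avg r (\<lambda>u. u a * u k * u j) y))"
      using a by (intro sum.cong refl arg_cong2[where f="(*)"] avg_overlap_mult moments_mult moments_coord) auto
    finally show "avg r (\<lambda>u. (overlap r (u, y))\<^sup>2 * u a) y = (\<Sum>k<d. post_mean r k y * (\<Sum>j<d. post_mean r j y * avg r (\<lambda>u. u a * u k * u j) y))" .
  qed
  also have "\<dots> = (\<Sum>a<d. \<Sum>k<d. \<Sum>j<d. post_mean r k y * post_mean r j y * (post_mean r a y * avg r (\<lambda>u. u a * (u k * u j)) y))"
    by (simp add: sum_distrib_left mult_ac)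
  also have "\<dots> = (\<Sum>k<d. \<Sum>j<d. \<Sum>a<d. post_mean r k y * post_mean r j y * (post_mean r a y * avg r (\<lambda>u. u a * (u k * u j)) y))"
    by (subst sum.swap, intro sum.cong refl sum.swap)
  finally have cube: "avg r (\<lambda>u. (overlap r (u, y))\<^sup>2 * overlap r (u, y)) y
      = (\<Sum>k<d. \<Sum>j<d. \<Sum>a<d. post_mean r k y * post_mean r j y * (post_mean r a y * avg r (\<lambda>u. u a * (u k * u j)) y))" .
  have i: "integrable \<gamma> (\<lambda>u. (overlap r (u, y))\<^sup>2 * overlap r (u, y))" "integrable \<gamma> (\<lambda>u. mean_sq r y * (overlap r (u, y))\<^sup>2)"
    by (intro moments_integrable moments_mult moments_const m moments_overlap_u)+
  have "avg r (\<lambda>u. (overlap r (u, y) - mean_sq r y) * (overlap r (u, y))\<^sup>2) y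
      = avg r (\<lambda>u. (overlap r (u, y))\<^sup>2 * overlap r (u, y) - mean_sq r y * (overlap r (u, y))\<^sup>2) y"
    by (simp add: algebra_simps)
  also have "\<dots> = avg r (\<lambda>u. (overlap r (u, y))\<^sup>2 * overlap r (u, y)) y - mean_sq r y * avg r (\<lambda>u. (overlap r (u, y))\<^sup>2) y"
    by (simp only: avg_diff[OF i] avg_mult_left)
  also have "mean_sq r y * avg r (\<lambda>u. (overlap r (u, y))\<^sup>2) y
      = (\<Sum>k<d. \<Sum>j<d. \<Sum>a<d. post_mean r k y * post_mean r j y * (post_mean r a y * (post_mean r a y * avg r (\<lambda>u. u k * u j) y)))"
  proof -
    have "(\<Sum>a<d. post_mean r k y * post_mean r j y * (post_mean r a y * (post_mean r a y * C))) = mean_sq r y * (post_mean r k y * post_mean r j y * C)" for k j C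
      unfolding mean_sq_def sum_distrib_right by (intro sum.cong refl) (simp add: power2_eq_square)
    then show ?thesis unfolding avg_overlap_sq sum_distrib_left by simp
  qed
  finally show ?thesis
    unfolding cube by (simp add: cov_def post_mean_def right_diff_distrib sum_subtractf)
qed


lemma avg_sqnorm_coord:
  assumes j: "j < d"
  shows "avg r (\<lambda>u. sqnorm u * u j) y = (\<Sum>k<d. avg r (\<lambda>u. u k * (u k * u j)) y)"
proof -
  have "avg r (\<lambda>u. sqnorm u * u j) y = avg r (\<lambda>u. \<Sum>k<d. u k * (u k * u j)) y"
    by (simp add: sqnorm_def sum_distrib_right power2_eq_square mult.assoc)
  also have "\<dots> = (\<Sum>k<d. avg r (\<lambda>u. u k * (u k * u j)) y)"
    by (rule avg_sum) (auto intro!: moments_integrable moments_mult moments_coord j)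
  finally show ?thesis .
qed

lemma sum_cov_signal:
  "(\<Sum>k<d. \<Sum>j<d. cov r (\<lambda>u. u k) (\<lambda>u. u k * u j) y * post_mean r j y)
    = avg r (\<lambda>u. sqnorm u * overlap r (u, y)) y - avg r (\<lambda>u. (overlap r (u, y))\<^sup>2) y"
proof -
  have "(\<Sum>k<d. \<Sum>j<d. cov r (\<lambda>u. u k) (\<lambda>u. u k * u j) y * post_mean r j y)
      = (\<Sum>k<d. \<Sum>j<d. post_mean r j y * avg r (\<lambda>u. u k * (u k * u j)) y)
        - (\<Sum>k<d. \<Sum>j<d. post_mean r k y * post_mean r j y * avg r (\<lambda>u. u k * u j) y)"
    by (simp add: cov_def post_mean_def algebra_simps sum_subtractf)
  also have "(\<Sum>k<d. \<Sum>j<d. post_mean r j y * avg r (\<lambda>u. u k * (u k * u j)) y)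
      = avg r (\<lambda>u. sqnorm u * overlap r (u, y)) y"
    by (subst sum.swap) (simp add: avg_overlap_mult[OF moments_sqnorm] avg_sqnorm_coord sum_distrib_left)
  finally show ?thesis by (simp only: avg_overlap_sq)
qed

lemma moments_matrix: "k < d \<Longrightarrow> j < d \<Longrightarrow> moments (joint r) (\<lambda>z. goe_matrix (snd z) k j)"
  unfolding goe_matrix_def by (rule moments_joint_component) (auto simp: upper_def)

text \<open>Posterior Stein identity in the signal combined with integration by parts in the observation.\<close>

lemma overlap_identity:
  "(\<integral>z. (mean_sq r (snd z) - q) * (mean_sq r (snd z) - m * dir_sum (fst z)
        - r\<^sup>2 * (sqnorm (fst z) * overlap r z) + r\<^sup>2 * (overlap r z)\<^sup>2) \<partial>joint r)
    = 2 * r\<^sup>2 * (\<integral>z. (overlap r z - mean_sq r (snd z)) * (overlap r z)\<^sup>2 \<partial>joint r)"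
proof -
  define \<phi> where "\<phi> y = mean_sq r y - q" for y
  define Y where "Y y = avg r (\<lambda>u. sqnorm u * overlap r (u, y)) y" for y
  define Q where "Q y = avg r (\<lambda>u. (overlap r (u, y))\<^sup>2) y" for y
  define R where "R y = avg r (\<lambda>u. (overlap r (u, y) - mean_sq r y) * (overlap r (u, y))\<^sup>2) y" for y
  define e where "e y = avg r dir_sum y" for y
  define h where "h k j y = (\<Sum>a<d. 2 * (post_mean r a y * cov r (\<lambda>u. u a) (\<lambda>u. u k * u j) y)) * (post_mean r k y * post_mean r j y)
        + \<phi> y * (cov r (\<lambda>u. u k) (\<lambda>u. u k * u j) y * post_mean r j y + cov r (\<lambda>u. u j) (\<lambda>u. u k * u j) y * post_mean r k y)
        + avg r (\<lambda>u. u k * u j) y * (\<phi> y * (post_mean r k y * post_mean r j y))" for k j y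
  let ?E = "\<lambda>f. \<integral>z. f (snd z) \<partial>joint r"
  have mphi: "moments (joint r) (\<lambda>z. \<phi> (snd z))"
    unfolding \<phi>_def by (intro moments_diff moments_mean_sq joint.moments_const)
  have mF1: "moments (joint r) (\<lambda>z. sqnorm (fst z) * overlap r z)"
    by (intro moments_mult moments_joint_sqnorm moments_overlap)
  have mF2: "moments (joint r) (\<lambda>z. (overlap r z)\<^sup>2)" by (intro joint.moments_power moments_overlap)
  have mR: "moments (joint r) (\<lambda>z. (overlap r z - mean_sq r (snd z)) * (overlap r z)\<^sup>2)"
    by (intro moments_mult moments_diff moments_overlap moments_mean_sq mF2)
  have mF: "moments (joint r) (\<lambda>z. (mean_sq r (snd z) - q) * (mean_sq r (snd z) - m * dir_sum (fst z)
        - r\<^sup>2 * (sqnorm (fst z) * overlap r z) + r\<^sup>2 * (overlap r z)\<^sup>2))"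
    by (intro moments_mult moments_add moments_diff joint.moments_const moments_mean_sq moments_joint_dir_sum
        mF1 mF2 moments_joint_sqnorm moments_overlap)
  have Y_eq: "Y y = (\<Sum>k<d. post_mean r k y * avg r (\<lambda>u. sqnorm u * u k) y)" for y
    unfolding Y_def by (rule avg_overlap_mult[OF moments_sqnorm])
  have e_eq: "e y = (\<Sum>k<d. post_mean r k y) / sqrt (real d)" for y
    unfolding e_def dir_sum_def[abs_def] post_mean_def divide_inverse avg_mult_right
    by (subst avg_sum) (auto intro!: moments_integrable moments_coord)
  have mY: "moments (joint r) (\<lambda>z. Y (snd z))"
    unfolding Y_eq by (intro joint.moments_sum moments_mult moments_post_mean moments_avg moments_sqnorm moments_coord) auto
  have me: "moments (joint r) (\<lambda>z. e (snd z))"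
    unfolding e_eq by (intro joint.moments_divide joint.moments_sum moments_post_mean) auto
  have mQ: "moments (joint r) (\<lambda>z. Q (snd z))"
    unfolding Q_def avg_overlap_sq
    by (intro joint.moments_sum moments_mult moments_post_mean moments_avg moments_coord) auto
  have mRy: "moments (joint r) (\<lambda>z. R (snd z))"
    unfolding R_def avg_overlap_cube[symmetric]
    by (intro joint.moments_sum moments_mult moments_post_mean moments_cov moments_coord) auto
  have mh: "moments (joint r) (\<lambda>z. h k j (snd z))" if "k < d" "j < d" for k j
    unfolding h_def
    by (intro moments_add moments_mult joint.moments_sum joint.moments_const moments_post_mean moments_cov moments_avg moments_coord mphi that) auto
  \<comment> \<open>\<open>posterior_stein\<close> contracted with the posterior mean; the weight is
    a function of the observation and may multiply it freely.\<close>
  have stein: "\<phi> y * (mean_sq r y - m * e y + r\<^sup>2 * Y y)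
      = r * (\<Sum>k<d. \<Sum>j<d. goe_matrix y k j * (\<phi> y * (post_mean r k y * post_mean r j y)))" for y
  proof -
    have "(\<Sum>k<d. post_mean r k y * (post_mean r k y - m / sqrt (real d) + r\<^sup>2 * avg r (\<lambda>u. sqnorm u * u k) y))
        = (\<Sum>k<d. post_mean r k y * (r * (\<Sum>j<d. goe_matrix y k j * post_mean r j y)))"
    proof (intro sum.cong refl arg_cong2[where f="(*)"])
      fix k assume "k \<in> {..<d}"
      then show "post_mean r k y - m / sqrt (real d) + r\<^sup>2 * avg r (\<lambda>u. sqnorm u * u k) y = r * (\<Sum>j<d. goe_matrix y k j * post_mean r j y)"
        using posterior_stein[of k r y] by (simp add: post_mean_def)
    qed
    moreover have "(\<Sum>k<d. post_mean r k y * (post_mean r k y - m / sqrt (real d) + r\<^sup>2 * avg r (\<lambda>u. sqnorm u * u k) y))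
        = mean_sq r y - m * e y + r\<^sup>2 * Y y"
      unfolding Y_eq e_eq mean_sq_def
      by (simp add: distrib_left right_diff_distrib sum.distrib sum_subtractf power2_eq_square sum_distrib_left
          sum_divide_distrib mult_ac)
    ultimately have "\<phi> y * (mean_sq r y - m * e y + r\<^sup>2 * Y y)
        = \<phi> y * (\<Sum>k<d. post_mean r k y * (r * (\<Sum>j<d. goe_matrix y k j * post_mean r j y)))" by simp
    then show ?thesis by (simp add: sum_distrib_left mult_ac)
  qed
  have hsum: "(\<Sum>k<d. \<Sum>j<d. h k j y) = 2 * R y + 2 * (\<phi> y * Y y) - \<phi> y * Q y" for y
  proof -
    have 1: "(\<Sum>k<d. \<Sum>j<d. (\<Sum>a<d. 2 * (post_mean r a y * cov r (\<lambda>u. u a) (\<lambda>u. u k * u j) y)) * (post_mean r k y * post_mean r j y)) = 2 * R y"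
      unfolding R_def avg_overlap_cube[symmetric] sum_distrib_left sum_distrib_right
      by (intro sum.cong refl) simp
    have 2: "(\<Sum>k<d. \<Sum>j<d. cov r (\<lambda>u. u k) (\<lambda>u. u k * u j) y * post_mean r j y) = Y y - Q y"
      unfolding Y_def Q_def by (rule sum_cov_signal)
    have 3: "(\<Sum>k<d. \<Sum>j<d. cov r (\<lambda>u. u j) (\<lambda>u. u k * u j) y * post_mean r k y) = Y y - Q y"
      unfolding 2[symmetric] by (subst sum.swap) (simp add: mult.commute)
    have 4: "(\<Sum>k<d. \<Sum>j<d. avg r (\<lambda>u. u k * u j) y * (\<phi> y * (post_mean r k y * post_mean r j y))) = \<phi> y * Q y"
      unfolding Q_def avg_overlap_sq sum_distrib_left by (intro sum.cong refl) simp
    have "(\<Sum>k<d. \<Sum>j<d. h k j y) = 2 * R y + \<phi> y * ((Y y - Q y) + (Y y - Q y)) + \<phi> y * Q y"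
      unfolding h_def sum.distrib 1 4 2[symmetric]
      by (simp only: sum_distrib_left[symmetric] sum.distrib 2 3)
    then show ?thesis by (simp add: algebra_simps)
  qed
  have "?E (\<lambda>y. \<phi> y * (mean_sq r y - m * e y + r\<^sup>2 * Y y))
      = r * (\<integral>z. (\<Sum>k<d. \<Sum>j<d. goe_matrix (snd z) k j * (\<phi> (snd z) * (post_mean r k (snd z) * post_mean r j (snd z)))) \<partial>joint r)"
    unfolding stein by simp
  also have "(\<integral>z. (\<Sum>k<d. \<Sum>j<d. goe_matrix (snd z) k j * (\<phi> (snd z) * (post_mean r k (snd z) * post_mean r j (snd z)))) \<partial>joint r)
      = (\<Sum>k<d. \<Sum>j<d. \<integral>z. goe_matrix (snd z) k j * (\<phi> (snd z) * (post_mean r k (snd z) * post_mean r j (snd z))) \<partial>joint r)"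
  proof -
    have i: "integrable (joint r) (\<lambda>z. goe_matrix (snd z) k j * (\<phi> (snd z) * (post_mean r k (snd z) * post_mean r j (snd z))))"
      if "k < d" "j < d" for k j
      by (intro moments_integrable moments_mult moments_matrix mphi moments_post_mean that)
    show ?thesis
      by (subst Bochner_Integration.integral_sum, use i in force)
        (intro sum.cong refl Bochner_Integration.integral_sum, use i in force)
  qed
  also have "\<dots> = (\<Sum>k<d. \<Sum>j<d. r * ?E (h k j))"
    unfolding h_def \<phi>_def by (intro sum.cong refl matrix_entry_ibp) auto
  also have "\<dots> = r * ?E (\<lambda>y. \<Sum>k<d. \<Sum>j<d. h k j y)"
  proof -
    have i: "integrable (joint r) (\<lambda>z. h k j (snd z))" if "k < d" "j < d" for k j
      by (rule moments_integrable[OF mh[OF that]])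
    have "?E (\<lambda>y. \<Sum>k<d. \<Sum>j<d. h k j y) = (\<Sum>k<d. \<Sum>j<d. ?E (h k j))"
      by (subst Bochner_Integration.integral_sum, use i in force)
        (intro sum.cong refl Bochner_Integration.integral_sum, use i in force)
    then show ?thesis by (simp add: sum_distrib_left)
  qed
  \<comment> \<open>\<open>Y\<close> occurs once on the left and twice on the right, so a single
    copy survives with the sign it has in the statement.\<close>
  finally have main: "?E (\<lambda>y. \<phi> y * (mean_sq r y - m * e y + r\<^sup>2 * Y y))
      = r\<^sup>2 * ?E (\<lambda>y. 2 * R y + 2 * (\<phi> y * Y y) - \<phi> y * Q y)"
    unfolding hsum by (simp add: power2_eq_square)
  have i: "integrable (joint r) (\<lambda>z. \<phi> (snd z) * mean_sq r (snd z))" "integrable (joint r) (\<lambda>z. \<phi> (snd z) * e (snd z))"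
      "integrable (joint r) (\<lambda>z. \<phi> (snd z) * Y (snd z))" "integrable (joint r) (\<lambda>z. \<phi> (snd z) * Q (snd z))"
      "integrable (joint r) (\<lambda>z. R (snd z))"
    by (intro moments_integrable moments_mult mphi moments_mean_sq me mY mQ mRy)+
  have L: "?E (\<lambda>y. \<phi> y * (mean_sq r y - m * e y + r\<^sup>2 * Y y))
      = ?E (\<lambda>y. \<phi> y * mean_sq r y) - m * ?E (\<lambda>y. \<phi> y * e y) + r\<^sup>2 * ?E (\<lambda>y. \<phi> y * Y y)"
  proof -
    have "?E (\<lambda>y. \<phi> y * (mean_sq r y - m * e y + r\<^sup>2 * Y y))
       = ?E (\<lambda>y. \<phi> y * mean_sq r y - m * (\<phi> y * e y) + r\<^sup>2 * (\<phi> y * Y y))" by (simp add: algebra_simps)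
    then show ?thesis using i by simp
  qed
  have Rr: "?E (\<lambda>y. 2 * R y + 2 * (\<phi> y * Y y) - \<phi> y * Q y)
      = 2 * ?E R + 2 * ?E (\<lambda>y. \<phi> y * Y y) - ?E (\<lambda>y. \<phi> y * Q y)"
    using i by simp
  have "(\<integral>z. (mean_sq r (snd z) - q) * (mean_sq r (snd z) - m * dir_sum (fst z)
        - r\<^sup>2 * (sqnorm (fst z) * overlap r z) + r\<^sup>2 * (overlap r z)\<^sup>2) \<partial>joint r)
      = ?E (\<lambda>y. \<phi> y * mean_sq r y - m * (\<phi> y * e y) - r\<^sup>2 * (\<phi> y * Y y) + r\<^sup>2 * (\<phi> y * Q y))"
  proof (subst nishimori_moments[OF mF, symmetric], intro Bochner_Integration.integral_cong refl)
    fix z :: "(nat \<Rightarrow> real) \<times> (nat \<times> nat \<Rightarrow> real)"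
    let ?y = "snd z"
    have iu: "integrable \<gamma> (\<lambda>u. m * dir_sum u)" "integrable \<gamma> (\<lambda>u. r\<^sup>2 * (sqnorm u * overlap r (u, ?y)))"
        "integrable \<gamma> (\<lambda>u. r\<^sup>2 * (overlap r (u, ?y))\<^sup>2)" "integrable \<gamma> (\<lambda>u. mean_sq r ?y)"
      by (intro moments_integrable moments_intros moments_dir_sum moments_sqnorm moments_overlap_u)+
    have "avg r (\<lambda>u. mean_sq r ?y - m * dir_sum u - r\<^sup>2 * (sqnorm u * overlap r (u, ?y)) + r\<^sup>2 * (overlap r (u, ?y))\<^sup>2) ?y
        = mean_sq r ?y - m * e ?y - r\<^sup>2 * Y ?y + r\<^sup>2 * Q ?y"
      by (simp only: avg_add[OF Bochner_Integration.integrable_diff[OF Bochner_Integration.integrable_diff[OF iu(4,1)] iu(2)] iu(3)]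
          avg_diff[OF Bochner_Integration.integrable_diff[OF iu(4,1)] iu(2)] avg_diff[OF iu(4,1)]
          avg_mult_left avg_const e_def Y_def Q_def)
    then show "avg r (\<lambda>u. (mean_sq r (snd (u, ?y)) - q) * (mean_sq r (snd (u, ?y)) - m * dir_sum (fst (u, ?y))
          - r\<^sup>2 * (sqnorm (fst (u, ?y)) * overlap r (u, ?y)) + r\<^sup>2 * (overlap r (u, ?y))\<^sup>2)) ?y
        = \<phi> ?y * mean_sq r ?y - m * (\<phi> ?y * e ?y) - r\<^sup>2 * (\<phi> ?y * Y ?y) + r\<^sup>2 * (\<phi> ?y * Q ?y)"
      unfolding fst_conv snd_conv avg_mult_left \<phi>_def[symmetric]
      by (simp only:) (simp add: algebra_simps)
  qed
  also have "\<dots> = ?E (\<lambda>y. \<phi> y * mean_sq r y) - m * ?E (\<lambda>y. \<phi> y * e y) - r\<^sup>2 * ?E (\<lambda>y. \<phi> y * Y y) + r\<^sup>2 * ?E (\<lambda>y. \<phi> y * Q y)"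
    using i by simp
  also have "\<dots> = 2 * r\<^sup>2 * ?E R"
    using main unfolding L Rr by (simp add: algebra_simps)
  also have "?E R = (\<integral>z. (overlap r z - mean_sq r (snd z)) * (overlap r z)\<^sup>2 \<partial>joint r)"
    using nishimori_moments[OF mR] by (simp add: R_def)
  finally show ?thesis .
qed


section \<open>Concentration and moments of the prior\<close>

lemma prior_stein:
  fixes g g' :: "(nat \<Rightarrow> real) \<Rightarrow> real"
  assumes i: "i < d"
    and deriv: "\<And>x t. ((\<lambda>t. g (x(i := t))) has_real_derivative g' (x(i := t))) (at t)"
    and cont: "\<And>x t. isCont (\<lambda>t. g' (x(i := t))) t"
    and g: "moments \<gamma> g" and g': "moments \<gamma> g'"
  shows "(\<integral>u. (u i - m / sqrt (real d)) * g u \<partial>\<gamma>) = 1 / real d * (\<integral>u. g' u \<partial>\<gamma>)"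
proof -
  have s: "0 < sqrt (1 / real d)" "(sqrt (1 / real d))\<^sup>2 = 1 / real d" using d_pos by auto
  have x: "moments \<gamma> (\<lambda>u. (u i - m / sqrt (real d)) * g u)"
    by (intro moments_mult moments_diff moments_coord moments_const g i)
  show ?thesis
    using stein_PiM[where I="{..<d}" and i=i and m="\<lambda>_. m / sqrt (real d)" and \<sigma>="\<lambda>_. sqrt (1 / real d)", OF _ _ s(1) deriv cont]
      moments_integrable[OF g] moments_integrable[OF g'] moments_integrable[OF x] i
    unfolding s(2) spike_law_eq by simp
qed

lemma prior_mean: "i < d \<Longrightarrow> (\<integral>u. u i \<partial>\<gamma>) = m / sqrt (real d)"
  using prior_stein[of i "\<lambda>_. 1" "\<lambda>_. 0"] moments_integrable[OF moments_coord[of i]]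
  by (simp add: moments_const prob_space)

lemma sum_const_mean: "(\<Sum>i<d. m / sqrt (real d)) / sqrt (real d) = m"
  using d_pos by (simp add: field_simps)

lemma dir_sum_variance: "(\<integral>u. (dir_sum u - m)\<^sup>2 \<partial>\<gamma>) = 1 / real d"
proof -
  let ?\<mu> = "m / sqrt (real d)"
  have c: "dir_sum u - m = (\<Sum>i<d. (u i - ?\<mu>)) / sqrt (real d)" for u
    using sum_const_mean by (simp add: dir_sum_def sum_subtractf diff_divide_distrib)
  have m: "moments \<gamma> (\<lambda>u. dir_sum u - m)" by (intro moments_diff moments_dir_sum moments_const)
  have st: "(\<integral>u. (u i - ?\<mu>) * (dir_sum u - m) \<partial>\<gamma>) = 1 / real d * (1 / sqrt (real d))" if i: "i < d" for i
  proof -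
    have "(\<integral>u. (u i - ?\<mu>) * (dir_sum u - m) \<partial>\<gamma>) = 1 / real d * (\<integral>u. 1 / sqrt (real d) \<partial>\<gamma>)"
    proof (rule prior_stein[OF i])
      have "((\<lambda>t. (\<Sum>j<d. (x(i := t)) j) / sqrt (real d) - m) has_real_derivative (\<Sum>j<d. if j = i then 1 else 0) / sqrt (real d) - 0) (at t)" for x t
        by (intro DERIV_diff DERIV_cdivide DERIV_sum DERIV_const) auto
      then show "((\<lambda>t. dir_sum (x(i := t)) - m) has_real_derivative 1 / sqrt (real d)) (at t)" for x t
        unfolding dir_sum_def by (rule DERIV_cong) (simp add: i)
    qed (auto intro: m moments_const)
    then show ?thesis by (simp add: prob_space)
  qed
  have ii: "integrable \<gamma> (\<lambda>u. (u i - ?\<mu>) * (dir_sum u - m))" if "i < d" for i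
    by (intro moments_integrable moments_mult m moments_diff moments_coord moments_const that)
  have "(\<integral>u. (dir_sum u - m)\<^sup>2 \<partial>\<gamma>) = (\<integral>u. (\<Sum>i<d. (u i - ?\<mu>) * (dir_sum u - m)) / sqrt (real d) \<partial>\<gamma>)"
    unfolding power2_eq_square by (subst (1) c) (simp add: sum_distrib_right)
  also have "\<dots> = (\<Sum>i<d. 1 / real d * (1 / sqrt (real d))) / sqrt (real d)"
    using ii by (simp add: Bochner_Integration.integral_sum st)
  also have "\<dots> = 1 / real d" using d_pos by (simp add: field_simps)
  finally show ?thesis .
qed

lemma sqnorm_centered: "sqnorm u - (1 + m\<^sup>2) = (\<Sum>i<d. (u i - m / sqrt (real d)) * (u i + m / sqrt (real d))) - 1"
proof -
  have "(\<Sum>i<d. (m / sqrt (real d))\<^sup>2) = m\<^sup>2" using d_pos by (simp add: power_divide)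
  moreover have "(u i - m / sqrt (real d)) * (u i + m / sqrt (real d)) = (u i)\<^sup>2 - (m / sqrt (real d))\<^sup>2" for i
    by (simp add: power2_eq_square algebra_simps)
  ultimately show ?thesis by (simp add: sqnorm_def sum_subtractf)
qed

text \<open>By \<open>sqnorm_centered\<close> each summand contains the centred coordinate times
  \<open>u i + m / sqrt (real d)\<close>. Stein's identity is applied to the latter factor times
  \<open>g\<close>; the part of the derivative that falls on the factor gives back \<open>g\<close>,
  and summed over \<open>i\<close> it cancels the constant \<open>1\<close>.\<close>

lemma sqnorm_stein:
  assumes deriv: "\<And>i x t. i < d \<Longrightarrow> ((\<lambda>t. g (x(i := t))) has_real_derivative g' i (x(i := t))) (at t)"
    and cont: "\<And>i x t. i < d \<Longrightarrow> isCont (\<lambda>t. g' i (x(i := t))) t"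
    and g: "moments \<gamma> g" and g': "\<And>i. i < d \<Longrightarrow> moments \<gamma> (g' i)"
  shows "(\<integral>u. (sqnorm u - (1 + m\<^sup>2)) * g u \<partial>\<gamma>)
    = 1 / real d * (\<Sum>i<d. \<integral>u. (u i + m / sqrt (real d)) * g' i u \<partial>\<gamma>)"
proof -
  let ?\<mu> = "m / sqrt (real d)"
  have st: "(\<integral>u. (u i - ?\<mu>) * ((u i + ?\<mu>) * g u) \<partial>\<gamma>) = 1 / real d * (\<integral>u. g u + (u i + ?\<mu>) * g' i u \<partial>\<gamma>)"
    if i: "i < d" for i
  proof (rule prior_stein[OF i])
    have "((\<lambda>t. ((x(i := t)) i + ?\<mu>) * g (x(i := t))) has_real_derivative
        (1 + 0) * g (x(i := t)) + g' i (x(i := t)) * ((x(i := t)) i + ?\<mu>)) (at t)" for x t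
      by (intro DERIV_mult DERIV_add DERIV_const deriv i) auto
    then show "((\<lambda>t. ((x(i := t)) i + ?\<mu>) * g (x(i := t))) has_real_derivative
        g (x(i := t)) + ((x(i := t)) i + ?\<mu>) * g' i (x(i := t))) (at t)" for x t
      by (rule DERIV_cong) (simp add: mult.commute)
    show "isCont (\<lambda>t. g (x(i := t)) + ((x(i := t)) i + ?\<mu>) * g' i (x(i := t))) t" for x t
      by (intro continuous_intros isCont_update cont i DERIV_isCont[OF deriv[OF i]])
  qed (intro moments_mult moments_add moments_coord moments_const g g' i)+
  have ii: "integrable \<gamma> (\<lambda>u. (u i - ?\<mu>) * ((u i + ?\<mu>) * g u))" "integrable \<gamma> (\<lambda>u. (u i + ?\<mu>) * g' i u)" if "i < d" for i
    by (intro moments_integrable moments_mult g g' moments_diff moments_add moments_coord moments_const that)+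
  have ig: "integrable \<gamma> g" by (rule moments_integrable[OF g])
  have "(\<integral>u. (sqnorm u - (1 + m\<^sup>2)) * g u \<partial>\<gamma>) = (\<integral>u. (\<Sum>i<d. (u i - ?\<mu>) * ((u i + ?\<mu>) * g u)) - g u \<partial>\<gamma>)"
    by (simp add: sqnorm_centered left_diff_distrib[of "sum _ _" 1] sum_distrib_right mult.assoc)
  also have "\<dots> = (\<Sum>i<d. \<integral>u. (u i - ?\<mu>) * ((u i + ?\<mu>) * g u) \<partial>\<gamma>) - (\<integral>u. g u \<partial>\<gamma>)"
  proof -
    have "integrable \<gamma> (\<lambda>u. \<Sum>i<d. (u i - ?\<mu>) * ((u i + ?\<mu>) * g u))"
      by (intro Bochner_Integration.integrable_sum ii) auto
    then have "(\<integral>u. (\<Sum>i<d. (u i - ?\<mu>) * ((u i + ?\<mu>) * g u)) - g u \<partial>\<gamma>)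
      = (\<integral>u. (\<Sum>i<d. (u i - ?\<mu>) * ((u i + ?\<mu>) * g u)) \<partial>\<gamma>) - (\<integral>u. g u \<partial>\<gamma>)"
      using ig by (rule Bochner_Integration.integral_diff)
    also have "(\<integral>u. (\<Sum>i<d. (u i - ?\<mu>) * ((u i + ?\<mu>) * g u)) \<partial>\<gamma>) = (\<Sum>i<d. \<integral>u. (u i - ?\<mu>) * ((u i + ?\<mu>) * g u) \<partial>\<gamma>)"
      by (rule Bochner_Integration.integral_sum) (use ii in auto)
    finally show ?thesis .
  qed
  also have "(\<Sum>i<d. \<integral>u. (u i - ?\<mu>) * ((u i + ?\<mu>) * g u) \<partial>\<gamma>)
      = (\<Sum>i<d. 1 / real d * ((\<integral>u. g u \<partial>\<gamma>) + (\<integral>u. (u i + ?\<mu>) * g' i u \<partial>\<gamma>)))"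
    by (intro sum.cong refl, subst st) (auto simp: Bochner_Integration.integral_add[OF ig ii(2)])
  also have "\<dots> = (\<integral>u. g u \<partial>\<gamma>) + 1 / real d * (\<Sum>i<d. \<integral>u. (u i + ?\<mu>) * g' i u \<partial>\<gamma>)"
    using d_pos by (simp add: distrib_left sum.distrib sum_distrib_left)
  finally show ?thesis by simp
qed

lemma sqnorm_mean: "(\<integral>u. sqnorm u \<partial>\<gamma>) = 1 + m\<^sup>2"
  using sqnorm_stein[of "\<lambda>_. 1" "\<lambda>_ _. 0"] moments_integrable[OF moments_sqnorm]
  by (simp add: moments_const prob_space)

lemma sqnorm_variance: "(\<integral>u. (sqnorm u - (1 + m\<^sup>2))\<^sup>2 \<partial>\<gamma>) = (2 + 4 * m\<^sup>2) / real d"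
proof -
  let ?\<mu> = "m / sqrt (real d)"
  have m: "moments \<gamma> (\<lambda>u. sqnorm u - (1 + m\<^sup>2))" by (intro moments_diff moments_sqnorm moments_const)
  have "(\<integral>u. (sqnorm u - (1 + m\<^sup>2)) * (sqnorm u - (1 + m\<^sup>2)) \<partial>\<gamma>)
      = 1 / real d * (\<Sum>i<d. \<integral>u. (u i + ?\<mu>) * (2 * u i) \<partial>\<gamma>)"
  proof (rule sqnorm_stein)
    fix i x t assume i: "i < d"
    have "((\<lambda>t. (\<Sum>j<d. ((x(i := t)) j)\<^sup>2) - (1 + m\<^sup>2)) has_real_derivative
        (\<Sum>j<d. real 2 * ((if j = i then 1 else 0) * ((x(i := t)) j) ^ (2 - Suc 0))) - 0) (at t)"
      by (intro DERIV_diff DERIV_sum DERIV_power DERIV_const) auto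
    then show "((\<lambda>t. sqnorm (x(i := t)) - (1 + m\<^sup>2)) has_real_derivative 2 * (x(i := t)) i) (at t)"
      unfolding sqnorm_def
      by (rule DERIV_cong) (use i in \<open>simp add: if_distrib[where f="\<lambda>x. x * _"] sum_distrib_left[symmetric] del: fun_upd_apply cong: if_cong\<close>)
    show "isCont (\<lambda>t. 2 * (x(i := t)) i) t" by (intro continuous_intros isCont_update)
    show "moments \<gamma> (\<lambda>u. 2 * u i)" by (intro moments_mult moments_const moments_coord i)
  qed (rule m)
  also have "(\<Sum>i<d. \<integral>u. (u i + ?\<mu>) * (2 * u i) \<partial>\<gamma>) = (\<Sum>i<d. 2 * (\<integral>u. (u i)\<^sup>2 \<partial>\<gamma>) + 2 * ?\<mu>\<^sup>2)"
  proof (intro sum.cong refl)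
    fix i assume "i \<in> {..<d}"
    then have i: "i < d" by simp
    have "(\<integral>u. (u i + ?\<mu>) * (2 * u i) \<partial>\<gamma>) = (\<integral>u. 2 * (u i)\<^sup>2 + 2 * ?\<mu> * u i \<partial>\<gamma>)"
      by (simp add: power2_eq_square algebra_simps)
    also have "\<dots> = 2 * (\<integral>u. (u i)\<^sup>2 \<partial>\<gamma>) + 2 * ?\<mu> * (\<integral>u. u i \<partial>\<gamma>)"
      using moments_integrable[OF moments_coord[OF i]] moments_integrable[OF moments_power[OF moments_coord[OF i], of 2]] by simp
    finally show "(\<integral>u. (u i + ?\<mu>) * (2 * u i) \<partial>\<gamma>) = 2 * (\<integral>u. (u i)\<^sup>2 \<partial>\<gamma>) + 2 * ?\<mu>\<^sup>2"
      by (simp add: prior_mean[OF i] power2_eq_square)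
  qed
  also have "\<dots> = 2 * (\<integral>u. sqnorm u \<partial>\<gamma>) + 2 * m\<^sup>2"
  proof -
    have "(\<integral>u. sqnorm u \<partial>\<gamma>) = (\<Sum>i<d. \<integral>u. (u i)\<^sup>2 \<partial>\<gamma>)"
      unfolding sqnorm_def by (rule Bochner_Integration.integral_sum) (auto intro!: moments_integrable moments_power moments_coord)
    then show ?thesis using d_pos by (simp add: sum.distrib sum_distrib_left power_divide)
  qed
  finally have "(\<integral>u. (sqnorm u - (1 + m\<^sup>2))\<^sup>2 \<partial>\<gamma>) = 1 / real d * (2 * (1 + m\<^sup>2) + 2 * m\<^sup>2)"
    by (simp only: sqnorm_mean power2_eq_square[of "sqnorm _ - _"])
  then show ?thesis by simp
qed

text \<open>\<open>sqnorm u\<close> is the average over \<open>i\<close> of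
  \<open>real d * (u i)\<^sup>2\<close>, so convexity reduces the bound to one coordinate, whose
  rescaling by \<open>sqrt (real d)\<close> has mean \<open>m\<close> and variance 1. This makes the
  bound free of \<open>d\<close>.\<close>

lemma sqnorm_moment_bound:
  assumes M: "\<bar>m\<bar> \<le> M"
  shows "(\<integral>u. (1 + sqnorm u) ^ 12 \<partial>\<gamma>) \<le> moment_bound M"
proof -
  let ?\<mu> = "m / sqrt (real d)" and ?\<sigma> = "sqrt (1 / real d)"
  have s: "0 < ?\<sigma>" using d_pos by simp
  interpret N: prob_space "normal_law 0 1" by (rule prob_space_normal_density) simp
  have mg: "moments (normal_law 0 1) (\<lambda>g. g)" by (rule moments_normal_law) simp
  have coord_int: "(\<integral>u. (1 + real d * (u i)\<^sup>2) ^ 12 \<partial>\<gamma>) \<le> moment_bound M" if i: "i < d" for i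
  proof -
    have "distr \<gamma> (normal_law ?\<mu> ?\<sigma>) (\<lambda>u. u i) = normal_law ?\<mu> ?\<sigma>"
      unfolding spike_law_eq using i s by (intro distr_PiM_component prob_space_normal_density) auto
    then have "(\<integral>u. (1 + real d * (u i)\<^sup>2) ^ 12 \<partial>\<gamma>) = (\<integral>x. (1 + real d * x\<^sup>2) ^ 12 \<partial>normal_law ?\<mu> ?\<sigma>)"
      using integral_distr[of "\<lambda>u. u i" \<gamma> "normal_law ?\<mu> ?\<sigma>" "\<lambda>x. (1 + real d * x\<^sup>2) ^ 12"]
        moments_measurable[OF moments_coord[OF i]] by simp
    also have "\<dots> = (\<integral>g. (1 + real d * (?\<mu> + ?\<sigma> * g)\<^sup>2) ^ 12 \<partial>normal_law 0 1)"
      by (rule integral_normal_affine[OF s]) simp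
    also have "\<dots> \<le> moment_bound M"
      unfolding moment_bound_def
    proof (rule integral_mono)
      show "integrable (normal_law 0 1) (\<lambda>g. (1 + real d * (?\<mu> + ?\<sigma> * g)\<^sup>2) ^ 12)"
        "integrable (normal_law 0 1) (\<lambda>g. (1 + 2 * M\<^sup>2 + 2 * g\<^sup>2) ^ 12)"
        by (intro moments_integrable N.moments_intros mg)+
      fix g :: real
      have "real d * (?\<mu> + ?\<sigma> * g)\<^sup>2 = (m + g)\<^sup>2"
        using d_pos by (simp add: power2_eq_square real_sqrt_divide field_simps)
      also have "\<dots> \<le> 2 * m\<^sup>2 + 2 * g\<^sup>2"
        using sum_squares_bound[of m g] by (simp add: power2_sum)
      also have "m\<^sup>2 \<le> M\<^sup>2" using power_mono[OF M abs_ge_zero, of 2] by simp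
      finally show "(1 + real d * (?\<mu> + ?\<sigma> * g)\<^sup>2) ^ 12 \<le> (1 + 2 * M\<^sup>2 + 2 * g\<^sup>2) ^ 12"
        by (intro power_mono) auto
    qed
    finally show ?thesis .
  qed
  have mi: "integrable \<gamma> (\<lambda>u. (1 + real d * (u i)\<^sup>2) ^ 12)" if "i < d" for i
    by (intro moments_integrable moments_intros moments_coord that)
  have "(\<integral>u. (1 + sqnorm u) ^ 12 \<partial>\<gamma>) \<le> (\<integral>u. (\<Sum>i<d. (1 + real d * (u i)\<^sup>2) ^ 12) / real d \<partial>\<gamma>)"
  proof (rule integral_mono)
    show "integrable \<gamma> (\<lambda>u. (1 + sqnorm u) ^ 12)"
      by (intro moments_integrable moments_intros moments_sqnorm)
    show "integrable \<gamma> (\<lambda>u. (\<Sum>i<d. (1 + real d * (u i)\<^sup>2) ^ 12) / real d)"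
      by (intro moments_integrable moments_intros moments_coord) auto
    fix u :: "nat \<Rightarrow> real"
    have "(\<Sum>i<d. 1 + real d * (u i)\<^sup>2) / real d = 1 + sqnorm u"
      using d_pos by (simp add: sum.distrib sqnorm_def add_divide_distrib flip: sum_distrib_left)
    then show "(1 + sqnorm u) ^ 12 \<le> (\<Sum>i<d. (1 + real d * (u i)\<^sup>2) ^ 12) / real d"
      using power_mean_12[OF d_pos, of "\<lambda>i. 1 + real d * (u i)\<^sup>2"] by simp
  qed
  also have "\<dots> = (\<Sum>i<d. \<integral>u. (1 + real d * (u i)\<^sup>2) ^ 12 \<partial>\<gamma>) / real d"
    using mi by (simp add: Bochner_Integration.integral_sum)
  also have "\<dots> \<le> (\<Sum>i<d. moment_bound M) / real d"
    by (intro divide_right_mono sum_mono coord_int) auto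
  also have "\<dots> = moment_bound M" using d_pos by simp
  finally show ?thesis .
qed


text \<open>All error terms are dominated by powers of \<open>envelope\<close>, whose fourth moment is controlled by the
  twelfth prior moment.\<close>

definition prior_moment :: real where "prior_moment = (\<integral>u. (1 + sqnorm u) ^ 12 \<partial>\<gamma>)"

definition post_cube :: "real \<Rightarrow> (nat \<times> nat \<Rightarrow> real) \<Rightarrow> real" where
  "post_cube r y = avg r (\<lambda>u. (1 + sqnorm u) ^ 3) y"

definition envelope :: "real \<Rightarrow> (nat \<Rightarrow> real) \<times> (nat \<times> nat \<Rightarrow> real) \<Rightarrow> real" where
  "envelope r z = (1 + sqnorm (fst z)) ^ 3 + post_cube r (snd z)"

definition cov_energy :: "real \<Rightarrow> real" where
  "cov_energy r = (\<integral>z. (\<Sum>i<d. \<Sum>j<d. (cov r (\<lambda>u. u i) (\<lambda>u. u j) (snd z))\<^sup>2) \<partial>joint r)"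

definition overlap_var :: "real \<Rightarrow> real" where
  "overlap_var r = (\<integral>z. (overlap r z - mean_sq r (snd z))\<^sup>2 \<partial>joint r)"

definition cross :: "real \<Rightarrow> real" where
  "cross r = (\<integral>z. (\<Sum>i<d. \<Sum>j<d. (avg r (\<lambda>u. u i * u j) (snd z))\<^sup>2) \<partial>joint r)"

lemma moments_cube: "moments \<gamma> (\<lambda>u. (1 + sqnorm u) ^ k)"
  by (intro moments_intros moments_sqnorm)

text \<open>One function thus dominates every power of \<open>sqnorm\<close> up to the third, the
  highest one that squares of third-order covariances produce.\<close>

lemma le_cube: "1 \<le> (1 + sqnorm u) ^ 3" "sqnorm u \<le> (1 + sqnorm u) ^ 3" "(sqnorm u)\<^sup>2 \<le> (1 + sqnorm u) ^ 3"
    "(sqnorm u) ^ 3 \<le> (1 + sqnorm u) ^ 3"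
proof -
  have "(1 + x) ^ 3 = 1 + 3 * x + 3 * x\<^sup>2 + x ^ 3" for x :: real
    by (simp add: power3_eq_cube power2_eq_square algebra_simps)
  moreover have "0 \<le> sqnorm u" "0 \<le> (sqnorm u)\<^sup>2" "0 \<le> sqnorm u ^ 3" using sqnorm_nonneg[of u] by auto
  ultimately show "1 \<le> (1 + sqnorm u) ^ 3" "sqnorm u \<le> (1 + sqnorm u) ^ 3" "(sqnorm u)\<^sup>2 \<le> (1 + sqnorm u) ^ 3"
    "(sqnorm u) ^ 3 \<le> (1 + sqnorm u) ^ 3" by simp_all
qed

lemma avg_le_post_cube:
  assumes "moments \<gamma> f" "\<And>u. f u \<le> (1 + sqnorm u) ^ 3"
  shows "avg r f y \<le> post_cube r y"
  unfolding post_cube_def by (rule avg_mono) (auto intro!: moments_integrable assms moments_cube)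

lemma post_cube_ge_1: "1 \<le> post_cube r y"
  using avg_le_post_cube[OF moments_const[of 1] le_cube(1)] by (simp add: avg_const)

lemma avg_square_le:
  assumes "moments \<gamma> f"
  shows "(avg r f y)\<^sup>2 \<le> avg r (\<lambda>u. (f u)\<^sup>2) y"
  unfolding avg_def using post.expectation_power_even_le[OF moments_post[OF assms], of r y 1] by simp

lemma sum_avg_square_le:
  assumes f: "\<And>i. i \<in> A \<Longrightarrow> moments \<gamma> (f i)"
  shows "(\<Sum>i\<in>A. (avg r (f i) y)\<^sup>2) \<le> avg r (\<lambda>u. \<Sum>i\<in>A. (f i u)\<^sup>2) y"
proof -
  have "(\<Sum>i\<in>A. (avg r (f i) y)\<^sup>2) \<le> (\<Sum>i\<in>A. avg r (\<lambda>u. (f i u)\<^sup>2) y)"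
    by (intro sum_mono avg_square_le f)
  also have "\<dots> = avg r (\<lambda>u. \<Sum>i\<in>A. (f i u)\<^sup>2) y"
    by (rule avg_sum[symmetric]) (intro moments_integrable moments_power f)
  finally show ?thesis .
qed

lemma mean_sq_le: "mean_sq r y \<le> post_cube r y"
proof -
  have "mean_sq r y \<le> avg r sqnorm y"
    using sum_avg_square_le[of "{..<d}" "\<lambda>i u. u i" r y] moments_coord by (simp add: mean_sq_def post_mean_def sqnorm_def[abs_def])
  also have "\<dots> \<le> post_cube r y" by (rule avg_le_post_cube[OF moments_sqnorm le_cube(2)])
  finally show ?thesis .
qed

lemma sqnorm_square: "(sqnorm u)\<^sup>2 = (\<Sum>i<d. \<Sum>j<d. (u i * u j)\<^sup>2)"
  by (simp add: sqnorm_def power2_eq_square[of "sum _ _"] sum_product power_mult_distrib)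

lemma second_moment_le: "(\<Sum>i<d. \<Sum>j<d. (avg r (\<lambda>u. u i * u j) y)\<^sup>2) \<le> post_cube r y"
proof -
  have "(\<Sum>i<d. \<Sum>j<d. (avg r (\<lambda>u. u i * u j) y)\<^sup>2)
      = (\<Sum>p\<in>{..<d} \<times> {..<d}. (avg r (\<lambda>u. u (fst p) * u (snd p)) y)\<^sup>2)"
    by (simp add: sum.cartesian_product case_prod_beta')
  also have "\<dots> \<le> avg r (\<lambda>u. \<Sum>p\<in>{..<d} \<times> {..<d}. (u (fst p) * u (snd p))\<^sup>2) y"
    by (rule sum_avg_square_le) (auto intro!: moments_mult moments_coord)
  also have "(\<lambda>u. \<Sum>p\<in>{..<d} \<times> {..<d}. (u (fst p) * u (snd p))\<^sup>2) = (\<lambda>u. (sqnorm u)\<^sup>2)"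
    by (simp add: sqnorm_square sum.cartesian_product case_prod_beta')
  also have "avg r (\<lambda>u. (sqnorm u)\<^sup>2) y \<le> post_cube r y"
    by (rule avg_le_post_cube[OF moments_power[OF moments_sqnorm] le_cube(3)])
  finally show ?thesis .
qed

lemma post_mean_products: "(\<Sum>i<d. \<Sum>j<d. (post_mean r i y * post_mean r j y)\<^sup>2) = (mean_sq r y)\<^sup>2"
  by (simp add: mean_sq_def power2_eq_square[of "sum _ _"] sum_product power_mult_distrib)

lemma cov_coord: "cov r (\<lambda>u. u i) (\<lambda>u. u j) y = avg r (\<lambda>u. u i * u j) y - post_mean r i y * post_mean r j y"
  by (simp add: cov_def post_mean_def)

lemma cov_square_le: "(\<Sum>i<d. \<Sum>j<d. (cov r (\<lambda>u. u i) (\<lambda>u. u j) y)\<^sup>2) \<le> 4 * (post_cube r y)\<^sup>2"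
proof -
  have "(a - b)\<^sup>2 \<le> 2 * a\<^sup>2 + 2 * b\<^sup>2" for a b :: real
    using sum_squares_bound[of a "-b"] by (simp add: power2_diff)
  then have "(\<Sum>i<d. \<Sum>j<d. (cov r (\<lambda>u. u i) (\<lambda>u. u j) y)\<^sup>2)
      \<le> (\<Sum>i<d. \<Sum>j<d. 2 * (avg r (\<lambda>u. u i * u j) y)\<^sup>2 + 2 * (post_mean r i y * post_mean r j y)\<^sup>2)"
    unfolding cov_coord by (intro sum_mono)
  also have "\<dots> = 2 * (\<Sum>i<d. \<Sum>j<d. (avg r (\<lambda>u. u i * u j) y)\<^sup>2) + 2 * (mean_sq r y)\<^sup>2"
    by (simp add: sum.distrib post_mean_products[symmetric] sum_distrib_left)
  also have "\<dots> \<le> 2 * post_cube r y + 2 * (post_cube r y)\<^sup>2"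
    using second_moment_le[of r y] power_mono[OF mean_sq_le[of r y] mean_sq_nonneg, of 2] by linarith
  also have "\<dots> \<le> 4 * (post_cube r y)\<^sup>2"
    using post_cube_ge_1[of r y] by (simp add: power2_eq_square)
  finally show ?thesis .
qed

lemma moments_post_cube: "moments (joint r) (\<lambda>z. post_cube r (snd z))"
  unfolding post_cube_def by (rule moments_avg[OF moments_cube])

lemma moments_envelope: "moments (joint r) (envelope r)"
  unfolding envelope_def[abs_def] by (intro moments_add moments_post_cube moments_joint_fst[OF moments_cube])

text \<open>The posterior part obeys the same bound as the prior part: Jensen moves the fourth power
  inside the average and \<open>nishimori\<close> removes the average. The constant is the 8 of
  \<open>power4_sum_le\<close> times these two contributions.\<close>

lemma envelope_fourth: "(\<integral>z. (envelope r z) ^ 4 \<partial>joint r) \<le> 16 * prior_moment"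
proof -
  have m1: "moments (joint r) (\<lambda>z. (1 + sqnorm (fst z)) ^ 12)" by (rule moments_joint_fst[OF moments_cube])
  have m2: "moments (joint r) (\<lambda>z. post_cube r (snd z) ^ 4)" by (rule joint.moments_power[OF moments_post_cube])
  have e1: "(\<integral>z. (1 + sqnorm (fst z)) ^ 12 \<partial>joint r) = prior_moment"
    unfolding prior_moment_def by (rule integral_joint_fst) (rule moments_measurable[OF moments_cube])
  have "(\<integral>z. post_cube r (snd z) ^ 4 \<partial>joint r) \<le> (\<integral>z. avg r (\<lambda>u. (1 + sqnorm u) ^ 12) (snd z) \<partial>joint r)"
  proof (rule integral_mono)
    show "integrable (joint r) (\<lambda>z. avg r (\<lambda>u. (1 + sqnorm u) ^ 12) (snd z))"
      by (intro moments_integrable moments_avg moments_cube)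
    show "post_cube r (snd z) ^ 4 \<le> avg r (\<lambda>u. (1 + sqnorm u) ^ 12) (snd z)" for z
      unfolding post_cube_def avg_def
      using post.expectation_power_even_le[OF moments_post[OF moments_cube[of 3]], of r "snd z" 2]
      by (simp flip: power_mult)
  qed (rule moments_integrable[OF m2])
  also have "\<dots> = prior_moment" using nishimori_moments[OF m1] e1 by simp
  finally have e2: "(\<integral>z. post_cube r (snd z) ^ 4 \<partial>joint r) \<le> prior_moment" .
  have "(\<integral>z. (envelope r z) ^ 4 \<partial>joint r)
      \<le> (\<integral>z. 8 * ((1 + sqnorm (fst z)) ^ 12 + post_cube r (snd z) ^ 4) \<partial>joint r)"
  proof (rule integral_mono)
    show "integrable (joint r) (\<lambda>z. (envelope r z) ^ 4)"
      by (intro moments_integrable joint.moments_power moments_envelope)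
    show "integrable (joint r) (\<lambda>z. 8 * ((1 + sqnorm (fst z)) ^ 12 + post_cube r (snd z) ^ 4))"
      using moments_integrable[OF m1] moments_integrable[OF m2] by auto
    show "(envelope r z) ^ 4 \<le> 8 * ((1 + sqnorm (fst z)) ^ 12 + post_cube r (snd z) ^ 4)" for z
      using power4_sum_le[of "(1 + sqnorm (fst z)) ^ 3" "post_cube r (snd z)"]
      by (simp add: envelope_def flip: power_mult)
  qed
  also have "\<dots> \<le> 16 * prior_moment"
    using moments_integrable[OF m1] moments_integrable[OF m2] e1 e2 by simp
  finally show ?thesis .
qed

lemma envelope_ge: "1 \<le> envelope r z" "post_cube r (snd z) \<le> envelope r z" "(1 + sqnorm (fst z)) ^ 3 \<le> envelope r z"
  "mean_sq r (snd z) \<le> envelope r z" "\<bar>overlap r z\<bar> \<le> envelope r z"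
proof -
  note p = post_cube_ge_1[of r "snd z"] le_cube(1,2)[of "fst z"] mean_sq_le[of r "snd z"]
  show e: "1 \<le> envelope r z" "post_cube r (snd z) \<le> envelope r z" "(1 + sqnorm (fst z)) ^ 3 \<le> envelope r z"
    "mean_sq r (snd z) \<le> envelope r z"
    using p unfolding envelope_def by linarith+
  have "(overlap r z)\<^sup>2 \<le> mean_sq r (snd z) * sqnorm (fst z)"
    unfolding overlap_def mean_sq_def sqnorm_def by (rule Cauchy_Schwarz_ineq_sum)
  also have "\<dots> \<le> envelope r z * envelope r z"
    using e p sqnorm_nonneg[of "fst z"] mean_sq_nonneg[of r "snd z"] by (intro mult_mono) linarith+
  finally have "(overlap r z)\<^sup>2 \<le> (envelope r z)\<^sup>2" by (simp add: power2_eq_square)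
  then show "\<bar>overlap r z\<bar> \<le> envelope r z" using e(1) by (simp add: abs_le_square_iff[symmetric])
qed

lemma cov_energy_nonneg: "0 \<le> cov_energy r"
  unfolding cov_energy_def by (intro Bochner_Integration.integral_nonneg sum_nonneg) auto

lemma prior_moment_ge_1: "1 \<le> prior_moment"
proof -
  have "(\<integral>u. 1 \<partial>\<gamma>) \<le> prior_moment"
    unfolding prior_moment_def
    by (rule integral_mono) (auto intro!: moments_integrable moments_cube moments_const one_le_power simp: sqnorm_nonneg)
  then show ?thesis by (simp add: prob_space)
qed

lemma moments_cov_energy: "moments (joint r) (\<lambda>z. \<Sum>i<d. \<Sum>j<d. (cov r (\<lambda>u. u i) (\<lambda>u. u j) (snd z))\<^sup>2)"
  by (intro joint.moments_sum joint.moments_power moments_cov moments_coord) auto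

lemma avg_overlap_variance:
  "avg r (\<lambda>u. (overlap r (u, y) - mean_sq r y)\<^sup>2) y
    = (\<Sum>k<d. \<Sum>j<d. (post_mean r k y * post_mean r j y) * cov r (\<lambda>u. u k) (\<lambda>u. u j) y)"
proof -
  have "avg r (\<lambda>u. (overlap r (u, y) - mean_sq r y)\<^sup>2) y = cov r (\<lambda>u. overlap r (u, y)) (\<lambda>u. overlap r (u, y)) y"
    using avg_centered_product[OF moments_overlap_u[of r y] moments_overlap_u[of r y], of r y]
    by (simp add: avg_overlap power2_eq_square)
  also have "\<dots> = (\<Sum>k<d. \<Sum>j<d. post_mean r k y * post_mean r j y * avg r (\<lambda>u. u k * u j) y) - (mean_sq r y)\<^sup>2"
    using avg_overlap_sq[of r y] by (simp add: cov_def avg_overlap power2_eq_square)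
  also have "\<dots> = (\<Sum>k<d. \<Sum>j<d. (post_mean r k y * post_mean r j y) * cov r (\<lambda>u. u k) (\<lambda>u. u j) y)"
    unfolding post_mean_products[symmetric]
    by (simp add: cov_coord right_diff_distrib sum_subtractf power2_eq_square)
  finally show ?thesis .
qed

text \<open>Given the observation, the variance of the overlap is the quadratic form of the
  posterior covariance at the posterior mean, hence at most \<open>mean_sq\<close> times the
  Frobenius norm. Cauchy-Schwarz over the observation separates the two factors.\<close>

lemma overlap_variance_le: "overlap_var r \<le> sqrt (16 * prior_moment) * sqrt (cov_energy r)"
proof -
  let ?K = "\<lambda>y. \<Sum>i<d. \<Sum>j<d. (cov r (\<lambda>u. u i) (\<lambda>u. u j) y)\<^sup>2"
  have m: "moments (joint r) (\<lambda>z. (overlap r z - mean_sq r (snd z))\<^sup>2)"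
    by (intro joint.moments_power moments_diff moments_overlap moments_mean_sq)
  have le: "avg r (\<lambda>u. (overlap r (u, y) - mean_sq r y)\<^sup>2) y \<le> mean_sq r y * sqrt (?K y)" for y
  proof -
    have "avg r (\<lambda>u. (overlap r (u, y) - mean_sq r y)\<^sup>2) y
        = (\<Sum>k<d. \<Sum>j<d. (post_mean r k y * post_mean r j y) * cov r (\<lambda>u. u k) (\<lambda>u. u j) y)"
      by (rule avg_overlap_variance)
    also have "\<dots> = (\<Sum>p\<in>{..<d} \<times> {..<d}. (post_mean r (fst p) y * post_mean r (snd p) y) * cov r (\<lambda>u. u (fst p)) (\<lambda>u. u (snd p)) y)"
      by (simp add: sum.cartesian_product case_prod_beta')
    also have "\<dots> \<le> sqrt ((mean_sq r y)\<^sup>2 * ?K y)"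
    proof (rule real_le_rsqrt)
      show "(\<Sum>p\<in>{..<d} \<times> {..<d}. (post_mean r (fst p) y * post_mean r (snd p) y) * cov r (\<lambda>u. u (fst p)) (\<lambda>u. u (snd p)) y)\<^sup>2
          \<le> (mean_sq r y)\<^sup>2 * ?K y"
        using Cauchy_Schwarz_ineq_sum[of "\<lambda>p. post_mean r (fst p) y * post_mean r (snd p) y"
            "\<lambda>p. cov r (\<lambda>u. u (fst p)) (\<lambda>u. u (snd p)) y" "{..<d} \<times> {..<d}"]
        by (simp add: post_mean_products[symmetric] sum.cartesian_product case_prod_beta')
    qed
    also have "\<dots> = mean_sq r y * sqrt (?K y)" using mean_sq_nonneg[of r y] by (simp add: real_sqrt_mult)
    finally show ?thesis .
  qed
  have m2: "moments (joint r) (\<lambda>z. sqrt (?K (snd z)))"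
  proof (rule joint.moments_dominated)
    show "(\<lambda>z. sqrt (?K (snd z))) \<in> borel_measurable (joint r)"
      using moments_measurable[OF moments_cov_energy[of r]] by measurable
    show "moments (joint r) (\<lambda>z. 2 * post_cube r (snd z))" by (intro moments_mult joint.moments_const moments_post_cube)
    show "\<bar>sqrt (?K (snd z))\<bar> \<le> 2 * post_cube r (snd z)" for z
    proof -
      have "sqrt (?K (snd z)) \<le> 2 * post_cube r (snd z)"
        using cov_square_le[of r "snd z"] post_cube_ge_1[of r "snd z"]
        by (intro real_le_lsqrt) (auto simp: power_mult_distrib)
      then show ?thesis by (simp add: sum_nonneg)
    qed
  qed
  have "overlap_var r = (\<integral>z. avg r (\<lambda>u. (overlap r (u, snd z) - mean_sq r (snd z))\<^sup>2) (snd z) \<partial>joint r)"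
    unfolding overlap_var_def using nishimori_moments[OF m] by simp
  also have "\<dots> \<le> (\<integral>z. mean_sq r (snd z) * sqrt (?K (snd z)) \<partial>joint r)"
    using nishimori(1)[OF moments_integrable[OF m]] moments_integrable[OF moments_mult[OF moments_mean_sq m2]]
    by (intro integral_mono le) auto
  also have "\<dots> \<le> sqrt (\<integral>z. (mean_sq r (snd z))\<^sup>2 \<partial>joint r) * sqrt (\<integral>z. (sqrt (?K (snd z)))\<^sup>2 \<partial>joint r)"
    using joint.moments_cauchy_schwarz[OF moments_mean_sq m2] by simp
  also have "(\<integral>z. (sqrt (?K (snd z)))\<^sup>2 \<partial>joint r) = cov_energy r"
    by (simp add: cov_energy_def sum_nonneg)
  also have "sqrt (\<integral>z. (mean_sq r (snd z))\<^sup>2 \<partial>joint r) * sqrt (cov_energy r) \<le> sqrt (16 * prior_moment) * sqrt (cov_energy r)"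
  proof (intro mult_right_mono real_sqrt_le_mono)
    have "(\<integral>z. (mean_sq r (snd z))\<^sup>2 \<partial>joint r) \<le> (\<integral>z. envelope r z ^ 4 \<partial>joint r)"
    proof (rule integral_mono)
      show "(mean_sq r (snd z))\<^sup>2 \<le> envelope r z ^ 4" for z
        using power_mono[OF envelope_ge(4)[of r z] mean_sq_nonneg, of 2] power_increasing[OF _ envelope_ge(1)[of r z], of 2 4]
        by linarith
    qed (intro moments_integrable joint.moments_power moments_mean_sq moments_envelope)+
    then show "(\<integral>z. (mean_sq r (snd z))\<^sup>2 \<partial>joint r) \<le> 16 * prior_moment" using envelope_fourth[of r] by linarith
  qed (simp add: cov_energy_nonneg)
  finally show ?thesis .
qed


text \<open>Bounds the second-moment norm of \<open>(envelope r z + q)\<^sup>2\<close>: the 8 comes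
  from \<open>power4_sum_le\<close>, the 16 from \<open>envelope_fourth\<close>.\<close>

definition env_const :: "real \<Rightarrow> real" where
  "env_const q = sqrt (8 * (16 * prior_moment + q ^ 4))"

lemma env_const_nonneg: "0 \<le> env_const q"
  using prior_moment_ge_1 by (simp add: env_const_def)

lemma envelope_shift_fourth: "(\<integral>z. (envelope r z + q) ^ 4 \<partial>joint r) \<le> (env_const q)\<^sup>2"
proof -
  have m: "moments (joint r) (\<lambda>z. (envelope r z) ^ 4)" by (intro joint.moments_power moments_envelope)
  have "(\<integral>z. (envelope r z + q) ^ 4 \<partial>joint r) \<le> (\<integral>z. 8 * ((envelope r z) ^ 4 + q ^ 4) \<partial>joint r)"
  proof (rule integral_mono)
    show "integrable (joint r) (\<lambda>z. (envelope r z + q) ^ 4)"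
      by (intro moments_integrable joint.moments_power moments_add joint.moments_const moments_envelope)
    show "integrable (joint r) (\<lambda>z. 8 * ((envelope r z) ^ 4 + q ^ 4))"
      using moments_integrable[OF m] by simp
  qed (rule power4_sum_le)
  also have "\<dots> = 8 * ((\<integral>z. (envelope r z) ^ 4 \<partial>joint r) + q ^ 4)"
    using moments_integrable[OF m] joint.prob_space[of r] by simp
  also have "\<dots> \<le> 8 * (16 * prior_moment + q ^ 4)" using envelope_fourth[of r] by simp
  also have "\<dots> = (env_const q)\<^sup>2" using prior_moment_ge_1 by (simp add: env_const_def)
  finally show ?thesis .
qed

text \<open>The common form of the error terms: a factor dominated by the squared envelope against a
  factor with small second moment.\<close>

lemma envelope_cauchy_schwarz:
  assumes q: "0 \<le> q" and F: "moments (joint r) F" and G: "moments (joint r) G"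
    and le: "\<And>z. \<bar>F z\<bar> \<le> (envelope r z + q)\<^sup>2" and b: "(\<integral>z. (G z)\<^sup>2 \<partial>joint r) \<le> b"
  shows "\<bar>\<integral>z. F z * G z \<partial>joint r\<bar> \<le> env_const q * sqrt b"
proof -
  have "(\<integral>z. (F z)\<^sup>2 \<partial>joint r) \<le> (\<integral>z. (envelope r z + q) ^ 4 \<partial>joint r)"
  proof (rule integral_mono)
    show "(F z)\<^sup>2 \<le> (envelope r z + q) ^ 4" for z
      using power_mono[OF le[of z] abs_ge_zero, of 2] by (simp flip: power_mult)
  qed (intro moments_integrable joint.moments_power F moments_add joint.moments_const moments_envelope)+
  then have "(\<integral>z. (F z)\<^sup>2 \<partial>joint r) \<le> (env_const q)\<^sup>2" using envelope_shift_fourth[of r q] by linarith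
  then have "sqrt (\<integral>z. (F z)\<^sup>2 \<partial>joint r) \<le> env_const q"
    using env_const_nonneg by (intro real_le_lsqrt) auto
  moreover have "sqrt (\<integral>z. (G z)\<^sup>2 \<partial>joint r) \<le> sqrt b" using b by simp
  ultimately show ?thesis
    using joint.moments_cauchy_schwarz[OF F G] env_const_nonneg[of q]
    by (smt (verit) mult_mono real_sqrt_ge_zero Bochner_Integration.integral_nonneg zero_le_power2)
qed

lemma overlap_var_nonneg: "0 \<le> overlap_var r"
  by (simp add: overlap_var_def)

text \<open>At the root \<open>q\<close> the quadratic \<open>f\<close> factors as \<open>f(X) = (X - q) (m\<^sup>2/q + r\<^sup>2 X)\<close> with positive second
  factor, so \<open>(X - q) f(X)\<close> dominates \<open>m\<^sup>2/q (X - q)\<^sup>2\<close>.\<close>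

lemma mean_sq_concentration:
  assumes q: "q > 0" and root: "r\<^sup>2 * q\<^sup>2 + (1 - r\<^sup>2 * (1 + m\<^sup>2)) * q - m\<^sup>2 = 0"
  shows "m\<^sup>2 / q * (\<integral>z. (mean_sq r (snd z) - q)\<^sup>2 \<partial>joint r)
    \<le> env_const q * ((4 * r\<^sup>2 + r\<^sup>2 * (1 + m\<^sup>2)) * sqrt (overlap_var r) + \<bar>m\<bar> * sqrt (1 / real d)
        + r\<^sup>2 * sqrt ((2 + 4 * m\<^sup>2) / real d))"
proof -
  define s where "s = 1 + m\<^sup>2"
  let ?X = "\<lambda>z. mean_sq r (snd z)" and ?ov = "overlap r" and ?n = "\<lambda>z. sqnorm (fst z)" and ?e = "\<lambda>z. dir_sum (fst z)"
  let ?\<phi> = "\<lambda>z. mean_sq r (snd z) - q"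
  let ?E = "\<lambda>F. \<integral>z. F z \<partial>joint r"
  note ms = moments_mean_sq moments_overlap moments_joint_sqnorm moments_joint_dir_sum joint.moments_const
  have m\<phi>: "moments (joint r) ?\<phi>" by (intro moments_diff ms)
  have m1: "moments (joint r) (\<lambda>z. ?ov z - ?X z)" "moments (joint r) (\<lambda>z. ?e z - m)"
    "moments (joint r) (\<lambda>z. ?n z - s)" "moments (joint r) (\<lambda>z. (?ov z)\<^sup>2)"
    "moments (joint r) (\<lambda>z. ?\<phi> z * ?ov z)" "moments (joint r) (\<lambda>z. ?\<phi> z * (?ov z + ?X z))"
    by (intro moments_diff ms joint.moments_power moments_mult moments_add)+
  have E1: "?E (\<lambda>z. (?ov z - ?X z)\<^sup>2) \<le> overlap_var r" by (simp add: overlap_var_def)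
  have E2: "?E (\<lambda>z. (?e z - m)\<^sup>2) \<le> 1 / real d"
    using integral_joint_fst[of "\<lambda>u. (dir_sum u - m)\<^sup>2" r] moments_measurable[OF moments_dir_sum] dir_sum_variance
    by (simp add: borel_measurable_diff borel_measurable_power)
  have E3: "?E (\<lambda>z. (?n z - s)\<^sup>2) \<le> (2 + 4 * m\<^sup>2) / real d"
    using integral_joint_fst[of "\<lambda>u. (sqnorm u - s)\<^sup>2" r] moments_measurable[OF moments_sqnorm] sqnorm_variance
    by (simp add: s_def borel_measurable_diff borel_measurable_power)
  have b: "\<bar>?\<phi> z\<bar> \<le> envelope r z + q" "\<bar>?ov z\<bar> \<le> envelope r z + q" "\<bar>?ov z + ?X z\<bar> \<le> 2 * (envelope r z + q)"
      "1 \<le> envelope r z + q" for z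
    using envelope_ge(1,4,5)[of r z] mean_sq_nonneg[of r "snd z"] q by (auto simp: abs_le_iff)
  have t1: "\<bar>?E (\<lambda>z. (?ov z)\<^sup>2 * (?ov z - ?X z))\<bar> \<le> env_const q * sqrt (overlap_var r)"
  proof (rule envelope_cauchy_schwarz[OF less_imp_le[OF q] m1(4,1) _ E1])
    show "\<bar>(?ov z)\<^sup>2\<bar> \<le> (envelope r z + q)\<^sup>2" for z
      using power_mono[OF b(2)[of z] abs_ge_zero, of 2] by simp
  qed
  have one: "\<bar>?\<phi> z\<bar> \<le> (envelope r z + q)\<^sup>2" for z
    using b(1)[of z] power_increasing[OF _ b(4)[of z], of 1 2] by simp
  have t2: "\<bar>?E (\<lambda>z. ?\<phi> z * (?e z - m))\<bar> \<le> env_const q * sqrt (1 / real d)"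
    by (rule envelope_cauchy_schwarz[OF less_imp_le[OF q] m\<phi> m1(2) one E2])
  have t3: "\<bar>?E (\<lambda>z. (?\<phi> z * ?ov z) * (?n z - s))\<bar> \<le> env_const q * sqrt ((2 + 4 * m\<^sup>2) / real d)"
  proof (rule envelope_cauchy_schwarz[OF less_imp_le[OF q] m1(5,3) _ E3])
    show "\<bar>?\<phi> z * ?ov z\<bar> \<le> (envelope r z + q)\<^sup>2" for z
      unfolding abs_mult power2_eq_square using b[of z] by (intro mult_mono) auto
  qed
  have t4: "\<bar>?E (\<lambda>z. ?\<phi> z * (?ov z - ?X z))\<bar> \<le> env_const q * sqrt (overlap_var r)"
    by (rule envelope_cauchy_schwarz[OF less_imp_le[OF q] m\<phi> m1(1) one E1])
  have t5: "\<bar>?E (\<lambda>z. (?\<phi> z * (?ov z + ?X z) / 2) * (?ov z - ?X z))\<bar> \<le> env_const q * sqrt (overlap_var r)"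
  proof (rule envelope_cauchy_schwarz[OF less_imp_le[OF q] joint.moments_divide[OF m1(6)] m1(1) _ E1])
    show "\<bar>?\<phi> z * (?ov z + ?X z) / 2\<bar> \<le> (envelope r z + q)\<^sup>2" for z
    proof -
      have "\<bar>?\<phi> z * (?ov z + ?X z)\<bar> \<le> (envelope r z + q) * (2 * (envelope r z + q))"
        unfolding abs_mult using b[of z] by (intro mult_mono) auto
      then show ?thesis by (simp add: power2_eq_square algebra_simps)
    qed
  qed
  have qf: "?\<phi> z * (?X z - m\<^sup>2 - r\<^sup>2 * s * ?X z + r\<^sup>2 * (?X z)\<^sup>2) \<ge> m\<^sup>2 / q * (?\<phi> z)\<^sup>2" for z
  proof -
    have k: "1 - r\<^sup>2 * s = m\<^sup>2 / q - r\<^sup>2 * q" using root q by (simp add: s_def field_simps power2_eq_square)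
    have alg: "(x - q) * (x - M - R * s * x + R * x\<^sup>2) = C * (x - q)\<^sup>2 + R * x * (x - q)\<^sup>2"
      if "1 - R * s = C - R * q" "M = C * q" for x M R C :: real
    proof -
      have "x - M - R * s * x + R * x\<^sup>2 = (1 - R * s) * x - M + R * x\<^sup>2" by (simp add: algebra_simps)
      also have "\<dots> = (x - q) * (C + R * x)" unfolding that by (simp add: algebra_simps power2_eq_square)
      finally have e: "x - M - R * s * x + R * x\<^sup>2 = (x - q) * (C + R * x)" .
      show ?thesis unfolding e by (simp add: power2_eq_square algebra_simps)
    qed
    have "m\<^sup>2 = m\<^sup>2 / q * q" using q by simp
    note alg[OF k this, of "?X z"]
    then show ?thesis using mean_sq_nonneg[of r "snd z"] by simp
  qed
  have i: "integrable (joint r) (\<lambda>z. ?\<phi> z * (?X z - m * ?e z - r\<^sup>2 * (?n z * ?ov z) + r\<^sup>2 * (?ov z)\<^sup>2))"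
      "integrable (joint r) (\<lambda>z. m * (?\<phi> z * (?e z - m)))"
      "integrable (joint r) (\<lambda>z. r\<^sup>2 * ((?\<phi> z * ?ov z) * (?n z - s)))"
      "integrable (joint r) (\<lambda>z. r\<^sup>2 * s * (?\<phi> z * (?ov z - ?X z)))"
      "integrable (joint r) (\<lambda>z. 2 * r\<^sup>2 * ((?\<phi> z * (?ov z + ?X z) / 2) * (?ov z - ?X z)))"
      "integrable (joint r) (\<lambda>z. m\<^sup>2 / q * (?\<phi> z)\<^sup>2)"
      "integrable (joint r) (\<lambda>z. ?\<phi> z * (?X z - m\<^sup>2 - r\<^sup>2 * s * ?X z + r\<^sup>2 * (?X z)\<^sup>2))"
    by (intro moments_integrable moments_mult moments_diff moments_add joint.moments_power joint.moments_divide ms)+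
  have "m\<^sup>2 / q * ?E (\<lambda>z. (?\<phi> z)\<^sup>2) = ?E (\<lambda>z. m\<^sup>2 / q * (?\<phi> z)\<^sup>2)" by simp
  also have "\<dots> \<le> ?E (\<lambda>z. ?\<phi> z * (?X z - m\<^sup>2 - r\<^sup>2 * s * ?X z + r\<^sup>2 * (?X z)\<^sup>2))"
    using i(6,7) qf by (rule integral_mono)
  \<comment> \<open>An exact rewriting: \<open>?e\<close> is traded for \<open>m\<close>,
    \<open>?n\<close> for \<open>s\<close> and \<open>?ov\<close> for \<open>?X\<close>, each at the
    price of a product with a small factor. What remains in front is the integrand of
    \<open>overlap_identity\<close>.\<close>
  also have "\<dots> = ?E (\<lambda>z. ?\<phi> z * (?X z - m * ?e z - r\<^sup>2 * (?n z * ?ov z) + r\<^sup>2 * (?ov z)\<^sup>2)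
      + m * (?\<phi> z * (?e z - m)) + r\<^sup>2 * ((?\<phi> z * ?ov z) * (?n z - s)) + r\<^sup>2 * s * (?\<phi> z * (?ov z - ?X z))
      - 2 * r\<^sup>2 * ((?\<phi> z * (?ov z + ?X z) / 2) * (?ov z - ?X z)))"
    by (intro Bochner_Integration.integral_cong refl) (simp add: field_simps power2_eq_square)
  also have "\<dots> = ?E (\<lambda>z. ?\<phi> z * (?X z - m * ?e z - r\<^sup>2 * (?n z * ?ov z) + r\<^sup>2 * (?ov z)\<^sup>2))
      + ?E (\<lambda>z. m * (?\<phi> z * (?e z - m))) + ?E (\<lambda>z. r\<^sup>2 * ((?\<phi> z * ?ov z) * (?n z - s)))
      + ?E (\<lambda>z. r\<^sup>2 * s * (?\<phi> z * (?ov z - ?X z)))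
      - ?E (\<lambda>z. 2 * r\<^sup>2 * ((?\<phi> z * (?ov z + ?X z) / 2) * (?ov z - ?X z)))"
    by (simp only: Bochner_Integration.integral_add[OF i(1,2)] Bochner_Integration.integral_add[OF Bochner_Integration.integrable_add[OF i(1,2)] i(3)]
        Bochner_Integration.integral_add[OF Bochner_Integration.integrable_add[OF Bochner_Integration.integrable_add[OF i(1,2)] i(3)] i(4)]
        Bochner_Integration.integral_diff[OF Bochner_Integration.integrable_add[OF Bochner_Integration.integrable_add[OF Bochner_Integration.integrable_add[OF i(1,2)] i(3)] i(4)] i(5)])
  also have "\<dots> = 2 * r\<^sup>2 * ?E (\<lambda>z. (?ov z)\<^sup>2 * (?ov z - ?X z)) + m * ?E (\<lambda>z. ?\<phi> z * (?e z - m))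
      + r\<^sup>2 * ?E (\<lambda>z. (?\<phi> z * ?ov z) * (?n z - s)) + r\<^sup>2 * s * ?E (\<lambda>z. ?\<phi> z * (?ov z - ?X z))
      - 2 * r\<^sup>2 * ?E (\<lambda>z. (?\<phi> z * (?ov z + ?X z) / 2) * (?ov z - ?X z))"
    unfolding overlap_identity by (simp only: integral_mult_right_zero mult.commute[of "_ - mean_sq r _" "(overlap r _)\<^sup>2"])
  also have "\<dots> \<le> 2 * r\<^sup>2 * (env_const q * sqrt (overlap_var r)) + \<bar>m\<bar> * (env_const q * sqrt (1 / real d))
      + r\<^sup>2 * (env_const q * sqrt ((2 + 4 * m\<^sup>2) / real d)) + r\<^sup>2 * s * (env_const q * sqrt (overlap_var r))
      + 2 * r\<^sup>2 * (env_const q * sqrt (overlap_var r))"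
  proof -
    have mono: "c * x \<le> \<bar>c\<bar> * y" "- (c * x) \<le> \<bar>c\<bar> * y" if "\<bar>x\<bar> \<le> y" for c x y :: real
    proof -
      have "\<bar>c * x\<bar> \<le> \<bar>c\<bar> * y" unfolding abs_mult using that by (intro mult_left_mono) auto
      then show "c * x \<le> \<bar>c\<bar> * y" "- (c * x) \<le> \<bar>c\<bar> * y" by linarith+
    qed
    have s0: "0 \<le> s" by (simp add: s_def)
    have ab: "\<bar>2 * r\<^sup>2\<bar> = 2 * r\<^sup>2" "\<bar>r\<^sup>2\<bar> = r\<^sup>2" "\<bar>r\<^sup>2 * s\<bar> = r\<^sup>2 * s"
      using s0 by (auto simp: abs_mult)
    show ?thesis
      using mono(1)[OF t1, of "2 * r\<^sup>2", unfolded ab] mono(1)[OF t2, of m] mono(1)[OF t3, of "r\<^sup>2", unfolded ab]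
        mono(1)[OF t4, of "r\<^sup>2 * s", unfolded ab] mono(2)[OF t5, of "2 * r\<^sup>2", unfolded ab]
      by linarith
  qed
  also have "\<dots> = env_const q * ((4 * r\<^sup>2 + r\<^sup>2 * (1 + m\<^sup>2)) * sqrt (overlap_var r) + \<bar>m\<bar> * sqrt (1 / real d)
        + r\<^sup>2 * sqrt ((2 + 4 * m\<^sup>2) / real d))"
    by (simp add: s_def algebra_simps)
  finally show ?thesis .
qed

text \<open>The second moment is the covariance plus the outer square of the posterior mean.
  Expanding its Frobenius norm gives \<open>cov_energy\<close>, twice the quadratic form that
  averages to \<open>overlap_var\<close>, and the square of \<open>mean_sq\<close>.\<close>

lemma cross_close:
  assumes q: "q > 0"
  shows "\<bar>cross r - q\<^sup>2\<bar> \<le> cov_energy r + 2 * overlap_var r + env_const q * sqrt (\<integral>z. (mean_sq r (snd z) - q)\<^sup>2 \<partial>joint r)"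
proof -
  let ?K = "\<lambda>y. \<Sum>i<d. \<Sum>j<d. (cov r (\<lambda>u. u i) (\<lambda>u. u j) y)\<^sup>2"
  let ?V = "\<lambda>y. avg r (\<lambda>u. (overlap r (u, y) - mean_sq r y)\<^sup>2) y"
  have m: "moments (joint r) (\<lambda>z. (overlap r z - mean_sq r (snd z))\<^sup>2)"
    by (intro joint.moments_power moments_diff moments_overlap moments_mean_sq)
  have dec: "(\<Sum>i<d. \<Sum>j<d. (avg r (\<lambda>u. u i * u j) y)\<^sup>2) = ?K y + 2 * ?V y + (mean_sq r y)\<^sup>2" for y
  proof -
    have "(avg r (\<lambda>u. u i * u j) y)\<^sup>2 = (cov r (\<lambda>u. u i) (\<lambda>u. u j) y)\<^sup>2
        + 2 * ((post_mean r i y * post_mean r j y) * cov r (\<lambda>u. u i) (\<lambda>u. u j) y) + (post_mean r i y * post_mean r j y)\<^sup>2" for i j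
      unfolding cov_coord by (simp add: power2_eq_square algebra_simps)
    then show ?thesis unfolding avg_overlap_variance post_mean_products[symmetric] by (simp add: sum.distrib sum_distrib_left)
  qed
  have iV: "integrable (joint r) (\<lambda>z. ?V (snd z))" and EV: "(\<integral>z. ?V (snd z) \<partial>joint r) = overlap_var r"
    using nishimori[OF moments_integrable[OF m]] by (simp_all add: overlap_var_def)
  have iX: "integrable (joint r) (\<lambda>z. (mean_sq r (snd z))\<^sup>2)" by (intro moments_integrable joint.moments_power moments_mean_sq)
  have cross_eq: "cross r = cov_energy r + 2 * overlap_var r + (\<integral>z. (mean_sq r (snd z))\<^sup>2 \<partial>joint r)"
    unfolding cross_def dec cov_energy_def EV[symmetric] using iV iX moments_integrable[OF moments_cov_energy[of r]] by simp
  have mm: "moments (joint r) (\<lambda>z. mean_sq r (snd z) + q)" "moments (joint r) (\<lambda>z. mean_sq r (snd z) - q)"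
    by (intro moments_add moments_diff moments_mean_sq joint.moments_const)+
  have "(\<integral>z. (mean_sq r (snd z))\<^sup>2 \<partial>joint r) - q\<^sup>2 = (\<integral>z. (mean_sq r (snd z))\<^sup>2 - q\<^sup>2 \<partial>joint r)"
    using iX joint.prob_space[of r] by simp
  also have "\<dots> = (\<integral>z. (mean_sq r (snd z) + q) * (mean_sq r (snd z) - q) \<partial>joint r)"
    by (simp add: power2_eq_square algebra_simps)
  finally have "\<bar>(\<integral>z. (mean_sq r (snd z))\<^sup>2 \<partial>joint r) - q\<^sup>2\<bar> \<le> env_const q * sqrt (\<integral>z. (mean_sq r (snd z) - q)\<^sup>2 \<partial>joint r)"
  proof (simp only:, intro envelope_cauchy_schwarz[OF less_imp_le[OF q] mm _ order_refl])
    show "\<bar>mean_sq r (snd z) + q\<bar> \<le> (envelope r z + q)\<^sup>2" for z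
      using envelope_ge(1,4)[of r z] mean_sq_nonneg[of r "snd z"] q power_increasing[of 1 2 "envelope r z + q"]
      by simp
  qed
  then show ?thesis unfolding cross_eq using cov_energy_nonneg[of r] overlap_var_nonneg[of r] by linarith
qed


section \<open>Third-order covariances and increments in the signal-to-noise ratio\<close>

definition third_cov :: "real \<Rightarrow> (nat \<times> nat \<Rightarrow> real) \<Rightarrow> real" where
  "third_cov r y = (\<Sum>i<d. \<Sum>j<d. \<Sum>l<d. (cov r (\<lambda>u. u i) (\<lambda>u. u j * u l) y)\<^sup>2)"

definition third_energy :: "real \<Rightarrow> real" where
  "third_energy r = (\<integral>z. third_cov r (snd z) \<partial>joint r)"

definition mean_energy :: "real \<Rightarrow> real" where
  "mean_energy r = (\<integral>z. mean_sq r (snd z) \<partial>joint r)"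

lemma sensitivity_eq:
  "sensitivity r f y = real d / 2 * (\<Sum>j<d. \<Sum>l<d. (cov r f (\<lambda>u. u j * u l) y)\<^sup>2)"
  unfolding sensitivity_def
  by (rule sum_upper[of "\<lambda>j l. (cov r f (\<lambda>u. u j * u l) y)\<^sup>2"]) (simp add: mult.commute)

lemma spread_eq:
  "spread r z = real d / 2 * (\<Sum>j<d. \<Sum>l<d. (fst z j * fst z l - avg r (\<lambda>u. u j * u l) (snd z))\<^sup>2)"
  unfolding spread_def
  by (rule sum_upper[of "\<lambda>j l. (fst z j * fst z l - avg r (\<lambda>u. u j * u l) (snd z))\<^sup>2"]) (simp add: mult.commute)

lemma spread_le: "spread r z \<le> real d * envelope r z"
proof -
  have "(\<Sum>j<d. \<Sum>l<d. (fst z j * fst z l - avg r (\<lambda>u. u j * u l) (snd z))\<^sup>2)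
      \<le> (\<Sum>j<d. \<Sum>l<d. 2 * (fst z j * fst z l)\<^sup>2 + 2 * (avg r (\<lambda>u. u j * u l) (snd z))\<^sup>2)"
    by (intro sum_mono square_sum_le)
  also have "\<dots> = 2 * (sqnorm (fst z))\<^sup>2 + 2 * (\<Sum>j<d. \<Sum>l<d. (avg r (\<lambda>u. u j * u l) (snd z))\<^sup>2)"
    by (simp add: sqnorm_square sum.distrib sum_distrib_left)
  also have "\<dots> \<le> 2 * envelope r z"
  proof -
    have "2 * A + 2 * B \<le> 2 * (C + P)" if "A \<le> C" "B \<le> P" for A B C P :: real using that by simp
    from this[OF le_cube(3) second_moment_le] show ?thesis unfolding envelope_def .
  qed
  finally have "real d / 2 * (\<Sum>j<d. \<Sum>l<d. (fst z j * fst z l - avg r (\<lambda>u. u j * u l) (snd z))\<^sup>2) \<le> real d / 2 * (2 * envelope r z)"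
    by (intro mult_left_mono) auto
  then show ?thesis by (simp add: spread_eq)
qed

lemma third_cov_nonneg: "0 \<le> third_cov r y"
  unfolding third_cov_def by (intro sum_nonneg) auto

text \<open>Jensen replaces the squares of posterior averages by averages of squares. These sum to
  the average of \<open>sqnorm ^ 3\<close> and to the averages of \<open>sqnorm\<close> and of its
  square multiplied together.\<close>

lemma third_cov_le: "third_cov r y \<le> 4 * (post_cube r y)\<^sup>2"
proof -
  have c: "(cov r f g y)\<^sup>2 \<le> 2 * avg r (\<lambda>u. (f u)\<^sup>2 * (g u)\<^sup>2) y + 2 * (avg r (\<lambda>u. (f u)\<^sup>2) y * avg r (\<lambda>u. (g u)\<^sup>2) y)"
    if "moments \<gamma> f" "moments \<gamma> g" for f g
  proof -
    have 1: "(avg r (\<lambda>u. f u * g u) y)\<^sup>2 \<le> avg r (\<lambda>u. (f u)\<^sup>2 * (g u)\<^sup>2) y"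
      using avg_square_le[OF moments_mult[OF that]] by (simp add: power_mult_distrib)
    have 2: "(avg r f y * avg r g y)\<^sup>2 \<le> avg r (\<lambda>u. (f u)\<^sup>2) y * avg r (\<lambda>u. (g u)\<^sup>2) y"
      unfolding power_mult_distrib by (intro mult_mono avg_square_le that avg_nonneg) auto
    show ?thesis
      unfolding cov_def using 1 2 square_sum_le(2)[of "avg r (\<lambda>u. f u * g u) y" "avg r f y * avg r g y"] by linarith
  qed
  have "third_cov r y \<le> (\<Sum>i<d. \<Sum>j<d. \<Sum>l<d. 2 * avg r (\<lambda>u. (u i)\<^sup>2 * (u j * u l)\<^sup>2) y
      + 2 * (avg r (\<lambda>u. (u i)\<^sup>2) y * avg r (\<lambda>u. (u j * u l)\<^sup>2) y))"
    unfolding third_cov_def by (intro sum_mono c moments_mult moments_coord) auto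
  also have "\<dots> = 2 * (\<Sum>i<d. \<Sum>j<d. \<Sum>l<d. avg r (\<lambda>u. (u i)\<^sup>2 * (u j * u l)\<^sup>2) y)
      + 2 * ((\<Sum>i<d. avg r (\<lambda>u. (u i)\<^sup>2) y) * (\<Sum>j<d. \<Sum>l<d. avg r (\<lambda>u. (u j * u l)\<^sup>2) y))"
    by (simp add: sum.distrib flip: sum_distrib_left sum_distrib_right)
  also have "(\<Sum>i<d. avg r (\<lambda>u. (u i)\<^sup>2) y) = avg r sqnorm y"
    unfolding sqnorm_def[abs_def] by (rule avg_sum[symmetric]) (auto intro!: moments_integrable moments_power moments_coord)
  also have "(\<Sum>j<d. \<Sum>l<d. avg r (\<lambda>u. (u j * u l)\<^sup>2) y) = avg r (\<lambda>u. (sqnorm u)\<^sup>2) y"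
    unfolding sqnorm_square
    by (subst avg_sum, (auto intro!: moments_integrable moments_sum moments_power moments_mult moments_coord)[1])
      (intro sum.cong refl avg_sum[symmetric], auto intro!: moments_integrable moments_power moments_mult moments_coord)
  also have "(\<Sum>i<d. \<Sum>j<d. \<Sum>l<d. avg r (\<lambda>u. (u i)\<^sup>2 * (u j * u l)\<^sup>2) y) = avg r (\<lambda>u. sqnorm u ^ 3) y"
  proof -
    have "sqnorm u ^ 3 = (\<Sum>i<d. \<Sum>j<d. \<Sum>l<d. (u i)\<^sup>2 * (u j * u l)\<^sup>2)" for u
    proof -
      have "sqnorm u ^ 3 = sqnorm u * (sqnorm u)\<^sup>2" by (simp add: power3_eq_cube power2_eq_square)
      also have "\<dots> = (\<Sum>i<d. (u i)\<^sup>2) * (\<Sum>j<d. \<Sum>l<d. (u j * u l)\<^sup>2)"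
        by (simp add: sqnorm_square) (simp add: sqnorm_def)
      finally show ?thesis by (simp flip: sum_distrib_left sum_distrib_right)
    qed
    then show ?thesis
      by (simp only:) (subst avg_sum, (auto intro!: moments_integrable moments_sum moments_power moments_mult moments_coord)[1],
        intro sum.cong refl, subst avg_sum, (auto intro!: moments_integrable moments_sum moments_power moments_mult moments_coord)[1],
        intro sum.cong refl avg_sum[symmetric], auto intro!: moments_integrable moments_power moments_mult moments_coord)
  qed
  also have "2 * avg r (\<lambda>u. sqnorm u ^ 3) y + 2 * (avg r sqnorm y * avg r (\<lambda>u. (sqnorm u)\<^sup>2) y)
      \<le> 2 * post_cube r y + 2 * (post_cube r y * post_cube r y)"
  proof (intro add_mono mult_left_mono mult_mono)
    show "avg r (\<lambda>u. sqnorm u ^ 3) y \<le> post_cube r y" "avg r (\<lambda>u. (sqnorm u)\<^sup>2) y \<le> post_cube r y" "avg r sqnorm y \<le> post_cube r y"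
      by (intro avg_le_post_cube moments_power moments_sqnorm le_cube)+
    show "0 \<le> post_cube r y" using post_cube_ge_1[of r y] by linarith
    show "0 \<le> avg r (\<lambda>u. (sqnorm u)\<^sup>2) y" by (rule avg_nonneg) simp
  qed auto
  also have "\<dots> \<le> 4 * (post_cube r y)\<^sup>2"
    using post_cube_ge_1[of r y] by (simp add: power2_eq_square)
  finally show ?thesis .
qed

lemma moments_third_cov: "moments (joint r) (\<lambda>z. third_cov r (snd z))"
  unfolding third_cov_def by (intro joint.moments_sum joint.moments_power moments_cov moments_mult moments_coord) auto

lemma third_energy_nonneg: "0 \<le> third_energy r"
  unfolding third_energy_def by (intro Bochner_Integration.integral_nonneg third_cov_nonneg)

lemma envelope_power_integral:
  assumes F: "moments (joint r) F" and le: "\<And>z. F z \<le> c * envelope r z ^ 4" and c: "0 \<le> c"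
  shows "(\<integral>z. F z \<partial>joint r) \<le> c * (16 * prior_moment)"
proof -
  have "(\<integral>z. F z \<partial>joint r) \<le> (\<integral>z. c * envelope r z ^ 4 \<partial>joint r)"
    by (intro integral_mono le moments_integrable F moments_mult joint.moments_const joint.moments_power moments_envelope)
  also have "\<dots> = c * (\<integral>z. envelope r z ^ 4 \<partial>joint r)" by simp
  also have "\<dots> \<le> c * (16 * prior_moment)" by (intro mult_left_mono envelope_fourth c)
  finally show ?thesis .
qed

lemma envelope_powers: "envelope r z \<le> envelope r z ^ 4" "(envelope r z)\<^sup>2 \<le> envelope r z ^ 4" "envelope r z ^ 3 \<le> envelope r z ^ 4"
  using power_increasing[OF _ envelope_ge(1)[of r z], of 1 4] power_increasing[OF _ envelope_ge(1)[of r z], of 2 4]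
    power_increasing[OF _ envelope_ge(1)[of r z], of 3 4] by simp_all

lemma post_cube_sq_le: "(post_cube r (snd z))\<^sup>2 \<le> (envelope r z)\<^sup>2"
  using power_mono[OF envelope_ge(2)[of r z], of 2] post_cube_ge_1[of r "snd z"] by simp

lemma third_energy_le: "third_energy r \<le> 64 * prior_moment"
proof -
  have "third_energy r \<le> 4 * (16 * prior_moment)"
    unfolding third_energy_def
  proof (rule envelope_power_integral[OF moments_third_cov])
    show "third_cov r (snd z) \<le> 4 * envelope r z ^ 4" for z
      using third_cov_le[of r "snd z"] post_cube_sq_le[of r z] envelope_powers(2)[of r z] by linarith
  qed simp
  then show ?thesis by simp
qed

lemma mean_energy_bounds: "0 \<le> mean_energy r" "mean_energy r \<le> 16 * prior_moment"
proof -
  show "0 \<le> mean_energy r" unfolding mean_energy_def by (intro Bochner_Integration.integral_nonneg mean_sq_nonneg)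
  have "mean_energy r \<le> 1 * (16 * prior_moment)"
    unfolding mean_energy_def
  proof (rule envelope_power_integral[OF moments_mean_sq])
    show "mean_sq r (snd z) \<le> 1 * envelope r z ^ 4" for z
      using envelope_ge(4)[of r z] envelope_powers(1)[of r z] by linarith
  qed simp
  then show "mean_energy r \<le> 16 * prior_moment" by simp
qed

text \<open>\<open>increment_single\<close> for the coordinates \<open>u i\<close>, combined by
  Cauchy-Schwarz over \<open>i\<close>. The sensitivities add up to \<open>d / 2\<close> times
  \<open>third_cov\<close>, and \<open>spread\<close> contributes another factor \<open>d\<close>,
  hence the \<open>d\<^sup>2\<close> next to \<open>prior_moment\<close>.\<close>

lemma mean_energy_increment:
  assumes s: "s > 0" and cs: "c\<^sup>2 + s\<^sup>2 = 1"
  shows "mean_energy (r * c) \<le> mean_energy r"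
    and "(r * s)\<^sup>2 * (real d / 2 * third_energy (r * c))\<^sup>2
      \<le> (mean_energy r - mean_energy (r * c)) * (real d / 2 * third_energy (r * c) + (r * s)\<^sup>2 * (32 * (real d)\<^sup>2 * prior_moment))"
proof -
  define \<Delta> where "\<Delta> i = (\<integral>z. (avg r (\<lambda>u. u i) (snd z))\<^sup>2 \<partial>joint r) - (\<integral>z. (avg (r * c) (\<lambda>u. u i) (snd z))\<^sup>2 \<partial>joint (r * c))" for i
  define A where "A i z = sensitivity (r * c) (\<lambda>u. u i) (snd z)" for i and z :: "(nat \<Rightarrow> real) \<times> (nat \<times> nat \<Rightarrow> real)"
  define a where "a i = (\<integral>z. A i z \<partial>joint (r * c))" for i
  define g where "g i = (\<integral>z. A i z * spread (r * c) z \<partial>joint (r * c))" for i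
  note inc = increment_single[OF s cs moments_coord, of _ r, folded \<Delta>_def A_def, folded a_def g_def]
  have mA: "moments (joint (r * c)) (A i)" "moments (joint (r * c)) (\<lambda>z. A i z * spread (r * c) z)" if "i < d" for i
    using moments_sensitivity[OF moments_coord[OF that]] unfolding A_def by (auto intro: moments_mult moments_spread)
  have E: "mean_energy r = (\<Sum>i<d. \<integral>z. (avg r (\<lambda>u. u i) (snd z))\<^sup>2 \<partial>joint r)" for r
    unfolding mean_energy_def mean_sq_def post_mean_def
    by (rule Bochner_Integration.integral_sum) (auto intro!: moments_integrable joint.moments_power moments_avg moments_coord)
  have \<Delta>_sum: "(\<Sum>i<d. \<Delta> i) = mean_energy r - mean_energy (r * c)" unfolding \<Delta>_def E by (simp add: sum_subtractf)
  have \<Delta>_nonneg: "0 \<le> \<Delta> i" if "i < d" for i using inc(1)[OF that] .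
  have "0 \<le> (\<Sum>i<d. \<Delta> i)" by (intro sum_nonneg \<Delta>_nonneg) auto
  then show "mean_energy (r * c) \<le> mean_energy r" unfolding \<Delta>_sum by simp
  have sumA: "(\<Sum>i<d. A i z) = real d / 2 * third_cov (r * c) (snd z)" for z
    by (simp add: A_def sensitivity_eq third_cov_def sum_distrib_left)
  have a_sum: "(\<Sum>i<d. a i) = real d / 2 * third_energy (r * c)"
  proof -
    have "(\<Sum>i<d. a i) = (\<integral>z. (\<Sum>i<d. A i z) \<partial>joint (r * c))"
      unfolding a_def by (rule Bochner_Integration.integral_sum[symmetric]) (auto intro!: moments_integrable mA)
    then show ?thesis by (simp add: sumA third_energy_def)
  qed
  have g_sum: "(\<Sum>i<d. g i) \<le> 32 * (real d)\<^sup>2 * prior_moment"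
  proof -
    have "(\<Sum>i<d. g i) = (\<integral>z. (\<Sum>i<d. A i z * spread (r * c) z) \<partial>joint (r * c))"
      unfolding g_def by (rule Bochner_Integration.integral_sum[symmetric]) (auto intro!: moments_integrable mA)
    also have "\<dots> \<le> 2 * (real d)\<^sup>2 * (16 * prior_moment)"
    proof (rule envelope_power_integral)
      show "moments (joint (r * c)) (\<lambda>z. \<Sum>i<d. A i z * spread (r * c) z)"
        by (rule joint.moments_sum) (auto intro: mA)
      fix z
      let ?e = "envelope (r * c) z"
      have "(\<Sum>i<d. A i z * spread (r * c) z) = (real d / 2 * third_cov (r * c) (snd z)) * spread (r * c) z"
        by (simp add: sumA flip: sum_distrib_right)
      also have "\<dots> \<le> (real d / 2 * (4 * ?e\<^sup>2)) * (real d * ?e)"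
      proof (intro mult_mono mult_left_mono spread_le)
        show "third_cov (r * c) (snd z) \<le> 4 * ?e\<^sup>2"
          using third_cov_le[of "r * c" "snd z"] post_cube_sq_le[of "r * c" z] by linarith
        show "0 \<le> spread (r * c) z" unfolding spread_def by (intro sum_nonneg) auto
      qed (auto simp: third_cov_nonneg)
      also have "\<dots> = 2 * (real d)\<^sup>2 * ?e ^ 3" by (simp add: power2_eq_square power3_eq_cube)
      also have "\<dots> \<le> 2 * (real d)\<^sup>2 * ?e ^ 4" by (intro mult_left_mono envelope_powers) auto
      finally show "(\<Sum>i<d. A i z * spread (r * c) z) \<le> 2 * (real d)\<^sup>2 * ?e ^ 4" .
    qed simp
    finally show ?thesis by simp
  qed
  let ?b = "\<lambda>i. a i + (r * s)\<^sup>2 * g i"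
  have A0: "0 \<le> A i z" for i z unfolding A_def sensitivity_def by (intro sum_nonneg) auto
  have b0: "0 \<le> ?b i" for i
  proof -
    have "0 \<le> a i" "0 \<le> g i" unfolding a_def g_def
      by (intro Bochner_Integration.integral_nonneg mult_nonneg_nonneg A0; auto simp: spread_def intro!: sum_nonneg)+
    then show ?thesis by simp
  qed
  have "\<bar>r * s\<bar> * (\<Sum>i<d. a i) \<le> (\<Sum>i<d. sqrt (\<Delta> i) * sqrt (?b i))"
    unfolding sum_distrib_left by (intro sum_mono inc(2)) auto
  moreover have "0 \<le> \<bar>r * s\<bar> * (\<Sum>i<d. a i)"
    unfolding a_def by (intro mult_nonneg_nonneg sum_nonneg Bochner_Integration.integral_nonneg A0) auto
  ultimately have "(\<bar>r * s\<bar> * (\<Sum>i<d. a i))\<^sup>2 \<le> (\<Sum>i<d. sqrt (\<Delta> i) * sqrt (?b i))\<^sup>2"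
    by (rule power_mono)
  also have "\<dots> \<le> (\<Sum>i<d. (sqrt (\<Delta> i))\<^sup>2) * (\<Sum>i<d. (sqrt (?b i))\<^sup>2)"
    by (rule Cauchy_Schwarz_ineq_sum)
  also have "\<dots> = (\<Sum>i<d. \<Delta> i) * (\<Sum>i<d. ?b i)"
    using \<Delta>_nonneg b0 by (intro arg_cong2[where f="(*)"] sum.cong refl) auto
  also have "\<dots> \<le> (\<Sum>i<d. \<Delta> i) * (real d / 2 * third_energy (r * c) + (r * s)\<^sup>2 * (32 * (real d)\<^sup>2 * prior_moment))"
    using g_sum \<open>0 \<le> (\<Sum>i<d. \<Delta> i)\<close>
    by (intro mult_left_mono) (auto simp: sum.distrib a_sum sum_distrib_left[symmetric] mult_left_mono)
  finally show "(r * s)\<^sup>2 * (real d / 2 * third_energy (r * c))\<^sup>2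
      \<le> (mean_energy r - mean_energy (r * c)) * (real d / 2 * third_energy (r * c) + (r * s)\<^sup>2 * (32 * (real d)\<^sup>2 * prior_moment))"
    unfolding a_sum \<Delta>_sum power_mult_distrib[of "\<bar>r * s\<bar>"] power2_abs .
qed

text \<open>Conditioning on more data does not decrease the second moment of a posterior average;
  this is used for every entry \<open>u i * u j\<close>.\<close>

lemma cross_mono_step:
  assumes s: "s > 0" and cs: "c\<^sup>2 + s\<^sup>2 = 1"
  shows "cross (r * c) \<le> cross r"
proof -
  have E: "cross r = (\<Sum>i<d. \<Sum>j<d. \<integral>z. (avg r (\<lambda>u. u i * u j) (snd z))\<^sup>2 \<partial>joint r)" for r
  proof -
    have i: "integrable (joint r) (\<lambda>z. (avg r (\<lambda>u. u i * u j) (snd z))\<^sup>2)" if "i < d" "j < d" for i j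
      by (intro moments_integrable joint.moments_power moments_avg moments_mult moments_coord that)
    show ?thesis unfolding cross_def
      by (subst Bochner_Integration.integral_sum, use i in force)
        (intro sum.cong refl Bochner_Integration.integral_sum, use i in force)
  qed
  show ?thesis unfolding E
  proof (intro sum_mono)
    fix i j assume "i \<in> {..<d}" "j \<in> {..<d}"
    then have "moments \<gamma> (\<lambda>u. u i * u j)" by (intro moments_mult moments_coord) auto
    from increment_single(1)[OF s cs this, of r]
    show "(\<integral>z. (avg (r * c) (\<lambda>u. u i * u j) (snd z))\<^sup>2 \<partial>joint (r * c))
      \<le> (\<integral>z. (avg r (\<lambda>u. u i * u j) (snd z))\<^sup>2 \<partial>joint r)" by simp
  qed
qed

text \<open>The coefficients \<open>c\<close> and \<open>s\<close> that split an observation at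
  ratio \<open>\<rho> + \<delta>\<close> into independent ones at \<open>\<rho>\<close> and
  \<open>\<delta>\<close>.\<close>

lemma split_parameters:
  assumes "\<rho> > 0" "\<delta> > 0"
  shows "sqrt (\<rho> + \<delta>) * sqrt (\<rho> / (\<rho> + \<delta>)) = sqrt \<rho>" "sqrt (\<rho> + \<delta>) * sqrt (\<delta> / (\<rho> + \<delta>)) = sqrt \<delta>"
    "(sqrt (\<rho> / (\<rho> + \<delta>)))\<^sup>2 + (sqrt (\<delta> / (\<rho> + \<delta>)))\<^sup>2 = 1" "sqrt (\<delta> / (\<rho> + \<delta>)) > 0"
  using assms by (auto simp: real_sqrt_divide power_divide add_divide_distrib[symmetric])

lemma cross_mono:
  assumes "\<rho> > 0" "\<rho> \<le> \<rho>'"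
  shows "cross (sqrt \<rho>) \<le> cross (sqrt \<rho>')"
proof (cases "\<rho> = \<rho>'")
  case False
  then have d: "\<rho>' - \<rho> > 0" using assms by simp
  show ?thesis
    using cross_mono_step[OF split_parameters(4,3)[OF assms(1) d], of "sqrt (\<rho> + (\<rho>' - \<rho>))"] split_parameters(1)[OF assms(1) d]
    by simp
qed simp

text \<open>With the step \<open>\<epsilon> / d\<close> both terms in the bound of
  \<open>mean_energy_increment\<close> are of order \<open>d\<close>, while the left-hand side there
  carries \<open>\<epsilon> / d\<close> times \<open>d\<^sup>2\<close>. The powers of
  \<open>d\<close> cancel and the increment alone controls \<open>third_energy\<close>.\<close>

lemma third_energy_step:
  assumes \<rho>: "\<rho> > 0" and \<epsilon>: "\<epsilon> > 0"
  defines "\<Delta> \<equiv> mean_energy (sqrt (\<rho> + \<epsilon> / real d)) - mean_energy (sqrt \<rho>)"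
  shows "0 \<le> \<Delta>" and "\<epsilon> * (third_energy (sqrt \<rho>))\<^sup>2 \<le> \<Delta> * (128 * prior_moment * (1 + \<epsilon>))"
proof -
  have \<delta>: "\<epsilon> / real d > 0" using \<epsilon> d_pos by simp
  note sp = split_parameters[OF \<rho> \<delta>]
  show "0 \<le> \<Delta>" using mean_energy_increment(1)[OF sp(4,3), of "sqrt (\<rho> + \<epsilon> / real d)"] by (simp add: \<Delta>_def sp(1))
  have "(sqrt (\<epsilon> / real d))\<^sup>2 * (real d / 2 * third_energy (sqrt \<rho>))\<^sup>2
      \<le> \<Delta> * (real d / 2 * third_energy (sqrt \<rho>) + (sqrt (\<epsilon> / real d))\<^sup>2 * (32 * (real d)\<^sup>2 * prior_moment))"
    using mean_energy_increment(2)[OF sp(4,3), of "sqrt (\<rho> + \<epsilon> / real d)"] by (simp only: \<Delta>_def sp(1,2))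
  also have "(sqrt (\<epsilon> / real d))\<^sup>2 = \<epsilon> / real d" using \<delta> by simp
  also have "\<Delta> * (real d / 2 * third_energy (sqrt \<rho>) + \<epsilon> / real d * (32 * (real d)\<^sup>2 * prior_moment)) \<le> \<Delta> * (real d * (32 * prior_moment * (1 + \<epsilon>)))"
  proof (intro mult_left_mono \<open>0 \<le> \<Delta>\<close>)
    have "real d / 2 * third_energy (sqrt \<rho>) \<le> real d / 2 * (64 * prior_moment)" by (intro mult_left_mono third_energy_le) auto
    then show "real d / 2 * third_energy (sqrt \<rho>) + \<epsilon> / real d * (32 * (real d)\<^sup>2 * prior_moment) \<le> real d * (32 * prior_moment * (1 + \<epsilon>))"
      using d_pos by (simp add: power2_eq_square algebra_simps)
  qed
  finally have "\<epsilon> * (real d * (third_energy (sqrt \<rho>))\<^sup>2) / 4 \<le> \<Delta> * (real d * (32 * prior_moment * (1 + \<epsilon>)))"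
    using d_pos by (simp add: power_mult_distrib power_divide power2_eq_square)
  then have "(\<epsilon> * (third_energy (sqrt \<rho>))\<^sup>2) * real d \<le> (\<Delta> * (128 * prior_moment * (1 + \<epsilon>))) * real d" by (simp add: algebra_simps)
  then show "\<epsilon> * (third_energy (sqrt \<rho>))\<^sup>2 \<le> \<Delta> * (128 * prior_moment * (1 + \<epsilon>))"
    using d_pos by (simp add: mult_le_cancel_right)
qed


text \<open>The direction \<open>e = (1,\<dots>,1)/\<surd>d\<close> of the mean breaks the sign symmetry: \<open>u \<bullet> e\<close> is close to
  \<open>m \<noteq> 0\<close>, so contracting the covariances with \<open>u u\<^sup>T\<close> against \<open>e\<close> recovers \<open>m\<close> times the
  posterior covariance.\<close>

lemma cov_energy_le:
  assumes m: "m > 0"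
  shows "m / 2 * cov_energy r \<le> third_energy r / (2 * m) + 3 * env_const 0 * sqrt (1 / real d)"
proof -
  let ?K = "\<lambda>i j y. cov r (\<lambda>u. u i) (\<lambda>u. u j) y"
  let ?KK = "\<lambda>y. \<Sum>i<d. \<Sum>j<d. (?K i j y)\<^sup>2"
  define w where "w i j y = cov r (\<lambda>u. u i) (\<lambda>u. u j * dir_sum u) y" for i j y
  \<comment> \<open>Chosen so that its posterior pairing with \<open>dir_sum u - m\<close> is the
    sum of \<open>?K i j y * (w i j y - m * ?K i j y)\<close>. This pairing is small because
    \<open>dir_sum\<close> concentrates at \<open>m\<close>.\<close>
  define H where "H z = (\<Sum>i<d. \<Sum>j<d. ?K i j (snd z) * ((fst z i - post_mean r i (snd z)) * fst z j))" for z
  have w_eq: "w i j y = (\<Sum>l<d. cov r (\<lambda>u. u i) (\<lambda>u. u j * u l) y) / sqrt (real d)" if "i < d" "j < d" for i j y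
  proof -
    have s: "avg r (\<lambda>u. f u * (u j * dir_sum u)) y = (\<Sum>l<d. avg r (\<lambda>u. f u * (u j * u l)) y) / sqrt (real d)"
      if f: "moments \<gamma> f" for f
    proof -
      have "avg r (\<lambda>u. f u * (u j * dir_sum u)) y = avg r (\<lambda>u. (\<Sum>l<d. f u * (u j * u l)) * (1 / sqrt (real d))) y"
        by (simp add: dir_sum_def sum_distrib_left sum_divide_distrib)
      also have "\<dots> = (\<Sum>l<d. avg r (\<lambda>u. f u * (u j * u l)) y) / sqrt (real d)"
        unfolding avg_mult_right
        by (subst avg_sum) (use \<open>j < d\<close> in \<open>auto intro!: moments_integrable moments_mult moments_coord f\<close>)
      finally show ?thesis .
    qed
    show ?thesis
      using s[OF moments_coord[OF that(1)]] s[OF moments_const[of 1]]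
      by (simp add: w_def cov_def sum_subtractf sum_distrib_left diff_divide_distrib)
  qed
  \<comment> \<open>Cauchy-Schwarz against the unit vector with entries
    \<open>1 / sqrt (real d)\<close>.\<close>
  have ww: "(\<Sum>i<d. \<Sum>j<d. (w i j y)\<^sup>2) \<le> third_cov r y" for y
    unfolding third_cov_def
  proof (intro sum_mono)
    fix i j assume ij: "i \<in> {..<d}" "j \<in> {..<d}"
    let ?c = "\<lambda>l. cov r (\<lambda>u. u i) (\<lambda>u. u j * u l) y"
    have "(w i j y)\<^sup>2 = (\<Sum>l<d. ?c l * (1 / sqrt (real d)))\<^sup>2"
      using ij by (simp add: w_eq sum_divide_distrib)
    also have "\<dots> \<le> (\<Sum>l<d. (?c l)\<^sup>2) * (\<Sum>l<d. (1 / sqrt (real d))\<^sup>2)" by (rule Cauchy_Schwarz_ineq_sum)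
    also have "\<dots> = (\<Sum>l<d. (?c l)\<^sup>2)" using d_pos by (simp add: power_divide)
    finally show "(w i j y)\<^sup>2 \<le> (\<Sum>l<d. (?c l)\<^sup>2)" .
  qed
  have mH: "moments (joint r) H"
    unfolding H_def by (intro joint.moments_sum moments_mult moments_diff moments_cov moments_joint_coord moments_post_mean moments_coord) auto
  have mD: "moments (joint r) (\<lambda>z. dir_sum (fst z) - m)"
    by (intro moments_diff moments_joint_dir_sum joint.moments_const)
  have one: "avg r (\<lambda>u. (u i - post_mean r i y) * u j * (dir_sum u - m)) y = w i j y - m * ?K i j y" if "i < d" "j < d" for i j y
  proof -
    have i: "integrable \<gamma> (\<lambda>u. u i * (u j * dir_sum u))" "integrable \<gamma> (\<lambda>u. post_mean r i y * (u j * dir_sum u))"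
      "integrable \<gamma> (\<lambda>u. m * (u i * u j))" "integrable \<gamma> (\<lambda>u. m * (post_mean r i y * u j))"
      by (intro moments_integrable moments_mult moments_const moments_coord moments_dir_sum that)+
    have "avg r (\<lambda>u. (u i - post_mean r i y) * u j * (dir_sum u - m)) y
        = avg r (\<lambda>u. (u i * (u j * dir_sum u) - post_mean r i y * (u j * dir_sum u)) - (m * (u i * u j) - m * (post_mean r i y * u j))) y"
      by (simp add: algebra_simps)
    also have "\<dots> = (avg r (\<lambda>u. u i * (u j * dir_sum u)) y - post_mean r i y * avg r (\<lambda>u. u j * dir_sum u) y)
        - (m * avg r (\<lambda>u. u i * u j) y - m * (post_mean r i y * avg r (\<lambda>u. u j) y))"
      by (simp only: avg_diff[OF Bochner_Integration.integrable_diff[OF i(1,2)] Bochner_Integration.integrable_diff[OF i(3,4)]]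
          avg_diff[OF i(1,2)] avg_diff[OF i(3,4)] avg_mult_left)
    finally show ?thesis by (simp add: w_def cov_def post_mean_def right_diff_distrib)
  qed
  have avgH: "avg r (\<lambda>u. H (u, y) * (dir_sum u - m)) y = (\<Sum>i<d. \<Sum>j<d. ?K i j y * (w i j y - m * ?K i j y))" for y
  proof -
    have mo: "integrable \<gamma> (\<lambda>u. ?K i j y * ((u i - post_mean r i y) * u j * (dir_sum u - m)))" if "i < d" "j < d" for i j
      by (intro moments_integrable moments_mult moments_diff moments_const moments_coord moments_dir_sum that)
    have "avg r (\<lambda>u. H (u, y) * (dir_sum u - m)) y
        = avg r (\<lambda>u. \<Sum>i<d. \<Sum>j<d. ?K i j y * ((u i - post_mean r i y) * u j * (dir_sum u - m))) y"
      by (simp add: H_def sum_distrib_right mult.assoc)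
    also have "\<dots> = (\<Sum>i<d. avg r (\<lambda>u. \<Sum>j<d. ?K i j y * ((u i - post_mean r i y) * u j * (dir_sum u - m))) y)"
      by (rule avg_sum) (intro Bochner_Integration.integrable_sum mo; simp)
    also have "\<dots> = (\<Sum>i<d. \<Sum>j<d. avg r (\<lambda>u. ?K i j y * ((u i - post_mean r i y) * u j * (dir_sum u - m))) y)"
      by (intro sum.cong refl avg_sum mo) auto
    finally show ?thesis by (simp add: avg_mult_left one)
  qed
  have point: "m / 2 * ?KK y \<le> third_cov r y / (2 * m) - avg r (\<lambda>u. H (u, y) * (dir_sum u - m)) y" for y
  proof -
    \<comment> \<open>Completing the square absorbs the mixed term \<open>k * x\<close> and leaves
      half of \<open>m * k\<^sup>2\<close>.\<close>
    have am: "m / 2 * k\<^sup>2 + k * (x - m * k) \<le> x\<^sup>2 / (2 * m)" for k x :: real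
    proof -
      have "0 \<le> (x - m * k)\<^sup>2 / (2 * m)" using m by simp
      also have "\<dots> = x\<^sup>2 / (2 * m) - (m / 2 * k\<^sup>2 + k * (x - m * k))"
        using m by (simp add: field_simps power2_eq_square)
      finally show ?thesis by simp
    qed
    have "m / 2 * ?KK y + (\<Sum>i<d. \<Sum>j<d. ?K i j y * (w i j y - m * ?K i j y))
        = (\<Sum>i<d. \<Sum>j<d. m / 2 * (?K i j y)\<^sup>2 + ?K i j y * (w i j y - m * ?K i j y))"
      by (simp add: sum.distrib sum_distrib_left)
    also have "\<dots> \<le> (\<Sum>i<d. \<Sum>j<d. (w i j y)\<^sup>2 / (2 * m))" by (intro sum_mono am)
    also have "\<dots> = (\<Sum>i<d. \<Sum>j<d. (w i j y)\<^sup>2) / (2 * m)" by (simp add: sum_divide_distrib)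
    also have "\<dots> \<le> third_cov r y / (2 * m)" using ww m by (intro divide_right_mono) auto
    finally show ?thesis unfolding avgH by simp
  qed
  have mHD: "moments (joint r) (\<lambda>z. H z * (dir_sum (fst z) - m))" by (intro moments_mult mH mD)
  have nis: "integrable (joint r) (\<lambda>z. avg r (\<lambda>u. H (u, snd z) * (dir_sum u - m)) (snd z))"
      "(\<integral>z. avg r (\<lambda>u. H (u, snd z) * (dir_sum u - m)) (snd z) \<partial>joint r) = (\<integral>z. H z * (dir_sum (fst z) - m) \<partial>joint r)"
    using nishimori[OF moments_integrable[OF mHD]] by simp_all
  have "m / 2 * cov_energy r = (\<integral>z. m / 2 * ?KK (snd z) \<partial>joint r)" by (simp add: cov_energy_def)
  also have "\<dots> \<le> (\<integral>z. third_cov r (snd z) / (2 * m) - avg r (\<lambda>u. H (u, snd z) * (dir_sum u - m)) (snd z) \<partial>joint r)"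
    by (intro integral_mono point Bochner_Integration.integrable_diff nis integrable_mult_right moments_integrable
        joint.moments_divide moments_third_cov moments_cov_energy)
  also have "\<dots> = third_energy r / (2 * m) - (\<integral>z. H z * (dir_sum (fst z) - m) \<partial>joint r)"
    using nis moments_integrable[OF moments_third_cov[of r]] by (simp add: third_energy_def)
  also have "\<dots> \<le> third_energy r / (2 * m) + 3 * env_const 0 * sqrt (1 / real d)"
  proof -
    \<comment> \<open>Cauchy-Schwarz gives \<open>(H z)\<^sup>2 \<le> 8 * envelope r z ^ 4\<close>,
      and 8 is below 9: dividing by 3 brings \<open>H\<close> under the squared envelope.\<close>
    have "\<bar>\<integral>z. H z / 3 * (dir_sum (fst z) - m) \<partial>joint r\<bar> \<le> env_const 0 * sqrt (1 / real d)"
    proof (rule envelope_cauchy_schwarz)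
      show "moments (joint r) (\<lambda>z. H z / 3)" by (rule joint.moments_divide[OF mH])
      show "(\<integral>z. (dir_sum (fst z) - m)\<^sup>2 \<partial>joint r) \<le> 1 / real d"
        using integral_joint_fst[of "\<lambda>u. (dir_sum u - m)\<^sup>2" r] moments_measurable[OF moments_dir_sum] dir_sum_variance
        by (simp add: borel_measurable_diff borel_measurable_power)
      show "\<bar>H z / 3\<bar> \<le> (envelope r z + 0)\<^sup>2" for z
      proof -
        let ?e = "envelope r z" and ?y = "snd z"
        have "(H z)\<^sup>2 = (\<Sum>p\<in>{..<d} \<times> {..<d}. ?K (fst p) (snd p) ?y * ((fst z (fst p) - post_mean r (fst p) ?y) * fst z (snd p)))\<^sup>2"
          by (simp add: H_def sum.cartesian_product case_prod_beta')
        also have "\<dots> \<le> (\<Sum>p\<in>{..<d} \<times> {..<d}. (?K (fst p) (snd p) ?y)\<^sup>2)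
            * (\<Sum>p\<in>{..<d} \<times> {..<d}. ((fst z (fst p) - post_mean r (fst p) ?y) * fst z (snd p))\<^sup>2)"
          by (rule Cauchy_Schwarz_ineq_sum)
        also have "\<dots> = ?KK ?y * ((\<Sum>i<d. (fst z i - post_mean r i ?y)\<^sup>2) * sqnorm (fst z))"
          by (simp add: sum.cartesian_product case_prod_beta' power_mult_distrib sum_product sqnorm_def)
        also have "\<dots> \<le> (4 * ?e\<^sup>2) * ((2 * ?e) * ?e)"
        proof (intro mult_mono)
          show "?KK ?y \<le> 4 * ?e\<^sup>2" using cov_square_le[of r ?y] post_cube_sq_le[of r z] by linarith
          have "(\<Sum>i<d. (fst z i - post_mean r i ?y)\<^sup>2) \<le> (\<Sum>i<d. 2 * (fst z i)\<^sup>2 + 2 * (post_mean r i ?y)\<^sup>2)"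
            by (intro sum_mono square_sum_le)
          also have "\<dots> = 2 * (sqnorm (fst z) + mean_sq r ?y)"
            by (simp add: sum.distrib sum_distrib_left[symmetric] sqnorm_def mean_sq_def)
          also have "\<dots> \<le> 2 * ?e"
            using le_cube(2)[of "fst z"] mean_sq_le[of r ?y] unfolding envelope_def by simp
          finally show "(\<Sum>i<d. (fst z i - post_mean r i ?y)\<^sup>2) \<le> 2 * ?e" .
          show "sqnorm (fst z) \<le> ?e" using le_cube(2)[of "fst z"] envelope_ge(3)[of z r] by linarith
        qed (use envelope_ge(1)[of r z] sqnorm_nonneg in \<open>auto intro!: sum_nonneg mult_nonneg_nonneg\<close>)
        also have "\<dots> \<le> (3 * ?e\<^sup>2)\<^sup>2"
          using zero_le_power[of ?e 4] envelope_ge(1)[of r z] by (simp add: power2_eq_square power4_eq_xxxx)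
        finally have "\<bar>H z\<bar> \<le> \<bar>3 * ?e\<^sup>2\<bar>" by (simp only: abs_le_square_iff)
        then show ?thesis by simp
      qed
    qed (auto simp: mD)
    then show ?thesis by simp
  qed
  finally show ?thesis .
qed

text \<open>Pigeonhole over \<open>d\<close> increments of a quantity bounded by \<open>16 prior_moment\<close>.\<close>

lemma exists_small_increment:
  assumes \<rho>: "\<rho> > 0" and \<epsilon>: "\<epsilon> > 0"
  shows "\<exists>\<rho>'\<in>{\<rho>..\<rho> + \<epsilon>}. (third_energy (sqrt \<rho>'))\<^sup>2 \<le> 2048 * prior_moment\<^sup>2 * (1 + \<epsilon>) / (\<epsilon> * real d)"
proof -
  define x where "x k = \<rho> + real k * (\<epsilon> / real d)" for k :: nat
  define \<Delta> where "\<Delta> k = mean_energy (sqrt (x (Suc k))) - mean_energy (sqrt (x k))" for k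
  have xp: "x k > 0" for k using \<rho> \<epsilon> by (auto simp: x_def intro!: add_pos_nonneg)
  have xS: "x (Suc k) = x k + \<epsilon> / real d" for k by (simp add: x_def distrib_right add_divide_distrib)
  have "(\<Sum>k<d. \<Delta> k) = mean_energy (sqrt (x d)) - mean_energy (sqrt (x 0))"
    unfolding \<Delta>_def by (rule sum_lessThan_telescope)
  also have "\<dots> \<le> 16 * prior_moment" using mean_energy_bounds[of "sqrt (x d)"] mean_energy_bounds[of "sqrt (x 0)"] by linarith
  finally have tot: "(\<Sum>k<d. \<Delta> k) \<le> 16 * prior_moment" .
  have "\<exists>k<d. \<Delta> k \<le> 16 * prior_moment / real d"
  proof (rule ccontr)
    assume "\<not> ?thesis"
    then have "(\<Sum>k<d. 16 * prior_moment / real d) < (\<Sum>k<d. \<Delta> k)"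
      using d_pos by (intro sum_strict_mono) (auto simp: not_le)
    then show False using tot d_pos by simp
  qed
  then obtain k where k: "k < d" "\<Delta> k \<le> 16 * prior_moment / real d" by blast
  have "\<epsilon> * (third_energy (sqrt (x k)))\<^sup>2 \<le> \<Delta> k * (128 * prior_moment * (1 + \<epsilon>))"
    using third_energy_step(2)[OF xp \<epsilon>, of k] by (simp add: \<Delta>_def xS)
  also have "\<dots> \<le> 16 * prior_moment / real d * (128 * prior_moment * (1 + \<epsilon>))"
    using k prior_moment_ge_1 \<epsilon> by (intro mult_right_mono) auto
  finally have "(third_energy (sqrt (x k)))\<^sup>2 \<le> 2048 * prior_moment\<^sup>2 * (1 + \<epsilon>) / (\<epsilon> * real d)"
    using \<epsilon> d_pos by (simp add: field_simps power2_eq_square)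
  moreover have "x k \<in> {\<rho>..\<rho> + \<epsilon>}"
  proof -
    have "real k * (\<epsilon> / real d) \<le> real d * (\<epsilon> / real d)" using k \<epsilon> by (intro mult_right_mono) auto
    then show ?thesis using \<epsilon> d_pos by (simp add: x_def)
  qed
  ultimately show ?thesis by blast
qed


text \<open>The position of the good ratio is not known in advance, so \<open>q\<close> is a
  function of the ratio and is bounded by \<open>Q\<close> on the whole interval. At that ratio the
  chain runs from \<open>third_energy\<close> to \<open>cov_energy\<close>,
  \<open>overlap_var\<close>, the variance of \<open>mean_sq\<close> and finally
  \<open>cross\<close>.\<close>

lemma exists_cross_close:
  assumes \<rho>: "\<rho> > 0" "\<rho> + \<epsilon> \<le> R" and \<epsilon>: "\<epsilon> > 0"
    and m: "0 < m\<^sub>1" "m\<^sub>1 \<le> m" "m \<le> m\<^sub>2" and B: "prior_moment \<le> B"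
    and q: "\<And>x. x \<in> {\<rho>..\<rho> + \<epsilon>} \<Longrightarrow> 0 < q x \<and> q x \<le> Q \<and> x * (q x)\<^sup>2 + (1 - x * (1 + m\<^sup>2)) * q x - m\<^sup>2 = 0"
  shows "\<exists>x\<in>{\<rho>..\<rho> + \<epsilon>}. \<bar>cross (sqrt x) - (q x)\<^sup>2\<bar> \<le> cross_rate B \<epsilon> m\<^sub>1 m\<^sub>2 Q R d"
proof -
  obtain x where x: "x \<in> {\<rho>..\<rho> + \<epsilon>}" and tx: "(third_energy (sqrt x))\<^sup>2 \<le> 2048 * prior_moment\<^sup>2 * (1 + \<epsilon>) / (\<epsilon> * real d)"
    using exists_small_increment[OF \<rho>(1) \<epsilon>] by blast
  have x0: "x > 0" "x \<le> R" using x \<rho> by auto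
  have pb: "0 \<le> prior_moment" "1 \<le> B" using prior_moment_ge_1 B by auto
  have mpos: "m > 0" using m by simp
  have t: "third_energy (sqrt x) \<le> third_rate B \<epsilon> d"
    unfolding third_rate_def
  proof (rule real_le_rsqrt)
    have "2048 * prior_moment\<^sup>2 * (1 + \<epsilon>) / (\<epsilon> * real d) \<le> 2048 * B\<^sup>2 * (1 + \<epsilon>) / (\<epsilon> * real d)"
      using pb B \<epsilon> by (intro divide_right_mono mult_right_mono mult_left_mono power_mono) auto
    then show "(third_energy (sqrt x))\<^sup>2 \<le> 2048 * B\<^sup>2 * (1 + \<epsilon>) / (\<epsilon> * real d)" using tx by linarith
  qed
  have k: "cov_energy (sqrt x) \<le> cov_rate B \<epsilon> m\<^sub>1 d"
  proof -
    have g0: "env_const 0 \<le> sqrt (8 * (16 * B))" using B by (simp add: env_const_def)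
    have "cov_energy (sqrt x) = 2 / m * (m / 2 * cov_energy (sqrt x))" using mpos by simp
    also have "\<dots> \<le> 2 / m * (third_energy (sqrt x) / (2 * m) + 3 * env_const 0 * sqrt (1 / real d))"
      using mpos by (intro mult_left_mono cov_energy_le) auto
    also have "\<dots> \<le> 2 / m\<^sub>1 * (third_rate B \<epsilon> d / (2 * m\<^sub>1) + 3 * sqrt (8 * (16 * B)) * sqrt (1 / real d))"
      using m third_energy_nonneg[of "sqrt x"] t g0 env_const_nonneg[of 0]
      by (intro mult_mono add_mono frac_le mult_right_mono mult_left_mono) auto
    finally show ?thesis by (simp add: cov_rate_def)
  qed
  have o: "overlap_var (sqrt x) \<le> overlap_rate B \<epsilon> m\<^sub>1 d"
  proof -
    have "sqrt (16 * prior_moment) * sqrt (cov_energy (sqrt x)) \<le> sqrt (16 * B) * sqrt (cov_rate B \<epsilon> m\<^sub>1 d)"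
      using B k pb cov_energy_nonneg[of "sqrt x"] by (intro mult_mono) auto
    then show ?thesis using overlap_variance_le[of "sqrt x"] by (simp add: overlap_rate_def)
  qed
  note qx = q[OF x]
  have root: "(sqrt x)\<^sup>2 * (q x)\<^sup>2 + (1 - (sqrt x)\<^sup>2 * (1 + m\<^sup>2)) * q x - m\<^sup>2 = 0" using qx x0 by simp
  have G: "env_const (q x) \<le> sqrt (8 * (16 * B + Q ^ 4))"
    unfolding env_const_def using qx B by (intro real_sqrt_le_mono mult_left_mono add_mono power_mono) auto
  have m2: "m\<^sup>2 \<le> m\<^sub>2\<^sup>2" "m\<^sub>1\<^sup>2 \<le> m\<^sup>2" using m by (auto intro!: power_mono)
  let ?V = "\<integral>z. (mean_sq (sqrt x) (snd z) - q x)\<^sup>2 \<partial>joint (sqrt x)"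
  have V: "?V \<le> var_rate B \<epsilon> m\<^sub>1 m\<^sub>2 Q R d"
  proof -
    \<comment> \<open>Undoing the factor \<open>m\<^sup>2 / q x\<close> of
      \<open>mean_sq_concentration\<close> costs \<open>q x / m\<^sup>2\<close>; it is bounded
      because the mean stays above \<open>m\<^sub>1 > 0\<close>.\<close>
    have "?V = q x / m\<^sup>2 * (m\<^sup>2 / q x * ?V)" using qx mpos by simp
    also have "\<dots> \<le> q x / m\<^sup>2 * (env_const (q x) * ((4 * x + x * (1 + m\<^sup>2)) * sqrt (overlap_var (sqrt x)) + m * sqrt (1 / real d)
        + x * sqrt ((2 + 4 * m\<^sup>2) / real d)))"
      using mean_sq_concentration[OF conjunct1[OF qx] root] qx x0 mpos by (intro mult_left_mono) auto
    also have "\<dots> \<le> var_rate B \<epsilon> m\<^sub>1 m\<^sub>2 Q R d"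
      unfolding var_rate_def
    proof (intro mult_mono add_mono frac_le real_sqrt_le_mono divide_right_mono G m2 o)
      show "0 < m\<^sub>1\<^sup>2" using m by simp
      show "0 \<le> sqrt (8 * (16 * B + Q ^ 4))" using env_const_nonneg[of "q x"] G by linarith
      show "0 \<le> env_const (q x) * ((4 * x + x * (1 + m\<^sup>2)) * sqrt (overlap_var (sqrt x)) + m * sqrt (1 / real d) + x * sqrt ((2 + 4 * m\<^sup>2) / real d))"
        using env_const_nonneg x0 overlap_var_nonneg mpos by (intro mult_nonneg_nonneg add_nonneg_nonneg) auto
      show "0 \<le> (4 * x + x * (1 + m\<^sup>2)) * sqrt (overlap_var (sqrt x)) + m * sqrt (1 / real d) + x * sqrt ((2 + 4 * m\<^sup>2) / real d)"
        using x0 overlap_var_nonneg mpos by (intro mult_nonneg_nonneg add_nonneg_nonneg) auto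
    qed (use d_pos qx x0 m m2 overlap_var_nonneg[of "sqrt x"] in \<open>auto intro!: divide_nonneg_nonneg add_nonneg_nonneg mult_nonneg_nonneg\<close>)
    finally show ?thesis .
  qed
  have "\<bar>cross (sqrt x) - (q x)\<^sup>2\<bar> \<le> cov_energy (sqrt x) + 2 * overlap_var (sqrt x) + env_const (q x) * sqrt ?V"
    using cross_close qx by blast
  also have "\<dots> \<le> cross_rate B \<epsilon> m\<^sub>1 m\<^sub>2 Q R d"
    unfolding cross_rate_def
    using k o G V env_const_nonneg[of "q x"] order_trans[OF env_const_nonneg G]
    by (intro add_mono mult_mono real_sqrt_le_mono) (auto simp: overlap_var_nonneg)
  finally show ?thesis using x by blast
qed


section \<open>Identification of the conditional expectation\<close>

text \<open>The given observation is the full matrix, that of the channel only its triangle.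
  Together with \<open>obs_eq_unfold\<close> this makes each a function of the other, so
  conditioning on either is the same.\<close>

lemma observe_eq_obs: "observe (sqrt \<rho>) (fst \<omega>) (snd \<omega>) = restrict (obs d \<rho> \<omega>) (upper d)"
proof
  fix p :: "nat \<times> nat"
  obtain i j where p: "p = (i, j)" by (cases p)
  show "observe (sqrt \<rho>) (fst \<omega>) (snd \<omega>) p = restrict (obs d \<rho> \<omega>) (upper d) p"
  proof -
    have "(i, j) \<in> upper d \<longleftrightarrow> i \<le> j \<and> j < d" by (simp add: upper_def)
    then show ?thesis
      by (cases "i \<le> j \<and> j < d") (auto simp: p observe_def obs_def goe_matrix_def)
  qed
qed

lemma cross_space_eq: "cross_space d m = \<gamma> \<Otimes>\<^sub>M noise"
  by (simp add: cross_space_def noise_eq_goe_law)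

definition unfold_obs :: "(nat \<times> nat \<Rightarrow> real) \<Rightarrow> nat \<times> nat \<Rightarrow> real" where
  "unfold_obs y = (\<lambda>p \<in> {..<d} \<times> {..<d}. goe_matrix y (fst p) (snd p))"

lemma obs_eq_unfold: "obs d \<rho> \<omega> = unfold_obs (observe (sqrt \<rho>) (fst \<omega>) (snd \<omega>))"
proof
  fix p :: "nat \<times> nat"
  obtain i j where p: "p = (i, j)" by (cases p)
  have "(min i j, max i j) \<in> upper d \<longleftrightarrow> i < d \<and> j < d" by (auto simp: upper_def)
  moreover have "fst \<omega> (min i j) * fst \<omega> (max i j) = fst \<omega> i * fst \<omega> j"
    by (auto simp: min_def max_def)
  ultimately show "obs d \<rho> \<omega> p = unfold_obs (observe (sqrt \<rho>) (fst \<omega>) (snd \<omega>)) p"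
    by (cases "i < d \<and> j < d") (auto simp: p obs_def unfold_obs_def observe_def goe_matrix_def)
qed

lemma unfold_obs_measurable[measurable]: "unfold_obs \<in> measurable noise (PiM ({..<d} \<times> {..<d}) (\<lambda>_. borel))"
proof (rule measurable_PiM_single')
  fix p assume p: "p \<in> {..<d} \<times> {..<d}"
  then have "(min (fst p) (snd p), max (fst p) (snd p)) \<in> upper d" by (auto simp: upper_def)
  from component_measurable[OF this] p
  show "(\<lambda>y. unfold_obs y p) \<in> borel_measurable noise"
    by (simp only: unfold_obs_def goe_matrix_def restrict_apply if_True)
next
  show "unfold_obs \<in> space noise \<rightarrow> (\<Pi>\<^sub>E p\<in>{..<d} \<times> {..<d}. space borel)"
    by (rule Pi_I, unfold unfold_obs_def restrict_PiE_iff) simp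
qed

lemma obs_measurable: "obs d \<rho> \<in> measurable (\<gamma> \<Otimes>\<^sub>M noise) (PiM ({..<d} \<times> {..<d}) (\<lambda>_. borel))"
  unfolding obs_eq_unfold[abs_def] by measurable

lemma integral_observe:
  fixes F :: "_ \<Rightarrow> real"
  assumes [measurable]: "F \<in> borel_measurable (\<gamma> \<Otimes>\<^sub>M noise)"
  shows "(\<integral>\<omega>. F (fst \<omega>, observe r (fst \<omega>) (snd \<omega>)) \<partial>(\<gamma> \<Otimes>\<^sub>M noise)) = (\<integral>z. F z \<partial>joint r)"
proof -
  have t: "(\<lambda>z. (fst z, observe r (fst z) (snd z))) \<in> measurable (\<gamma> \<Otimes>\<^sub>M noise) (\<gamma> \<Otimes>\<^sub>M noise)" by measurable
  show ?thesis unfolding joint_eq_distr by (subst integral_distr[OF t]) auto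
qed

text \<open>Every event of the observed sigma-algebra is decided by \<open>observe\<close>, and by
  \<open>nishimori\<close> the entry and its posterior average have equal integrals over each such
  event.\<close>

lemma cond_exp_eq_avg:
  assumes i: "i < d" "j < d"
  shows "AE \<omega> in cross_space d m. real_cond_exp (cross_space d m) (obs_sigma d \<rho> m) (\<lambda>\<omega>'. fst \<omega>' i * fst \<omega>' j) \<omega>
    = avg (sqrt \<rho>) (\<lambda>u. u i * u j) (observe (sqrt \<rho>) (fst \<omega>) (snd \<omega>))"
proof -
  let ?M = "\<gamma> \<Otimes>\<^sub>M noise" and ?F = "obs_sigma d \<rho> m" and ?r = "sqrt \<rho>"
  let ?f = "\<lambda>\<omega> :: (nat \<Rightarrow> real) \<times> (nat \<times> nat \<Rightarrow> real). fst \<omega> i * fst \<omega> j"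
  let ?g = "\<lambda>\<omega>. avg ?r (\<lambda>u. u i * u j) (observe ?r (fst \<omega>) (snd \<omega>))"
  let ?B = "PiM ({..<d} \<times> {..<d}) (\<lambda>_. borel)"
  have mf: "moments \<gamma> (\<lambda>u. u i * u j)" by (intro moments_mult moments_coord i)
  note [measurable] = moments_measurable[OF mf]
  have F: "?F = vimage_algebra (space ?M) (obs d \<rho>) ?B"
    by (simp add: obs_sigma_def cross_space_eq)
  have obsF: "obs d \<rho> \<in> measurable ?F ?B"
    unfolding F by (rule measurable_vimage_algebra1) (use measurable_space[OF obs_measurable] in auto)
  have sub: "subalgebra ?M ?F"
    unfolding subalgebra_def F using sets_image_in_sets[OF refl obs_measurable, of \<rho>] by simp
  interpret S: finite_measure_subalgebra ?M ?F
    by (rule finite_measure_subalgebra.intro)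
      (use sub in \<open>auto intro: UN.finite_measure_axioms simp: finite_measure_subalgebra_axioms_def\<close>)
  have obs_y: "(\<lambda>\<omega>. observe ?r (fst \<omega>) (snd \<omega>)) \<in> measurable ?F noise"
    unfolding observe_eq_obs
  proof (rule measurable_into_noise)
    fix p assume p: "p \<in> upper d"
    then have "p \<in> {..<d} \<times> {..<d}" by (auto simp: upper_def)
    then have "(\<lambda>x. x p) \<in> borel_measurable ?B" by measurable
    from measurable_compose[OF obsF this] show "(\<lambda>\<omega>. restrict (obs d \<rho> \<omega>) (upper d) p) \<in> borel_measurable ?F"
      using p by simp
  qed auto
  have int_f: "integrable ?M ?f"
  proof -
    have "moments (distr ?M \<gamma> fst) (\<lambda>u. u i * u j)" using mf noise.distr_pair_fst[of \<gamma>] by simp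
    then have "moments ?M (\<lambda>\<omega>. fst \<omega> i * fst \<omega> j)" by (subst (asm) moments_distr) auto
    then show ?thesis by (rule moments_integrable)
  qed
  have t: "(\<lambda>z. (fst z, observe ?r (fst z) (snd z))) \<in> measurable ?M ?M" by measurable
  have int_g: "integrable ?M ?g"
  proof -
    have "integrable (joint ?r) (\<lambda>z. avg ?r (\<lambda>u. u i * u j) (snd z))"
      by (intro moments_integrable moments_avg mf)
    then show ?thesis unfolding joint_eq_distr by (subst (asm) integrable_distr_eq[OF t]) auto
  qed
  have "AE \<omega> in ?M. real_cond_exp ?M ?F ?f \<omega> = ?g \<omega>"
  proof (rule S.real_cond_exp_charact[OF _ int_f int_g])
    show "?g \<in> borel_measurable ?F"
      by (rule measurable_compose[OF obs_y]) measurable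
    fix A assume "A \<in> sets ?F"
    then obtain B where B[measurable]: "B \<in> sets ?B" and A: "A = obs d \<rho> -` B \<inter> space ?M"
      unfolding F using sets_vimage_algebra2[of "obs d \<rho>" "space ?M" ?B] measurable_space[OF obs_measurable, of _ \<rho>]
      by blast
    \<comment> \<open>The indicator of the event as a function of the triangle, the form in which it
      can be pulled out of the posterior average.\<close>
    define T where "T y = (indicator B (unfold_obs y) :: real)" for y
    have T[measurable]: "T \<in> borel_measurable noise" unfolding T_def by measurable
    have ind: "indicator A \<omega> = T (observe ?r (fst \<omega>) (snd \<omega>))" if "\<omega> \<in> space ?M" for \<omega>
      using that by (auto simp: A T_def indicator_def obs_eq_unfold)
    have mT: "moments (joint ?r) (\<lambda>z. T (snd z))"
      by (rule joint.moments_dominated[OF _ joint.moments_const[of _ 1]]) (auto simp: T_def)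
    have "(LINT \<omega>:A|?M. ?f \<omega>) = (\<integral>\<omega>. ?f \<omega> * T (observe ?r (fst \<omega>) (snd \<omega>)) \<partial>?M)"
      unfolding set_lebesgue_integral_def by (intro Bochner_Integration.integral_cong) (auto simp: ind mult.commute)
    also have "\<dots> = (\<integral>z. ?f z * T (snd z) \<partial>joint ?r)"
      using integral_observe[of "\<lambda>z. ?f z * T (snd z)" ?r] by simp
    also have "\<dots> = (\<integral>z. avg ?r (\<lambda>u. u i * u j) (snd z) * T (snd z) \<partial>joint ?r)"
      using nishimori_moments[OF moments_mult[OF moments_joint_fst[OF mf] mT]] by (simp add: avg_mult_right)
    also have "\<dots> = (\<integral>\<omega>. ?g \<omega> * T (observe ?r (fst \<omega>) (snd \<omega>)) \<partial>?M)"
      using integral_observe[of "\<lambda>z. avg ?r (\<lambda>u. u i * u j) (snd z) * T (snd z)" ?r] by simp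
    also have "\<dots> = (LINT \<omega>:A|?M. ?g \<omega>)"
      unfolding set_lebesgue_integral_def by (intro Bochner_Integration.integral_cong) (auto simp: ind mult.commute)
    finally show "(LINT \<omega>:A|?M. ?f \<omega>) = (LINT \<omega>:A|?M. ?g \<omega>)" .
  qed
  then show ?thesis unfolding cross_space_eq .
qed

lemma cross_check_eq_cross: "cross_check d \<rho> m = cross (sqrt \<rho>)"
proof -
  let ?r = "sqrt \<rho>" and ?M = "\<gamma> \<Otimes>\<^sub>M noise"
  have mf: "(\<lambda>u. u i * u j) \<in> borel_measurable \<gamma>" if "i < d" "j < d" for i j
    using that by (intro moments_measurable moments_mult moments_coord)
  have m1: "(\<lambda>\<omega>. avg ?r (\<lambda>u. u i * u j) (snd \<omega>)) \<in> borel_measurable ?M" if "i < d" "j < d" for i j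
    using avg_measurable[OF mf[OF that]] by measurable
  have "AE \<omega> in ?M. \<forall>i\<in>{..<d}. \<forall>j\<in>{..<d}. real_cond_exp (cross_space d m) (obs_sigma d \<rho> m) (\<lambda>\<omega>'. fst \<omega>' i * fst \<omega>' j) \<omega>
      = avg ?r (\<lambda>u. u i * u j) (observe ?r (fst \<omega>) (snd \<omega>))"
    unfolding cross_space_eq
    by (intro eventually_ball_finite ballI cond_exp_eq_avg[unfolded cross_space_eq]) auto
  then have "cross_check d \<rho> m = (\<integral>\<omega>. (\<Sum>i<d. \<Sum>j<d. (avg ?r (\<lambda>u. u i * u j) (observe ?r (fst \<omega>) (snd \<omega>)))\<^sup>2) \<partial>?M)"
    unfolding cross_check_def cross_space_eq
  proof (intro integral_cong_AE)
    have sub: "subalgebra ?M (obs_sigma d \<rho> m)"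
      unfolding subalgebra_def obs_sigma_def using sets_image_in_sets[OF refl obs_measurable, of \<rho>]
      by (simp add: cross_space_eq)
    show "(\<lambda>\<omega>. \<Sum>i<d. \<Sum>j<d. (real_cond_exp ?M (obs_sigma d \<rho> m) (\<lambda>\<omega>'. fst \<omega>' i * fst \<omega>' j) \<omega>)\<^sup>2) \<in> borel_measurable ?M"
      by (intro borel_measurable_sum borel_measurable_power borel_measurable_cond_exp2)
    show "(\<lambda>\<omega>. \<Sum>i<d. \<Sum>j<d. (avg ?r (\<lambda>u. u i * u j) (observe ?r (fst \<omega>) (snd \<omega>)))\<^sup>2) \<in> borel_measurable ?M"
      using avg_measurable[OF mf] by (intro borel_measurable_sum borel_measurable_power) auto
  qed (auto elim!: eventually_mono)
  also have "\<dots> = cross ?r"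
    unfolding cross_def
    using integral_observe[of "\<lambda>z. \<Sum>i<d. \<Sum>j<d. (avg ?r (\<lambda>u. u i * u j) (snd z))\<^sup>2" ?r] m1 by simp
  finally show ?thesis .
qed

text \<open>Prepares measurability in the mean: only plain integrals against the prior and the noise
  law remain, and the mean enters through the prior alone. Of the two factors \<open>Z r y\<close>
  in the squared averages, one cancels against the weight in \<open>joint\<close>.\<close>

lemma cross_eq_integral:
  "cross r = (\<integral>y. (\<Sum>i<d. \<Sum>j<d. (\<integral>u. u i * u j * lik r y u \<partial>\<gamma>)\<^sup>2) / (\<integral>u. lik r y u \<partial>\<gamma>) \<partial>goe_law d)"
proof -
  have mf: "moments \<gamma> (\<lambda>u. u i * u j)" if "i < d" "j < d" for i j
    using that by (intro moments_mult moments_coord)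
  have i: "integrable (joint r) (\<lambda>z. \<Sum>i<d. \<Sum>j<d. (avg r (\<lambda>u. u i * u j) (snd z))\<^sup>2)"
    by (intro moments_integrable joint.moments_sum joint.moments_power moments_avg mf) auto
  have "cross r = (\<integral>y. Z r y * (\<Sum>i<d. \<Sum>j<d. (avg r (\<lambda>u. u i * u j) y)\<^sup>2) \<partial>noise)"
    unfolding cross_def by (rule integral_joint_snd(2)[where h="\<lambda>y. \<Sum>i<d. \<Sum>j<d. (avg r (\<lambda>u. u i * u j) y)\<^sup>2", OF i])
  also have "\<dots> = (\<integral>y. (\<Sum>i<d. \<Sum>j<d. (\<integral>u. u i * u j * lik r y u \<partial>\<gamma>)\<^sup>2) / (\<integral>u. lik r y u \<partial>\<gamma>) \<partial>noise)"
  proof (intro Bochner_Integration.integral_cong refl)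
    fix y
    have "(avg r (\<lambda>u. u i * u j) y)\<^sup>2 = (\<integral>u. u i * u j * lik r y u \<partial>\<gamma>)\<^sup>2 / (Z r y)\<^sup>2" if "i < d" "j < d" for i j
      using moments_measurable[OF mf[OF that]] by (simp add: avg_eq power_divide)
    then have "(\<Sum>i<d. \<Sum>j<d. (avg r (\<lambda>u. u i * u j) y)\<^sup>2) = (\<Sum>i<d. \<Sum>j<d. (\<integral>u. u i * u j * lik r y u \<partial>\<gamma>)\<^sup>2) / (Z r y)\<^sup>2"
      by (simp add: sum_divide_distrib)
    then show "Z r y * (\<Sum>i<d. \<Sum>j<d. (avg r (\<lambda>u. u i * u j) y)\<^sup>2)
        = (\<Sum>i<d. \<Sum>j<d. (\<integral>u. u i * u j * lik r y u \<partial>\<gamma>)\<^sup>2) / (\<integral>u. lik r y u \<partial>\<gamma>)"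
      using Z_pos[of r y] by (simp add: power2_eq_square Z_def[symmetric])
  qed
  finally show ?thesis by (simp only: noise_eq_goe_law)
qed

end

section \<open>Uniformity in the mean and the limit\<close>

lemma normal_law_shift: "\<sigma> > 0 \<Longrightarrow> distr (normal_law 0 \<sigma>) (normal_law 0 \<sigma>) (\<lambda>x. x + \<mu>) = normal_law \<mu> \<sigma>"
proof (rule measure_eqI)
  fix A assume \<sigma>: "\<sigma> > 0" and "A \<in> sets (distr (normal_law 0 \<sigma>) (normal_law 0 \<sigma>) (\<lambda>x. x + \<mu>))"
  then have A[measurable]: "A \<in> sets borel" by simp
  have "emeasure (normal_law \<mu> \<sigma>) A = (\<integral>\<^sup>+x. ennreal (normal_density \<mu> \<sigma> x) * indicator A x \<partial>lborel)"
    by (simp add: emeasure_density)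
  also have "\<dots> = (\<integral>\<^sup>+x. ennreal (normal_density 0 \<sigma> x) * indicator A (x + \<mu>) \<partial>lborel)"
    by (subst nn_integral_real_affine[where c=1 and t=\<mu>]) (auto simp: normal_density_def add.commute)
  also have "\<dots> = (\<integral>\<^sup>+x. indicator A (x + \<mu>) \<partial>normal_law 0 \<sigma>)"
    by (simp add: nn_integral_density)
  also have "\<dots> = (\<integral>\<^sup>+x. indicator A x \<partial>distr (normal_law 0 \<sigma>) (normal_law 0 \<sigma>) (\<lambda>x. x + \<mu>))"
    by (subst nn_integral_distr) auto
  finally show "emeasure (distr (normal_law 0 \<sigma>) (normal_law 0 \<sigma>) (\<lambda>x. x + \<mu>)) A = emeasure (normal_law \<mu> \<sigma>) A"
    by simp
qed simp

text \<open>Moves the mean from the measure into the integrand, where joint measurability in the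
  mean and the other variables can be read off.\<close>

lemma spike_law_shift:
  assumes d: "d > 0"
  shows "spike_law d m = distr (spike_law d 0) (spike_law d 0) (\<lambda>g. \<lambda>i\<in>{..<d}. g i + m / sqrt (real d))"
proof -
  let ?N = "\<lambda>_. normal_law 0 (sqrt (1 / real d))"
  have s: "0 < sqrt (1 / real d)" using d by simp
  have ps: "prob_space (normal_law 0 (sqrt (1 / real d)))" by (rule prob_space_normal_density[OF s])
  have P: "product_prob_space ?N"
    using prob_space_imp_sigma_finite[OF ps] ps
    by (simp add: product_prob_space_def product_sigma_finite_def product_prob_space_axioms_def)
  have "distr (PiM {..<d} ?N) (PiM {..<d} ?N) (compose {..<d} (\<lambda>x. x + m / sqrt (real d)))
      = PiM {..<d} (\<lambda>i. distr (?N i) (?N i) (\<lambda>x. x + m / sqrt (real d)))"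
    by (rule distr_PiM_finite_prob_space[OF _ P P]) auto
  then show ?thesis
    by (simp add: spike_law_eq normal_law_shift[OF s] compose_def[abs_def])
qed

text \<open>\<open>truncated_cross\<close> integrates over the mean; for a function that is not
  measurable that integral would be the default value 0. After the shift to mean 0, all integrals
  depend on the mean as a parameter and are jointly measurable.\<close>

lemma cross_measurable:
  assumes d: "d > 0"
  shows "(\<lambda>m. spiked_goe.cross d m r) \<in> borel_measurable borel"
proof -
  let ?\<gamma> = "spike_law d 0"
  define sh where "sh m g = (\<lambda>i\<in>{..<d}. g i + m / sqrt (real d))" for m and g :: "nat \<Rightarrow> real"
  define L where "L y u = exp (real d / 2 * r * (\<Sum>i<d. \<Sum>j<d. goe_matrix y i j * (u i * u j)) - real d / 4 * r\<^sup>2 * (\<Sum>i<d. (u i)\<^sup>2)\<^sup>2)"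
    for y u
  have meas_u[measurable]: "i < d \<Longrightarrow> (\<lambda>u. u i) \<in> borel_measurable ?\<gamma>" for i
    unfolding spike_law_eq by measurable
  have sh_meas[measurable]: "sh m \<in> measurable ?\<gamma> ?\<gamma>" for m
    using meas_u unfolding sh_def spike_law_eq
    by (intro measurable_restrict) (auto intro!: borel_measurable_add)
  have sig: "sigma_finite_measure (goe_law d)"
  proof -
    interpret spiked_goe d 0 by unfold_locales (rule d)
    show ?thesis unfolding noise_eq_goe_law[symmetric] by unfold_locales
  qed
  interpret W: sigma_finite_measure "goe_law d" by (rule sig)
  interpret G: prob_space ?\<gamma> by (rule prob_space_spike_law[OF d])
  have meas_y[measurable]: "(\<lambda>y. goe_matrix y i j) \<in> borel_measurable (goe_law d)" if "i < d" "j < d" for i j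
  proof -
    interpret spiked_goe d 0 by unfold_locales (rule d)
    show ?thesis
      unfolding goe_matrix_def noise_eq_goe_law[symmetric]
      by (rule component_measurable) (use that in \<open>auto simp: upper_def\<close>)
  qed
  have L_u[measurable]: "L y \<in> borel_measurable ?\<gamma>" for y
    unfolding L_def by measurable
  have eq: "spiked_goe.cross d m r = (\<integral>y. (\<Sum>i<d. \<Sum>j<d. (\<integral>g. sh m g i * sh m g j * L y (sh m g) \<partial>?\<gamma>)\<^sup>2)
      / (\<integral>g. L y (sh m g) \<partial>?\<gamma>) \<partial>goe_law d)" for m
  proof -
    interpret spiked_goe d m by unfold_locales (rule d)
    have lik: "lik r y = L y" for y
      by (simp add: lik_eq L_def sqnorm_def fun_eq_iff)
    have tr: "(\<integral>u. F u \<partial>spike_law d m) = (\<integral>g. F (sh m g) \<partial>?\<gamma>)" if "F \<in> borel_measurable ?\<gamma>" for F :: "_ \<Rightarrow> real"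
      unfolding spike_law_shift[OF d, of m] sh_def[symmetric] by (rule integral_distr[OF sh_meas that])
    have n: "(\<integral>u. u i * u j * L y u \<partial>spike_law d m) = (\<integral>g. sh m g i * sh m g j * L y (sh m g) \<partial>?\<gamma>)"
      if "i < d" "j < d" for i j y
      using that by (intro tr) measurable
    show ?thesis
      unfolding cross_eq_integral lik
      by (intro Bochner_Integration.integral_cong refl arg_cong2[where f="(/)"] sum.cong
          arg_cong[where f="\<lambda>x::real. x\<^sup>2"] n tr[OF L_u]) auto
  qed
  have sh1: "(\<lambda>(z, g). sh (fst z) g i) \<in> borel_measurable ((borel \<Otimes>\<^sub>M goe_law d) \<Otimes>\<^sub>M ?\<gamma>)" if "i < d" for i
    unfolding sh_def using that by (simp add: case_prod_beta')
  have L1: "(\<lambda>(z, g). L (snd z) (sh (fst z) g)) \<in> borel_measurable ((borel \<Otimes>\<^sub>M goe_law d) \<Otimes>\<^sub>M ?\<gamma>)"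
    unfolding L_def case_prod_beta'
    by (intro borel_measurable_exp[THEN measurable_compose[rotated]] borel_measurable_diff borel_measurable_times borel_measurable_const
        borel_measurable_sum borel_measurable_power)
      (use sh1 in \<open>auto simp: case_prod_beta' intro!: measurable_compose[OF measurable_fst] measurable_compose[OF measurable_snd]\<close>)
  have N1: "(\<lambda>(z, g). sh (fst z) g i * sh (fst z) g j * L (snd z) (sh (fst z) g)) \<in> borel_measurable ((borel \<Otimes>\<^sub>M goe_law d) \<Otimes>\<^sub>M ?\<gamma>)"
    if "i < d" "j < d" for i j
    using sh1[OF that(1)] sh1[OF that(2)] L1 unfolding case_prod_beta' by (intro borel_measurable_times)
  have "(\<lambda>(m, y). (\<Sum>i<d. \<Sum>j<d. (\<integral>g. sh m g i * sh m g j * L y (sh m g) \<partial>?\<gamma>)\<^sup>2) / (\<integral>g. L y (sh m g) \<partial>?\<gamma>))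
      \<in> borel_measurable (borel \<Otimes>\<^sub>M goe_law d)"
    unfolding case_prod_beta'
    using G.borel_measurable_lebesgue_integral[OF N1] G.borel_measurable_lebesgue_integral[OF L1]
    by (intro borel_measurable_divide borel_measurable_sum borel_measurable_power) auto
  then show ?thesis
    unfolding eq by (rule W.borel_measurable_lebesgue_integral)
qed

text \<open>The positive root of the quadratic satisfied in the limit by the squared length of the
  posterior mean, after division by \<open>\<rho>\<close>.\<close>

definition fixed_point :: "real \<Rightarrow> real \<Rightarrow> real" where
  "fixed_point \<rho> m = ((1 + m\<^sup>2 - 1 / \<rho>) + sqrt ((1 + m\<^sup>2 - 1 / \<rho>)\<^sup>2 + 4 * m\<^sup>2 / \<rho>)) / 2"

text \<open>The first summand of the bound is the positive part of
  \<open>1 + m\<^sup>2 - 1 / \<rho>\<close>. It is stated this way because the sandwich also visits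
  ratios below 1, where that number can be negative.\<close>

lemma fixed_point_props:
  assumes \<rho>: "\<rho> > 0" and m: "m > 0"
  shows "0 < fixed_point \<rho> m"
    and "\<rho> * (fixed_point \<rho> m)\<^sup>2 + (1 - \<rho> * (1 + m\<^sup>2)) * fixed_point \<rho> m - m\<^sup>2 = 0"
    and "fixed_point \<rho> m \<le> (\<bar>1 + m\<^sup>2 - 1 / \<rho>\<bar> + (1 + m\<^sup>2 - 1 / \<rho>)) / 2 + m / sqrt \<rho>"
proof -
  define A where "A = 1 + m\<^sup>2 - 1 / \<rho>"
  define s where "s = sqrt (A\<^sup>2 + 4 * m\<^sup>2 / \<rho>)"
  have p: "4 * m\<^sup>2 / \<rho> > 0" using \<rho> m by simp
  have "sqrt (A\<^sup>2) < s" unfolding s_def using p by (intro real_sqrt_less_mono) simp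
  then have s: "\<bar>A\<bar> < s" by simp
  have fp: "fixed_point \<rho> m = (A + s) / 2" by (simp add: fixed_point_def A_def s_def)
  show "0 < fixed_point \<rho> m" unfolding fp using s by (simp add: abs_less_iff)
  have s2: "s\<^sup>2 = A\<^sup>2 + 4 * m\<^sup>2 / \<rho>" unfolding s_def using p by (intro real_sqrt_pow2 add_nonneg_nonneg) auto
  have "\<rho> * ((A + s) / 2)\<^sup>2 - \<rho> * A * ((A + s) / 2) - m\<^sup>2 = \<rho> / 4 * (s\<^sup>2 - A\<^sup>2) - m\<^sup>2"
    by (simp add: power2_eq_square field_simps)
  also have "\<dots> = 0" unfolding s2 using \<rho> by simp
  finally have "\<rho> * ((A + s) / 2)\<^sup>2 - \<rho> * A * ((A + s) / 2) - m\<^sup>2 = 0" .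
  moreover have "1 - \<rho> * (1 + m\<^sup>2) = - (\<rho> * A)" using \<rho> by (simp add: A_def field_simps)
  ultimately show "\<rho> * (fixed_point \<rho> m)\<^sup>2 + (1 - \<rho> * (1 + m\<^sup>2)) * fixed_point \<rho> m - m\<^sup>2 = 0"
    unfolding fp by simp
  have "s \<le> sqrt (A\<^sup>2) + sqrt (4 * m\<^sup>2 / \<rho>)"
    unfolding s_def using p by (intro sqrt_add_le_add_sqrt) auto
  also have "sqrt (4 * m\<^sup>2 / \<rho>) = 2 * (m / sqrt \<rho>)"
    using m by (simp add: real_sqrt_divide real_sqrt_mult)
  finally have le: "s \<le> \<bar>A\<bar> + 2 * (m / sqrt \<rho>)" unfolding real_sqrt_abs .
  have "(a + x) / 2 \<le> (t + a) / 2 + b" if "x \<le> t + 2 * b" for a x t b :: real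
    using that by (simp add: field_simps)
  from this[OF le] show "fixed_point \<rho> m \<le> (\<bar>1 + m\<^sup>2 - 1 / \<rho>\<bar> + (1 + m\<^sup>2 - 1 / \<rho>)) / 2 + m / sqrt \<rho>"
    unfolding fp A_def[symmetric] .
qed

text \<open>The ratios found above and below \<open>\<rho>\<close> bracket it, and their roots
  differ little from the one at \<open>(\<rho>, \<mu>)\<close> by continuity in both arguments. Half
  of \<open>\<eta>\<close> is spent on this continuity, half on \<open>cross_rate\<close>.\<close>

lemma cross_check_uniform_limit:
  assumes \<rho>: "\<rho> \<ge> 1" and \<mu>: "\<mu> > 0" and \<eta>: "\<eta> > 0"
  shows "\<exists>h>0. \<forall>\<^sub>F d in sequentially. \<forall>m. \<bar>m - \<mu>\<bar> \<le> h \<longrightarrow> \<bar>cross_check d \<rho> m - (fixed_point \<rho> \<mu>)\<^sup>2\<bar> \<le> \<eta>"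
proof -
  let ?L = "(fixed_point \<rho> \<mu>)\<^sup>2"
  have "isCont (\<lambda>p. (fixed_point (fst p) (snd p))\<^sup>2) (\<rho>, \<mu>)"
    unfolding fixed_point_def using \<rho> by (intro continuous_intros) auto
  then obtain \<delta> where \<delta>: "\<delta> > 0"
    and close: "\<And>p. dist p (\<rho>, \<mu>) < \<delta> \<Longrightarrow> dist ((fixed_point (fst p) (snd p))\<^sup>2) ?L < \<eta> / 2"
    using \<eta> unfolding continuous_at_eps_delta by (metis fst_conv snd_conv half_gt_zero)
  \<comment> \<open>The quarters of \<open>\<delta>\<close> keep the pair of ratio and mean inside
    the continuity ball; \<open>1 / 2\<close> keeps all ratios at least \<open>1 / 2\<close>, and in
    \<open>h\<close> the bound \<open>\<mu> / 2\<close> keeps the means positive.\<close>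
  define \<epsilon> where "\<epsilon> = min (\<delta> / 4) (1 / 2)"
  define h where "h = min (\<delta> / 4) (\<mu> / 2)"
  have e: "\<epsilon> > 0" "\<epsilon> \<le> 1 / 2" and h: "h > 0" "h \<le> \<mu> / 2" using \<delta> \<mu> by (auto simp: \<epsilon>_def h_def)
  have close': "\<bar>(fixed_point x m)\<^sup>2 - ?L\<bar> < \<eta> / 2" if "\<bar>x - \<rho>\<bar> \<le> \<epsilon>" "\<bar>m - \<mu>\<bar> \<le> h" for x m
  proof -
    have "dist (x, m) (\<rho>, \<mu>) \<le> \<bar>x - \<rho>\<bar> + \<bar>m - \<mu>\<bar>"
      unfolding dist_Pair_Pair dist_real_def
      using sqrt_sum_squares_le_sum_abs[of "x - \<rho>" "m - \<mu>"] by simp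
    also have "\<dots> < \<delta>" using that \<delta> unfolding \<epsilon>_def h_def by linarith
    finally show ?thesis using close[of "(x, m)"] by (simp add: dist_real_def)
  qed
  define m\<^sub>1 m\<^sub>2 where "m\<^sub>1 = \<mu> / 2" and "m\<^sub>2 = 2 * \<mu>"
  define B where "B = moment_bound m\<^sub>2"
  \<comment> \<open>A bound for \<open>fixed_point x m\<close> when \<open>x \<ge> 1 / 2\<close> and
    \<open>m \<le> m\<^sub>2\<close>: the positive part is at most \<open>1 + m\<^sup>2\<close>, and
    \<open>m / sqrt x\<close> is at most \<open>2 * m\<^sub>2\<close>.\<close>
  define Q where "Q = 4 + m\<^sub>2\<^sup>2 + 2 * m\<^sub>2"
  define R where "R = \<rho> + 1"
  have ev: "\<forall>\<^sub>F d in sequentially. d > 0 \<and> cross_rate B \<epsilon> m\<^sub>1 m\<^sub>2 Q R d < \<eta> / 2"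
    using order_tendstoD(2)[OF cross_rate_tendsto, of "\<eta> / 2" B \<epsilon> m\<^sub>1 m\<^sub>2 Q R] \<eta> eventually_gt_at_top[of 0]
    by (auto intro: eventually_conj)
  have "\<forall>\<^sub>F d in sequentially. \<forall>m. \<bar>m - \<mu>\<bar> \<le> h \<longrightarrow> \<bar>cross_check d \<rho> m - ?L\<bar> \<le> \<eta>"
    using ev
  proof eventually_elim
    case (elim d)
    show ?case
    proof (intro allI impI)
      fix m assume mh: "\<bar>m - \<mu>\<bar> \<le> h"
      then have m: "m\<^sub>1 \<le> m" "m \<le> m\<^sub>2" "0 < m\<^sub>1" using h \<mu> unfolding m\<^sub>1_def m\<^sub>2_def by linarith+
      interpret spiked_goe d m by unfold_locales (use elim in simp)
      have B: "prior_moment \<le> B" unfolding prior_moment_def B_def using m by (intro sqnorm_moment_bound) auto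
      have fp: "0 < fixed_point x m \<and> fixed_point x m \<le> Q \<and>
          x * (fixed_point x m)\<^sup>2 + (1 - x * (1 + m\<^sup>2)) * fixed_point x m - m\<^sup>2 = 0" if x: "x \<ge> 1 / 2" for x
      proof -
        have mp: "m > 0" and xp: "x > 0" using m x by auto
        have ix: "1 / x \<le> 2" "0 < 1 / x" using x by (auto simp: field_simps)
        have "1 / 4 \<le> x" using x by simp
        then have "sqrt (1 / 4) \<le> sqrt x" by (rule real_sqrt_le_mono)
        then have sx: "1 / 2 \<le> sqrt x" by (simp add: real_sqrt_divide)
        have "m / sqrt x \<le> m / (1 / 2)" using sx mp xp by (intro divide_left_mono) auto
        then have t1: "m / sqrt x \<le> 2 * m\<^sub>2" using m by simp
        have "(\<bar>a\<bar> + a) / 2 \<le> c" if "a \<le> c" "0 \<le> c" for a c :: real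
          using that by (cases "a \<ge> 0") auto
        from this[of "1 + m\<^sup>2 - 1 / x" "1 + m\<^sup>2"]
        have t2: "(\<bar>1 + m\<^sup>2 - 1 / x\<bar> + (1 + m\<^sup>2 - 1 / x)) / 2 \<le> 1 + m\<^sup>2" using ix by simp
        have t3: "m\<^sup>2 \<le> m\<^sub>2\<^sup>2" using m by (intro power_mono) auto
        have "f \<le> 4 + M + 2 * n" if "f \<le> a + b" "b \<le> 2 * n" "a \<le> 1 + k" "k \<le> M" for f a b n k M :: real
          using that by linarith
        from this[OF fixed_point_props(3)[OF xp mp] t1 t2 t3] have "fixed_point x m \<le> Q" unfolding Q_def .
        then show ?thesis using fixed_point_props(1,2)[OF xp mp] by blast
      qed
      have mono1: "cross_check d \<rho> m = cross (sqrt \<rho>)" by (rule cross_check_eq_cross)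
      \<comment> \<open>One good ratio on each side of \<open>\<rho>\<close>: here in an interval
        starting at \<open>\<rho>\<close>, next in one ending there.\<close>
      obtain x where x: "x \<in> {\<rho>..\<rho> + \<epsilon>}" and cx: "\<bar>cross (sqrt x) - (fixed_point x m)\<^sup>2\<bar> \<le> cross_rate B \<epsilon> m\<^sub>1 m\<^sub>2 Q R d"
        using exists_cross_close[of \<rho> \<epsilon> R m\<^sub>1 m\<^sub>2 B "\<lambda>x. fixed_point x m" Q] \<rho> e m B fp unfolding R_def by auto
      obtain x' where x': "x' \<in> {\<rho> - \<epsilon>..\<rho> - \<epsilon> + \<epsilon>}" and cx': "\<bar>cross (sqrt x') - (fixed_point x' m)\<^sup>2\<bar> \<le> cross_rate B \<epsilon> m\<^sub>1 m\<^sub>2 Q R d"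
        using exists_cross_close[of "\<rho> - \<epsilon>" \<epsilon> R m\<^sub>1 m\<^sub>2 B "\<lambda>x. fixed_point x m" Q] \<rho> e m B fp unfolding R_def by auto
      have "cross (sqrt \<rho>) \<le> cross (sqrt x)" using \<rho> x by (intro cross_mono) auto
      moreover have "cross (sqrt x') \<le> cross (sqrt \<rho>)" using \<rho> x' e by (intro cross_mono) auto
      moreover have "\<bar>(fixed_point x m)\<^sup>2 - ?L\<bar> < \<eta> / 2" using x e by (intro close' mh) auto
      moreover have "\<bar>(fixed_point x' m)\<^sup>2 - ?L\<bar> < \<eta> / 2" using x' e by (intro close' mh) auto
      ultimately show "\<bar>cross_check d \<rho> m - ?L\<bar> \<le> \<eta>"
        unfolding mono1 using cx cx' elim by linarith
    qed
  qed
  then show ?thesis using h(1) by blast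
qed

text \<open>Inside the truncation window \<open>close\<close> applies. Outside it the integrand is 0
  and the error is \<open>L\<close>, paid for as in Chebyshev's inequality: there
  \<open>sqrt (real d) * (sqnorm x - 1)\<^sup>2\<close> is at least 1, and its mean is
  \<open>2 / sqrt (real d)\<close>.\<close>

lemma truncated_cross_deviation:
  assumes d: "d > 0" and L: "0 \<le> L" and \<eta>: "0 \<le> \<eta>"
    and close: "\<And>m. \<bar>m - \<mu>\<bar> \<le> \<bar>\<mu>\<bar> * real d powr (-1/4) \<Longrightarrow> \<bar>cross_check d \<rho> m - L\<bar> \<le> \<eta>"
  shows "\<bar>truncated_cross \<rho> \<mu> d - L\<bar> \<le> \<eta> + L * (2 / sqrt (real d))"
proof -
  interpret spiked_goe d 0 by unfold_locales (rule d)
  let ?t = "real d powr (-1/4)"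
  let ?f = "\<lambda>x. (if \<bar>euclid_norm d x - 1\<bar> \<le> ?t then 1 else 0) * cross_check d \<rho> (\<mu> * euclid_norm d x)"
  let ?b = "\<lambda>x. \<eta> + L * (sqrt (real d) * (sqnorm x - 1)\<^sup>2)"
  have iso: "iso_gauss d = \<gamma>" by (simp add: iso_gauss_def spike_law_def)
  have norm: "euclid_norm d x = sqrt (sqnorm x)" for x by (simp add: euclid_norm_def sqnorm_def)
  have t2: "?t\<^sup>2 * sqrt (real d) = 1"
  proof -
    have "?t\<^sup>2 = real d powr (-1/4 + -1/4)" unfolding power2_eq_square by (rule powr_add[symmetric])
    also have "\<dots> = inverse (sqrt (real d))" by (simp add: powr_minus powr_half_sqrt)
    finally show ?thesis using d by simp
  qed
  have meas: "(\<lambda>x. ?f x) \<in> borel_measurable \<gamma>"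
  proof -
    have n[measurable]: "(\<lambda>x. euclid_norm d x) \<in> borel_measurable \<gamma>"
      unfolding norm using moments_measurable[OF moments_sqnorm] by measurable
    have c: "(\<lambda>m. cross_check d \<rho> m) \<in> borel_measurable borel"
      using cross_measurable[OF d, of "sqrt \<rho>"] spiked_goe.cross_check_eq_cross[of d] d
      by (simp add: spiked_goe_def)
    have "(\<lambda>x. cross_check d \<rho> (\<mu> * euclid_norm d x)) \<in> borel_measurable \<gamma>"
      by (rule measurable_compose[OF _ c]) measurable
    then show ?thesis by measurable
  qed
  have point: "\<bar>?f x - L\<bar> \<le> ?b x" for x
  proof (cases "\<bar>euclid_norm d x - 1\<bar> \<le> ?t")
    case True
    have "\<bar>\<mu> * euclid_norm d x - \<mu>\<bar> = \<bar>\<mu>\<bar> * \<bar>euclid_norm d x - 1\<bar>"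
      by (simp add: abs_mult[symmetric] algebra_simps)
    also have "\<dots> \<le> \<bar>\<mu>\<bar> * ?t" using True by (rule mult_left_mono) simp
    finally have "\<bar>cross_check d \<rho> (\<mu> * euclid_norm d x) - L\<bar> \<le> \<eta>" by (rule close)
    moreover have "0 \<le> L * (sqrt (real d) * (sqnorm x - 1)\<^sup>2)" using L by simp
    ultimately show ?thesis using True by simp
  next
    case False
    have s: "sqrt (sqnorm x) * sqrt (sqnorm x) = sqnorm x" by (simp add: sqnorm_nonneg)
    \<comment> \<open>Passing from the norm to its square: the factor
      \<open>euclid_norm d x + 1\<close> is at least 1, and the square is the quantity whose
      variance is known.\<close>
    have "\<bar>euclid_norm d x - 1\<bar> * 1 \<le> \<bar>euclid_norm d x - 1\<bar> * (euclid_norm d x + 1)"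
      by (intro mult_left_mono) (auto simp: norm sqnorm_nonneg)
    also have "\<dots> = \<bar>(euclid_norm d x - 1) * (euclid_norm d x + 1)\<bar>"
      by (simp add: abs_mult norm sqnorm_nonneg)
    also have "(euclid_norm d x - 1) * (euclid_norm d x + 1) = sqnorm x - 1"
      using s by (simp add: norm algebra_simps)
    finally have "?t \<le> \<bar>sqnorm x - 1\<bar>" using False by simp
    then have "?t\<^sup>2 \<le> (sqnorm x - 1)\<^sup>2" using power_mono[of ?t "\<bar>sqnorm x - 1\<bar>" 2] by simp
    then have "?t\<^sup>2 * sqrt (real d) \<le> (sqnorm x - 1)\<^sup>2 * sqrt (real d)" by (rule mult_right_mono) simp
    then have "1 \<le> sqrt (real d) * (sqnorm x - 1)\<^sup>2" unfolding t2 by (simp add: mult.commute)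
    then have "L * 1 \<le> L * (sqrt (real d) * (sqnorm x - 1)\<^sup>2)" using L by (rule mult_left_mono)
    then show ?thesis using False L \<eta> by simp
  qed
  have ib: "integrable \<gamma> ?b"
    by (intro moments_integrable moments_intros moments_sqnorm)
  have "integrable \<gamma> (\<lambda>x. ?f x - L)"
  proof (rule Bochner_Integration.integrable_bound[OF ib])
    show "(\<lambda>x. ?f x - L) \<in> borel_measurable \<gamma>" by (intro borel_measurable_diff meas borel_measurable_const)
    show "AE x in \<gamma>. norm (?f x - L) \<le> norm (?b x)"
      unfolding real_norm_def by (intro AE_I2 order_trans[OF point abs_ge_self])
  qed
  then have "integrable \<gamma> (\<lambda>x. (?f x - L) + L)" by (rule Bochner_Integration.integrable_add) simp
  then have fi: "integrable \<gamma> ?f" by simp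
  have "\<bar>truncated_cross \<rho> \<mu> d - L\<bar> = \<bar>\<integral>x. ?f x - L \<partial>\<gamma>\<bar>"
    unfolding truncated_cross_def iso using fi prob_space by (subst Bochner_Integration.integral_diff) auto
  also have "\<dots> \<le> (\<integral>x. \<bar>?f x - L\<bar> \<partial>\<gamma>)" by (rule integral_abs_bound)
  also have "\<dots> \<le> (\<integral>x. ?b x \<partial>\<gamma>)"
    using fi by (intro integral_mono ib point) auto
  also have "\<dots> = \<eta> + L * (sqrt (real d) * (\<integral>x. (sqnorm x - 1)\<^sup>2 \<partial>\<gamma>))"
  proof -
    have "integrable \<gamma> (\<lambda>x. (sqnorm x - 1)\<^sup>2)" by (intro moments_integrable moments_intros moments_sqnorm)
    then show ?thesis using prob_space by simp
  qed
  also have "(\<integral>x. (sqnorm x - 1)\<^sup>2 \<partial>\<gamma>) = 2 / real d" using sqnorm_variance by simp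
  also have "sqrt (real d) * (2 / real d) = 2 / sqrt (real d)"
    using d by (simp add: field_simps)
  finally show ?thesis .
qed

lemma truncated_cross_tendsto:
  assumes \<rho>: "\<rho> \<ge> 1" and \<mu>: "\<mu> > 0"
  shows "truncated_cross \<rho> \<mu> \<longlonglongrightarrow> (fixed_point \<rho> \<mu>)\<^sup>2"
proof (rule tendstoI)
  fix e :: real assume e: "e > 0"
  let ?L = "(fixed_point \<rho> \<mu>)\<^sup>2"
  obtain h where h: "h > 0"
    and ev: "\<forall>\<^sub>F d in sequentially. \<forall>m. \<bar>m - \<mu>\<bar> \<le> h \<longrightarrow> \<bar>cross_check d \<rho> m - ?L\<bar> \<le> e / 2"
    using cross_check_uniform_limit[OF \<rho> \<mu>, of "e / 2"] e by auto
  have "(\<lambda>d. \<bar>\<mu>\<bar> * real d powr (-1/4)) \<longlonglongrightarrow> 0"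
    by (intro tendsto_mult_right_zero tendsto_neg_powr filterlim_real_sequentially) simp
  then have ev1: "\<forall>\<^sub>F d in sequentially. \<bar>\<mu>\<bar> * real d powr (-1/4) < h"
    using h by (rule order_tendstoD(2))
  have "(\<lambda>d. ?L * (2 / sqrt (real d))) \<longlonglongrightarrow> 0"
    by (intro tendsto_mult_right_zero tendsto_divide_0[OF tendsto_const]
        filterlim_at_top_imp_at_infinity filterlim_compose[OF sqrt_at_top filterlim_real_sequentially])
  then have ev2: "\<forall>\<^sub>F d in sequentially. ?L * (2 / sqrt (real d)) < e / 2"
    using e by (intro order_tendstoD(2)) auto
  show "\<forall>\<^sub>F d in sequentially. dist (truncated_cross \<rho> \<mu> d) ?L < e"
    using ev ev1 ev2 eventually_gt_at_top[of 0]
  proof eventually_elim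
    case (elim d)
    have "\<bar>truncated_cross \<rho> \<mu> d - ?L\<bar> \<le> e / 2 + ?L * (2 / sqrt (real d))"
      using elim e by (intro truncated_cross_deviation) auto
    then show ?case using elim(3) by (simp add: dist_real_def)
  qed
qed

theorem theorem5:
  fixes \<rho> \<mu> :: real
  assumes "\<rho> \<ge> 1" and "\<mu> > 0"
  shows "\<exists>L. (truncated_cross \<rho> \<mu> \<longlonglongrightarrow> L) \<and>
             L \<le> (1 + \<mu>\<^sup>2 - 1 / \<rho> + \<bar>\<mu>\<bar> / sqrt \<rho>)\<^sup>2"
proof (intro exI conjI)
  show "truncated_cross \<rho> \<mu> \<longlonglongrightarrow> (fixed_point \<rho> \<mu>)\<^sup>2"
    by (rule truncated_cross_tendsto[OF assms])
  \<comment> \<open>At the ratio \<open>\<rho> \<ge> 1\<close> the number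
    \<open>1 + \<mu>\<^sup>2 - 1 / \<rho>\<close> is nonnegative, so it equals its positive part in
    \<open>fixed_point_props\<close>.\<close>
  have \<rho>: "\<rho> > 0" and "1 / \<rho> \<le> 1" using assms by auto
  then have A: "0 \<le> 1 + \<mu>\<^sup>2 - 1 / \<rho>" by (simp add: add_increasing2 diff_le_eq)
  have "fixed_point \<rho> \<mu> \<le> 1 + \<mu>\<^sup>2 - 1 / \<rho> + \<bar>\<mu>\<bar> / sqrt \<rho>"
  proof -
    have "(\<bar>a\<bar> + a) / 2 = a" if "0 \<le> a" for a :: real using that by simp
    from fixed_point_props(3)[OF \<rho> assms(2), unfolded this[OF A]] assms(2) show ?thesis by simp
  qed
  then show "(fixed_point \<rho> \<mu>)\<^sup>2 \<le> (1 + \<mu>\<^sup>2 - 1 / \<rho> + \<bar>\<mu>\<bar> / sqrt \<rho>)\<^sup>2"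
    using fixed_point_props(1)[OF \<rho> assms(2)] by (intro power_mono) auto
qed

end
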